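(* Suppose that $f$ is $L_f$-smooth (not necessarily convex) and that the condition number of $A$ is $\kappa_A$. Consider the inexact proximal point method for non-convex problems described in the context, let $x_1^\star$ be the exact solution of its first subproblem, assume $F(x_1^\star)-\inf_xF(x)\le\Delta'$, and take $\delta_k=\frac{\sqrt{\Delta'/L_f}}{2k}$. Then, in order to find an approximate solution $x_T$ satisfying $\mathrm{SubOpt}_{\mathsf{NC}}(x_T)\le\epsilon$, the total number of gradient evaluations of this method is bounded by $$\tilde O\left(\frac{\kappa_AL_f\Delta'}{\epsilon^2}\right).$$ Furthermore, if $x_0\in\mathrm{dom}\,F$ and $F(x_0)-\inf_xF(x)\le\Delta$ (with $\Delta'=\Delta$ in the choice of $\delta_k$), the total number is bounded by $\tilde O\left(\frac{\kappa_AL_f\Delta}{\epsilon^2}\right)$.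
   Context: Problem: $\min_{x\in\mathbb{R}^n}F(x):=f(x)+h(Ax-b)$, where $f:\mathbb{R}^n\to\mathbb{R}$ is differentiable with $L_f$-Lipschitz gradient, $h:\mathbb{R}^m\to\mathbb{R}\cup\{+\infty\}$ is proper closed convex with computable proximal operator, $A\in\mathbb{R}^{m\times n}$ has full row rank, $L_A=\|A\|$, $\mu_A$ is its minimal singular value, $\kappa_A=L_A/\mu_A$. Here $h^\star$ is the convex conjugate and $\mathrm{prox}_g(x)=\arg\min_u\{g(u)+\frac12\|x-u\|^2\}$. Suboptimality measure: $\mathrm{SubOpt}_{\mathsf{NC}}(x):=L_f\left\|x-\mathrm{prox}_{\frac1{2L_f}h(A\cdot-b)}\left(x-\frac1{2L_f}\nabla f(x)\right)\right\|$. Inexact proximal point method for non-convex problems (outer loop): given $x_0$, for $k=1,\dots,T$ apply the inner solver below to $\min_x\{F(x)+L_f\|x-x_{k-1}\|^2\}$ (smooth part $f(\cdot)+L_f\|\cdot-x_{k-1}\|^2$), whose exact solution is $x_k^\star$, to obtain $x_k$ with $\|x_k-x_k^\star\|\le\delta_k$. The output is $\{x_k\}_{k=1}^T$; finding $x_T$ with $\mathrm{SubOpt}_{\mathsf{NC}}\le\epsilon$ means that some iterate of the output has this property. Inner solver (Inexact PPA for $\min_x\phi(x)+h(Ax-b)$ with $\phi$ $L$-smooth and $\mu$-strongly convex): input $x_0,\lambda_0$, $\ell\ge\mu_\Phi:=\mu_A^2/L$ (suitably chosen), $D>0$; let $\rho=\frac{\mu_\Phi}{12\ell}$, $\delta_j=(1-\rho)^{j/2}D$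 (inner tolerances). For $j=1,2,\dots$: with $\Psi_j(x)=\phi(x)+\max_\lambda\{\lambda^{\mathrm T}(Ax-b)-h^\star(\lambda)-\frac\ell2\|\lambda-\lambda_{j-1}\|^2\}$, which is $(L+L_A^2/\ell)$-smooth and $\mu$-strongly convex, let $x_j=\mathrm{AGD}(\Psi_j,x_{j-1},\delta_j)$ and $\lambda_j=\mathrm{prox}_{h^\star/\ell}(\lambda_{j-1}+\frac{Ax_j-b}\ell)$. $\mathrm{AGD}(\Psi,y_0,\delta)$ for $L$-smooth $\mu$-strongly convex $\Psi$: $\theta=\frac{\sqrt{L/\mu}-1}{\sqrt{L/\mu}+1}$, $y_{-1}=y_0$; iterate $\tilde y_{k+1}=y_k+\theta(y_k-y_{k-1})$, $y_{k+1}=\tilde y_{k+1}-\frac1L\nabla\Psi(\tilde y_{k+1})$ until $\|\nabla\Psi(y_T)\|\le\mu\delta$; output $y_T$. $\tilde O$ hides universal constants and logarithmic factors in the problem parameters, initial distances and $1/\epsilon$. Gradient evaluations are evaluations of $\nabla f$.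
   Formalization: The bound is proved with max(κ_A, κ_A L_f Δ/ε²) in place of κ_A L_f Δ/ε² (likewise for Δ'); they agree when ε² ≤ L_f Δ, and for large ε the literal formula tends to 0 although at least one gradient evaluation is always made. *)

theory Defs
  imports "HOL-Analysis.Analysis"
begin

definition gradient :: "('a::real_inner \<Rightarrow> real) \<Rightarrow> 'a \<Rightarrow> 'a" where
  "gradient f x = (THE D. GDERIV f x :> D)"

definition smooth_fun :: "real \<Rightarrow> ('a::euclidean_space \<Rightarrow> real) \<Rightarrow> bool" where
  "smooth_fun L f \<longleftrightarrow> (\<forall>x. f differentiable (at x)) \<and> L-lipschitz_on UNIV (gradient f)"

definition proper_closed_convex :: "('a::euclidean_space \<Rightarrow> ereal) \<Rightarrow> bool" where
  "proper_closed_convex h \<longleftrightarrow>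
     (\<forall>y. h y \<noteq> -\<infinity>) \<and> (\<exists>y. h y \<noteq> \<infinity>) \<and>
     closed {(y, t::real). h y \<le> ereal t} \<and> convex {(y, t::real). h y \<le> ereal t}"

definition conjugate :: "('a::euclidean_space \<Rightarrow> ereal) \<Rightarrow> 'a \<Rightarrow> ereal" where
  "conjugate h w = (SUP y. ereal (w \<bullet> y) - h y)"

definition prox :: "('a::euclidean_space \<Rightarrow> ereal) \<Rightarrow> 'a \<Rightarrow> 'a" where
  "prox g x = arg_min (\<lambda>u. g u + ereal ((norm (x - u))\<^sup>2 / 2)) (\<lambda>_. True)"


text \<open>
  For \<open>A\<close> with \<open>m\<close> rows and full row rank, the \<open>m\<close> singular values are the square roots of the
  eigenvalues of \<open>A A\<^sup>T\<close>.
\<close>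

definition singular_values :: "real^'n^'m \<Rightarrow> real set" where
  "singular_values A =
     {s. 0 \<le> s \<and> (\<exists>v. v \<noteq> 0 \<and> (A ** transpose A) *v v = s\<^sup>2 *\<^sub>R v)}"

definition min_singular :: "real^'n^'m \<Rightarrow> real" where
  "min_singular A = Inf (singular_values A)"

definition op_norm :: "real^'n^'m \<Rightarrow> real" where
  "op_norm A = onorm (\<lambda>x. A *v x)"

definition cond_number :: "real^'n^'m \<Rightarrow> real" where
  "cond_number A = op_norm A / min_singular A"


definition objective ::
    "(real^'n \<Rightarrow> real) \<Rightarrow> (real^'m \<Rightarrow> ereal) \<Rightarrow> real^'n^'m \<Rightarrow> real^'m \<Rightarrow> real^'n \<Rightarrow> ereal" where
  "objective \<phi> h A b x = ereal (\<phi> x) + h (A *v x - b)"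

definition primal_sol ::
    "(real^'n \<Rightarrow> real) \<Rightarrow> (real^'m \<Rightarrow> ereal) \<Rightarrow> real^'n^'m \<Rightarrow> real^'m \<Rightarrow> real^'n" where
  "primal_sol \<phi> h A b = arg_min (objective \<phi> h A b) (\<lambda>_. True)"

definition dual_objective ::
    "(real^'n \<Rightarrow> real) \<Rightarrow> (real^'m \<Rightarrow> ereal) \<Rightarrow> real^'n^'m \<Rightarrow> real^'m \<Rightarrow> real^'m \<Rightarrow> ereal" where
  "dual_objective \<phi> h A b w =
     (INF x. ereal (\<phi> x + w \<bullet> (A *v x - b))) - conjugate h w"

definition dual_sol ::
    "(real^'n \<Rightarrow> real) \<Rightarrow> (real^'m \<Rightarrow> ereal) \<Rightarrow> real^'n^'m \<Rightarrow> real^'m \<Rightarrow> real^'m" where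
  "dual_sol \<phi> h A b = arg_max (dual_objective \<phi> h A b) (\<lambda>_. True)"

definition subopt_nc ::
    "real \<Rightarrow> (real^'n \<Rightarrow> real) \<Rightarrow> (real^'m \<Rightarrow> ereal) \<Rightarrow> real^'n^'m \<Rightarrow> real^'m \<Rightarrow> real^'n \<Rightarrow> real" where
  "subopt_nc Lf f h A b x =
     Lf * norm (x - prox (\<lambda>u. ereal (1 / (2 * Lf)) * h (A *v u - b))
                         (x - (1 / (2 * Lf)) *\<^sub>R gradient f x))"


subsection \<open>Accelerated gradient descent\<close>

text \<open>The state is the pair \<open>(y\<^sub>k, y\<^sub>k\<^sub>-\<^sub>1)\<close>.\<close>

primrec agd_state ::
    "('a::euclidean_space \<Rightarrow> real) \<Rightarrow> real \<Rightarrow> real \<Rightarrow> 'a \<Rightarrow> nat \<Rightarrow> 'a \<times> 'a" where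
  "agd_state \<Psi> L \<mu> y0 0 = (y0, y0)"
| "agd_state \<Psi> L \<mu> y0 (Suc k) =
     (let \<theta> = (sqrt (L / \<mu>) - 1) / (sqrt (L / \<mu>) + 1);
          y = fst (agd_state \<Psi> L \<mu> y0 k);
          y' = snd (agd_state \<Psi> L \<mu> y0 k);
          z = y + \<theta> *\<^sub>R (y - y')
      in (z - (1 / L) *\<^sub>R gradient \<Psi> z, y))"

text \<open>AGD stops, for the first time, after \<open>t\<close> steps, with output \<open>y\<close>.\<close>

definition agd_returns ::
    "('a::euclidean_space \<Rightarrow> real) \<Rightarrow> real \<Rightarrow> real \<Rightarrow> 'a \<Rightarrow> real \<Rightarrow> nat \<Rightarrow> 'a \<Rightarrow> bool" where
  "agd_returns \<Psi> L \<mu> y0 \<delta> t y \<longleftrightarrow>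
     y = fst (agd_state \<Psi> L \<mu> y0 t) \<and>
     norm (gradient \<Psi> y) \<le> \<mu> * \<delta> \<and>
     (\<forall>s<t. norm (gradient \<Psi> (fst (agd_state \<Psi> L \<mu> y0 s))) > \<mu> * \<delta>)"

text \<open>
  A run with \<open>t\<close> steps evaluates the gradient at the \<open>t\<close> extrapolated points and, for the stopping
  test, at \<open>y\<^sub>0, \<dots>, y\<^sub>t\<close>. In the inner solver every such evaluation costs one evaluation
  of the gradient of \<open>f\<close>.
\<close>

definition agd_cost :: "nat \<Rightarrow> nat" where
  "agd_cost t = 2 * t + 1"


subsection \<open>Inner solver (inexact PPA)\<close>

definition ppa_model ::
    "(real^'n \<Rightarrow> real) \<Rightarrow> (real^'m \<Rightarrow> ereal) \<Rightarrow> real^'n^'m \<Rightarrow> real^'m \<Rightarrow> real \<Rightarrow> real^'m \<Rightarrow> real^'n \<Rightarrow> real" where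
  "ppa_model \<phi> h A b l \<nu> x =
     \<phi> x + real_of_ereal (SUP w. ereal (w \<bullet> (A *v x - b)) - conjugate h w
                                 - ereal (l / 2 * (norm (w - \<nu>))\<^sup>2))"

definition mu_dual :: "real \<Rightarrow> real^'n^'m \<Rightarrow> real" where
  "mu_dual L A = (min_singular A)\<^sup>2 / L"

text \<open>\<open>ts j\<close> is the number of AGD steps in iteration \<open>j\<close>.\<close>

definition ppa_iterates ::
    "(real^'n \<Rightarrow> real) \<Rightarrow> (real^'m \<Rightarrow> ereal) \<Rightarrow> real^'n^'m \<Rightarrow> real^'m \<Rightarrow>
     real \<Rightarrow> real \<Rightarrow> real \<Rightarrow> real \<Rightarrow> real^'n \<Rightarrow> real^'m \<Rightarrow>
     nat \<Rightarrow> (nat \<Rightarrow> real^'n) \<Rightarrow> (nat \<Rightarrow> real^'m) \<Rightarrow> (nat \<Rightarrow> nat) \<Rightarrow> bool" where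
  "ppa_iterates \<phi> h A b L \<mu> l D x0 l0 J xs ls ts \<longleftrightarrow>
     xs 0 = x0 \<and> ls 0 = l0 \<and>
     (\<forall>j\<in>{1..J}.
        agd_returns (ppa_model \<phi> h A b l (ls (j - 1))) (L + (op_norm A)\<^sup>2 / l) \<mu> (xs (j - 1))
          ((1 - mu_dual L A / (12 * l)) powr (real j / 2) * D) (ts j) (xs j) \<and>
        ls j = prox (\<lambda>w. ereal (1 / l) * conjugate h w)
                    (ls (j - 1) + (1 / l) *\<^sub>R (A *v xs j - b)))"

text \<open>
  The inner solver is stopped at the first iterate that is \<open>\<delta>\<close>-close to the exact solution;
  \<open>x\<close> is this iterate and \<open>N\<close> the number of gradient evaluations spent.
\<close>

definition ppa_returns ::
    "(real^'n \<Rightarrow> real) \<Rightarrow> (real^'m \<Rightarrow> ereal) \<Rightarrow> real^'n^'m \<Rightarrow> real^'m \<Rightarrow>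
     real \<Rightarrow> real \<Rightarrow> real \<Rightarrow> real \<Rightarrow> real^'n \<Rightarrow> real^'m \<Rightarrow> real \<Rightarrow> nat \<Rightarrow> real^'n \<Rightarrow> bool" where
  "ppa_returns \<phi> h A b L \<mu> l D x0 l0 \<delta> N x \<longleftrightarrow>
     (\<exists>J xs ls ts.
        ppa_iterates \<phi> h A b L \<mu> l D x0 l0 J xs ls ts \<and> 1 \<le> J \<and> x = xs J \<and>
        norm (x - primal_sol \<phi> h A b) \<le> \<delta> \<and>
        (\<forall>j\<in>{1..<J}. norm (xs j - primal_sol \<phi> h A b) > \<delta>) \<and>
        N = (\<Sum>j=1..J. agd_cost (ts j)))"


subsection \<open>Outer loop (inexact proximal point method)\<close>

definition prox_smooth_part :: "real \<Rightarrow> (real^'n \<Rightarrow> real) \<Rightarrow> real^'n \<Rightarrow> real^'n \<Rightarrow> real" where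
  "prox_smooth_part Lf f c x = f x + Lf * (norm (x - c))\<^sup>2"

text \<open>
  The smooth part of a subproblem is \<open>3 L\<^sub>f\<close>-smooth and \<open>L\<^sub>f\<close>-strongly convex; these are the
  constants given to the inner solver. The \<open>k\<close>-th call starts from \<open>x\<^sub>k\<^sub>-\<^sub>1\<close> and the multiplier
  \<open>lam0 k\<close>; \<open>N\<close> is the total number of gradient evaluations of the first \<open>T\<close> calls.
\<close>

definition ippm_returns ::
    "(real^'n \<Rightarrow> real) \<Rightarrow> (real^'m \<Rightarrow> ereal) \<Rightarrow> real^'n^'m \<Rightarrow> real^'m \<Rightarrow>
     real \<Rightarrow> real \<Rightarrow> real \<Rightarrow> real^'n \<Rightarrow> (nat \<Rightarrow> real^'m) \<Rightarrow> (nat \<Rightarrow> real) \<Rightarrow>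
     nat \<Rightarrow> nat \<Rightarrow> (nat \<Rightarrow> real^'n) \<Rightarrow> bool" where
  "ippm_returns f h A b Lf l D x0 lam0 \<delta> T N xs \<longleftrightarrow>
     xs 0 = x0 \<and>
     (\<exists>Ns. (\<forall>k\<in>{1..T}.
              ppa_returns (prox_smooth_part Lf f (xs (k - 1))) h A b (3 * Lf) Lf l D
                (xs (k - 1)) (lam0 k) (\<delta> k) (Ns k) (xs k)) \<and>
           N = (\<Sum>k=1..T. Ns k))"


subsection \<open>Soft-O\<close>

text \<open>
  \<open>soft_O N B ps\<close>: the count \<open>N\<close> is at most \<open>B\<close> up to a universal constant and a fixed power of the
  logarithm of the (nonnegative) quantities \<open>ps\<close>. The universal constant and the exponent are explicit
  numbers, because an existential quantifier inside a theorem that is polymorphic in the dimensions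
  would let them depend on the dimensions.
\<close>

definition soft_O :: "nat \<Rightarrow> real \<Rightarrow> real list \<Rightarrow> bool" where
  "soft_O N B ps \<longleftrightarrow> real N \<le> 10 ^ 12 * B * (ln (exp 1 + sum_list ps))\<^sup>2"

text \<open>
  \<open>R\<close> bounds the initial distances. The maximum with the condition number of \<open>A\<close>, the cost of a single
  subproblem, only matters if \<open>\<epsilon>\<^sup>2 > L\<^sub>f \<Delta>\<close>: for such large \<open>\<epsilon>\<close> the quotient
  \<open>\<kappa>\<^sub>A L\<^sub>f \<Delta> / \<epsilon>\<^sup>2\<close> can be arbitrarily small, while at least one evaluation is always made.
\<close>

definition finds_within ::
    "(real^'n \<Rightarrow> real) \<Rightarrow> (real^'m \<Rightarrow> ereal) \<Rightarrow> real^'n^'m \<Rightarrow> real^'m \<Rightarrow>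
     real \<Rightarrow> real \<Rightarrow> real \<Rightarrow> real^'n \<Rightarrow> (nat \<Rightarrow> real^'m) \<Rightarrow> real \<Rightarrow> real \<Rightarrow> real \<Rightarrow> bool" where
  "finds_within f h A b Lf l D x0 lam0 R \<Delta> \<epsilon> \<longleftrightarrow>
     (\<exists>T N xs.
        ippm_returns f h A b Lf l D x0 lam0 (\<lambda>k. sqrt (\<Delta> / Lf) / (2 * real k)) T N xs \<and>
        (\<exists>k\<in>{1..T}. subopt_nc Lf f h A b (xs k) \<le> \<epsilon>) \<and>
        soft_O N (max (cond_number A) (cond_number A * Lf * \<Delta> / \<epsilon>\<^sup>2))
          [Lf, 1 / Lf, op_norm A, 1 / min_singular A, \<Delta>, 1 / \<Delta>, 1 / \<epsilon>, D, 1 / D, R])"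

end

theory Submission
  imports Defs
begin

text \<open>
  The inner solver is run with \<open>\<ell> = \<mu>\<^sub>\<Phi> = \<mu>\<^sub>A\<^sup>2 / (3 L\<^sub>f)\<close>. Then the exact proximal step on the dual
  contracts the distance to the optimal multiplier by the factor \<open>3/4\<close>, so with tolerances that decay
  like \<open>(11/12)\<^bsup>j/2\<^esup>\<close> all inner errors decay at that rate, while every model function has condition
  number \<open>3 + 3 \<kappa>\<^sub>A\<^sup>2\<close>, so that AGD needs \<open>O(\<kappa>\<^sub>A log)\<close> steps; a subproblem therefore costs
  \<open>O(\<kappa>\<^sub>A log\<^sup>2)\<close> gradients.

  Iterates need not be feasible, so the descent of the outer loop is tested on the exact solutions:
  \<open>F(x\<^sub>k\<^sup>\<star>) + L\<^sub>f \<parallel>x\<^sub>k\<^sup>\<star> - x\<^sub>k\<^sub>-\<^sub>1\<parallel>\<^sup>2 \<le> F(x\<^sub>k\<^sub>-\<^sub>1\<^sup>\<star>) + L\<^sub>f \<delta>\<^sub>k\<^sub>-\<^sub>1\<^sup>2\<close>. As \<open>\<Sum> \<delta>\<^sub>k\<^sup>2\<close> converges, some \<open>k\<close> in the second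
  half of \<open>T = O(1 + L\<^sub>f \<Delta> / \<epsilon>\<^sup>2)\<close> rounds has both \<open>\<parallel>x\<^sub>k\<^sup>\<star> - x\<^sub>k\<^sub>-\<^sub>1\<parallel>\<close> and \<open>\<delta>\<^sub>k\<close> small, and these control
  the suboptimality of \<open>x\<^sub>k\<close>.
\<close>

subsection \<open>Smooth and strongly convex functions\<close>

text \<open>\<open>gradient\<close>, \<open>prox\<close>, \<open>primal_sol\<close> and
  \<open>dual_sol\<close> are descriptions or choices, so each must be evaluated before anything can
  be estimated: minimisers exist by compactness of sublevel sets in the epigraph and are unique by
  strong convexity; multipliers are unique because the transpose of \<open>A\<close> is injective.
  \<open>finds_within\<close> asks for an actual run, so termination of every loop has to be shown
  along with its cost.

  The obstacle in the outer loop is the multiplier. \<open>R\<close> bounds the distance of each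
  \<open>lam0 k\<close> to the optimal multiplier of the first subproblem, whereas round
  \<open>k\<close> pays for the distance to its own. The exact solutions and their multipliers
  therefore have to be followed through the loop. Their drift is only polynomial in the parameters
  and the number of rounds, and it enters the cost only inside logarithms. Hence the estimates by
  powers of a single number \<open>S\<close>, wasteful but with explicit exponents: the constants in
  \<open>soft_O\<close> are numerals, so no constant may stay unnamed.\<close>

lemma gradient_eqI:
  assumes "GDERIV f x :> D"
  shows "gradient f x = D"
  unfolding gradient_def
proof (rule the_equality)
  fix D' assume "GDERIV f x :> D'"
  then have "(\<lambda>h. inner h D') = (\<lambda>h. inner h D)"
    using assms unfolding gderiv_def by (metis has_derivative_unique)
  then have "inner (D' - D) D' = inner (D' - D) D" by metis
  then have "inner (D' - D) (D' - D) = 0" by (simp add: inner_diff_right)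
  then show "D' = D" by simp
qed (fact assms)

lemma GDERIV_gradient:
  fixes f :: "'a::euclidean_space \<Rightarrow> real"
  assumes "f differentiable (at x)"
  shows "GDERIV f x :> gradient f x"
proof -
  obtain f' where f': "(f has_derivative f') (at x)"
    using assms by (auto simp: differentiable_def)
  then have "linear f'" by (rule has_derivative_linear)
  then have "f' = (\<lambda>h. inner h (adjoint f' 1))"
    using adjoint_works[OF \<open>linear f'\<close>, of _ "1::real"] by (auto simp: fun_eq_iff)
  with f' have "GDERIV f x :> adjoint f' 1" by (simp add: gderiv_def)
  then show ?thesis using gradient_eqI by metis
qed

text \<open>Gradients are recognised below by a two-sided quadratic estimate. This suits the model
  function of the inner solver, whose second term is a supremum with no formula to
  differentiate.\<close>

lemma GDERIV_quadratic_remainder: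
  fixes f :: "'a::euclidean_space \<Rightarrow> real"
  assumes "\<And>y. \<bar>f y - f x - D \<bullet> (y - x)\<bar> \<le> C * (norm (y - x))\<^sup>2"
  shows "GDERIV f x :> D"
  unfolding gderiv_def
proof (rule has_derivativeI_sandwich[of 1 _ _ _ _ "\<lambda>y. C * norm (y - x)"])
  show "bounded_linear (\<lambda>h. h \<bullet> D)" by (rule bounded_linear_inner_left)
  show "((\<lambda>y. C * norm (y - x)) \<longlongrightarrow> 0) (at x)"
    by (intro tendsto_eq_intros) auto
  fix y assume "y \<noteq> x"
  then have "norm (y - x) > 0" by simp
  then show "norm (f y - f x - (y - x) \<bullet> D) / norm (y - x) \<le> C * norm (y - x)"
    using assms[of y] by (simp add: inner_commute divide_le_eq power2_eq_square mult.assoc)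
qed auto

lemma smooth_funI:
  fixes f :: "'a::euclidean_space \<Rightarrow> real"
  assumes "\<And>x. GDERIV f x :> g x" and "L-lipschitz_on UNIV g"
  shows "smooth_fun L f"
proof -
  have "gradient f = g" using gradient_eqI assms(1) by blast
  then show ?thesis
    using assms unfolding smooth_fun_def gderiv_def differentiable_def by auto
qed

section \<open>Quadratic bounds from a Lipschitz gradient\<close>

lemma smooth_fun_GDERIV: "smooth_fun L f \<Longrightarrow> GDERIV f x :> gradient f x"
  by (simp add: smooth_fun_def GDERIV_gradient)

lemma smooth_fun_lipschitz:
  "smooth_fun L f \<Longrightarrow> norm (gradient f x - gradient f y) \<le> L * norm (x - y)"
  by (auto simp: smooth_fun_def dist_norm dest: lipschitz_onD[of L UNIV _ x y])

lemma smooth_fun_nonneg: "smooth_fun L f \<Longrightarrow> 0 \<le> L"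
  by (auto simp: smooth_fun_def lipschitz_on_def)

lemma smooth_fun_continuous: "smooth_fun L f \<Longrightarrow> continuous_on UNIV f"
  by (simp add: smooth_fun_def continuous_at_imp_continuous_on differentiable_imp_continuous_within)

lemma smooth_fun_line_deriv:
  fixes f :: "'a::euclidean_space \<Rightarrow> real"
  assumes "smooth_fun L f"
  shows "((\<lambda>t. f (x + t *\<^sub>R d)) has_real_derivative (gradient f (x + t *\<^sub>R d) \<bullet> d)) (at t)"
proof -
  have f: "(f has_derivative (\<lambda>h. h \<bullet> gradient f (x + t *\<^sub>R d))) (at (x + t *\<^sub>R d))"
    using smooth_fun_GDERIV[OF assms] unfolding gderiv_def .
  have l: "((\<lambda>t. x + t *\<^sub>R d) has_derivative (\<lambda>s. s *\<^sub>R d)) (at t)"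
    by (auto intro!: derivative_eq_intros)
  have "((\<lambda>t. f (x + t *\<^sub>R d)) has_derivative (\<lambda>s. (s *\<^sub>R d) \<bullet> gradient f (x + t *\<^sub>R d))) (at t)"
    using has_derivative_compose[OF l f] .
  then show ?thesis
    by (rule has_derivative_imp_has_field_derivative) (simp add: inner_commute mult.commute)
qed

lemma smooth_fun_upper:
  fixes f :: "'a::euclidean_space \<Rightarrow> real"
  assumes "smooth_fun L f"
  shows "f y \<le> f x + gradient f x \<bullet> (y - x) + L / 2 * (norm (y - x))\<^sup>2"
proof -
  define d where "d = y - x"
  \<comment> \<open>Excess of \<open>f\<close> along the segment over its quadratic upper model; the
    Lipschitz bound makes its derivative nonpositive, and comparing the ends gives the
    claim.\<close>
  define p where "p t = f (x + t *\<^sub>R d) - t * (gradient f x \<bullet> d) - L * t\<^sup>2 / 2 * (norm d)\<^sup>2" for t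
  have "p 1 \<le> p 0"
  proof (rule DERIV_nonpos_imp_nonincreasing[of 0 1 p])
    fix t :: real assume t: "0 \<le> t" "t \<le> 1"
    have "(p has_real_derivative
        (gradient f (x + t *\<^sub>R d) \<bullet> d - gradient f x \<bullet> d - L * t * (norm d)\<^sup>2)) (at t)"
      unfolding p_def
      by (auto intro!: derivative_eq_intros smooth_fun_line_deriv[OF assms])
    moreover have "(gradient f (x + t *\<^sub>R d) - gradient f x) \<bullet> d \<le> L * t * (norm d)\<^sup>2"
    proof -
      have "(gradient f (x + t *\<^sub>R d) - gradient f x) \<bullet> d
          \<le> norm (gradient f (x + t *\<^sub>R d) - gradient f x) * norm d"
        by (rule norm_cauchy_schwarz)
      also have "\<dots> \<le> (L * norm (t *\<^sub>R d)) * norm d"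
        using smooth_fun_lipschitz[OF assms, of "x + t *\<^sub>R d" x]
        by (intro mult_right_mono) auto
      finally show ?thesis using t by (simp add: power2_eq_square mult_ac)
    qed
    ultimately show "\<exists>z. (p has_real_derivative z) (at t) \<and> z \<le> 0"
      by (auto simp: inner_diff_left)
  qed simp
  then show ?thesis unfolding p_def d_def by simp
qed

lemma smooth_fun_uminus:
  fixes f :: "'a::euclidean_space \<Rightarrow> real"
  assumes "smooth_fun L f"
  shows "smooth_fun L (\<lambda>x. - f x)" and "gradient (\<lambda>x. - f x) x = - gradient f x"
proof -
  have d: "GDERIV (\<lambda>x. - f x) x :> - gradient f x" for x
    using GDERIV_minus[OF smooth_fun_GDERIV[OF assms]] .
  have "L-lipschitz_on UNIV (\<lambda>x. - gradient f x)"
    using assms by (simp add: smooth_fun_def lipschitz_on_minus)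
  with d show "smooth_fun L (\<lambda>x. - f x)" by (rule smooth_funI)
  show "gradient (\<lambda>x. - f x) x = - gradient f x" using d by (rule gradient_eqI)
qed

lemma smooth_fun_lower:
  fixes f :: "'a::euclidean_space \<Rightarrow> real"
  assumes "smooth_fun L f"
  shows "f x + gradient f x \<bullet> (y - x) - L / 2 * (norm (y - x))\<^sup>2 \<le> f y"
  using smooth_fun_upper[OF smooth_fun_uminus(1)[OF assms], of y x]
  by (simp add: smooth_fun_uminus(2)[OF assms])

section \<open>Strong convexity in gradient form\<close>

definition smooth_strongly_convex :: "real \<Rightarrow> real \<Rightarrow> ('a::euclidean_space \<Rightarrow> real) \<Rightarrow> bool" where
  "smooth_strongly_convex L \<mu> \<phi> \<longleftrightarrow> 0 < \<mu> \<and> smooth_fun L \<phi> \<and>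
     (\<forall>x y. \<phi> x + gradient \<phi> x \<bullet> (y - x) + \<mu> / 2 * (norm (y - x))\<^sup>2 \<le> \<phi> y)"

lemma ssc_smooth: "smooth_strongly_convex L \<mu> \<phi> \<Longrightarrow> smooth_fun L \<phi>"
  by (simp add: smooth_strongly_convex_def)

lemma ssc_pos: "smooth_strongly_convex L \<mu> \<phi> \<Longrightarrow> 0 < \<mu>"
  by (simp add: smooth_strongly_convex_def)

lemma ssc_lower:
  "smooth_strongly_convex L \<mu> \<phi> \<Longrightarrow>
    \<phi> x + gradient \<phi> x \<bullet> (y - x) + \<mu> / 2 * (norm (y - x))\<^sup>2 \<le> \<phi> y"
  by (simp add: smooth_strongly_convex_def)

lemma ssc_gradient_ineq:
  fixes \<phi> :: "'a::euclidean_space \<Rightarrow> real"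
  assumes "smooth_strongly_convex L \<mu> \<phi>"
  shows "\<phi> x + gradient \<phi> x \<bullet> (y - x) \<le> \<phi> y"
proof -
  have "0 \<le> \<mu> / 2 * (norm (y - x))\<^sup>2" using ssc_pos[OF assms] by simp
  then show ?thesis using ssc_lower[OF assms, of x y] by linarith
qed

lemma ssc_monotone:
  fixes \<phi> :: "'a::euclidean_space \<Rightarrow> real"
  assumes "smooth_strongly_convex L \<mu> \<phi>"
  shows "\<mu> * (norm (x - y))\<^sup>2 \<le> (gradient \<phi> x - gradient \<phi> y) \<bullet> (x - y)"
  using ssc_lower[OF assms, of x y] ssc_lower[OF assms, of y x]
  by (simp add: inner_diff_left inner_diff_right norm_minus_commute)

lemma ssc_norm_gradient_ge:
  fixes \<phi> :: "'a::euclidean_space \<Rightarrow> real"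
  assumes "smooth_strongly_convex L \<mu> \<phi>"
  shows "\<mu> * norm (x - y) \<le> norm (gradient \<phi> x - gradient \<phi> y)"
proof (cases "x = y")
  case False
  have "\<mu> * norm (x - y) * norm (x - y) \<le> norm (gradient \<phi> x - gradient \<phi> y) * norm (x - y)"
    using order_trans[OF ssc_monotone[OF assms, of x y] norm_cauchy_schwarz]
    by (simp add: power2_eq_square mult.assoc)
  then show ?thesis using False by simp
qed simp

lemma norm_squared_shift:
  fixes x y c :: "'a::real_inner"
  shows "(norm (y - c))\<^sup>2 = (norm (x - c))\<^sup>2 + 2 * ((x - c) \<bullet> (y - x)) + (norm (y - x))\<^sup>2"
  by (simp add: power2_norm_eq_inner inner_diff_left inner_diff_right inner_commute)

text \<open>\<open>f\<close> can lose \<open>Lf / 2\<close> times a square against its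
  linearisation, and the added square has coefficient \<open>Lf\<close>, so \<open>Lf / 2\<close>
  survives, which is modulus \<open>Lf\<close>. The Lipschitz constants \<open>Lf\<close> and
  \<open>2 * Lf\<close> of the two gradients add up to \<open>3 * Lf\<close>.\<close>

lemma ssc_shifted_square:
  fixes f :: "'a::euclidean_space \<Rightarrow> real"
  assumes f: "smooth_fun Lf f" and "0 < Lf"
  shows "smooth_strongly_convex (3 * Lf) Lf (\<lambda>x. f x + Lf * (norm (x - c))\<^sup>2)" (is "smooth_strongly_convex _ _ ?\<phi>")
    and "gradient (\<lambda>x. f x + Lf * (norm (x - c))\<^sup>2) x = gradient f x + (2 * Lf) *\<^sub>R (x - c)"
proof -
  define g where "g x = gradient f x + (2 * Lf) *\<^sub>R (x - c)" for x
  have sq: "Lf * (norm (y - c))\<^sup>2 =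
      Lf * (norm (x - c))\<^sup>2 + ((2 * Lf) *\<^sub>R (x - c)) \<bullet> (y - x) + Lf * (norm (y - x))\<^sup>2" for x y
    by (subst norm_squared_shift[of y c x]) (simp add: distrib_left)
  have D: "GDERIV ?\<phi> x :> g x" for x
  proof (rule GDERIV_quadratic_remainder[where C = "Lf / 2 + Lf"])
    fix y
    show "\<bar>?\<phi> y - ?\<phi> x - g x \<bullet> (y - x)\<bar> \<le> (Lf / 2 + Lf) * (norm (y - x))\<^sup>2"
      using smooth_fun_lower[OF f, of x y] smooth_fun_upper[OF f, of y x] sq[of y x] \<open>0 < Lf\<close>
      by (auto simp: g_def inner_add_left distrib_right abs_le_iff intro: add_increasing)
  qed
  then show gr: "gradient ?\<phi> x = gradient f x + (2 * Lf) *\<^sub>R (x - c)" for x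
    using gradient_eqI g_def by metis
  have "(3 * Lf)-lipschitz_on UNIV g"
  proof (rule lipschitz_onI)
    fix x y
    have "g x - g y = (gradient f x - gradient f y) + (2 * Lf) *\<^sub>R (x - y)"
      by (simp add: g_def algebra_simps)
    then have "norm (g x - g y) \<le> norm (gradient f x - gradient f y) + norm ((2 * Lf) *\<^sub>R (x - y))"
      by (metis norm_triangle_ineq)
    then show "dist (g x) (g y) \<le> 3 * Lf * dist x y"
      using smooth_fun_lipschitz[OF f, of x y] \<open>0 < Lf\<close> by (simp add: dist_norm)
  qed (use \<open>0 < Lf\<close> in simp)
  then have "smooth_fun (3 * Lf) ?\<phi>" using D smooth_funI by blast
  moreover have "?\<phi> x + gradient ?\<phi> x \<bullet> (y - x) + Lf / 2 * (norm (y - x))\<^sup>2 \<le> ?\<phi> y" for x y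
    using smooth_fun_lower[OF f, of x y] sq[of y x] by (simp add: gr inner_add_left)
  ultimately show "smooth_strongly_convex (3 * Lf) Lf ?\<phi>"
    using \<open>0 < Lf\<close> by (simp add: smooth_strongly_convex_def)
qed

lemma ssc_half_square:
  fixes c :: "'a::euclidean_space"
  assumes "0 < s"
  shows "smooth_strongly_convex s s (\<lambda>x. s / 2 * (norm (x - c))\<^sup>2)" (is "smooth_strongly_convex _ _ ?\<phi>")
    and "gradient (\<lambda>x. s / 2 * (norm (x - c))\<^sup>2) x = s *\<^sub>R (x - c)"
proof -
  have sq: "?\<phi> y = ?\<phi> x + (s *\<^sub>R (x - c)) \<bullet> (y - x) + s / 2 * (norm (y - x))\<^sup>2" for x y
    by (subst norm_squared_shift[of y c x]) (simp add: distrib_left)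
  have D: "GDERIV ?\<phi> x :> s *\<^sub>R (x - c)" for x
  proof (rule GDERIV_quadratic_remainder[where C = "s / 2"])
    fix y
    have "?\<phi> y - ?\<phi> x - s *\<^sub>R (x - c) \<bullet> (y - x) = s / 2 * (norm (y - x))\<^sup>2"
      using sq[of y x] by linarith
    then show "\<bar>?\<phi> y - ?\<phi> x - s *\<^sub>R (x - c) \<bullet> (y - x)\<bar> \<le> s / 2 * (norm (y - x))\<^sup>2"
      using assms by (simp only:) simp
  qed
  then show gr: "gradient ?\<phi> x = s *\<^sub>R (x - c)" for x by (rule gradient_eqI)
  have "s-lipschitz_on UNIV (\<lambda>x. s *\<^sub>R (x - c))"
    using assms by (intro lipschitz_onI) (auto simp: dist_norm simp flip: scaleR_diff_right)
  with D have "smooth_fun s ?\<phi>" by (rule smooth_funI)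
  then show "smooth_strongly_convex s s ?\<phi>"
    using assms eq_refl[OF sq[symmetric]] unfolding smooth_strongly_convex_def gr by blast
qed

subsection \<open>Closed convex functions and composite minimization\<close>

text \<open>Finiteness of \<open>h x\<close> is built in, and only a global affine minorant is asked
  for, so \<open>conjugate h\<close> can be treated before anything is known about its
  regularity.\<close>

definition subgradient :: "('a::euclidean_space \<Rightarrow> ereal) \<Rightarrow> 'a \<Rightarrow> 'a \<Rightarrow> bool" where
  "subgradient h x v \<longleftrightarrow> (\<exists>t. h x = ereal t \<and> (\<forall>y. ereal (t + v \<bullet> (y - x)) \<le> h y))"

lemma subgradientE:
  assumes "subgradient h x v"
  obtains t where "h x = ereal t" "\<And>y. ereal (t + v \<bullet> (y - x)) \<le> h y"
  using assms by (auto simp: subgradient_def)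

lemma subgradient_monotone:
  assumes "subgradient h x v" "subgradient h y w"
  shows "0 \<le> (v - w) \<bullet> (x - y)"
proof -
  obtain t where t: "h x = ereal t" "\<And>z. ereal (t + v \<bullet> (z - x)) \<le> h z"
    using assms(1) by (auto elim: subgradientE)
  obtain s where s: "h y = ereal s" "\<And>z. ereal (s + w \<bullet> (z - y)) \<le> h z"
    using assms(2) by (auto elim: subgradientE)
  have "t + v \<bullet> (y - x) \<le> s" "s + w \<bullet> (x - y) \<le> t"
    using t(2)[of y] s(2)[of x] by (auto simp: t(1) s(1))
  then show ?thesis by (simp add: inner_diff_left inner_diff_right)
qed

lemma subgradient_scale:
  assumes "subgradient h x v" "0 < c"
  shows "subgradient (\<lambda>u. ereal c * h u) x (c *\<^sub>R v)"
proof -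
  obtain t where t: "h x = ereal t" "\<And>z. ereal (t + v \<bullet> (z - x)) \<le> h z"
    using assms(1) by (auto elim: subgradientE)
  have "ereal (c * t + (c *\<^sub>R v) \<bullet> (z - x)) \<le> ereal c * h z" for z
    using ereal_mult_left_mono[OF t(2)[of z], of "ereal c"] \<open>0 < c\<close> by (simp add: distrib_left)
  then show ?thesis using t(1) by (auto simp: subgradient_def)
qed

text \<open>Strict separation of a point just below the graph from the epigraph. The epigraph point
  above it forces the vertical component \<open>s\<close> of the normal to be positive, so the
  separating hyperplane is a graph.\<close>

lemma closed_convex_affine_minorant:
  assumes "proper_closed_convex h"
  obtains a c where "\<And>y. ereal (a \<bullet> y + c) \<le> h y"
proof -
  let ?E = "{(y, t::real). h y \<le> ereal t}"
  have cl: "closed ?E" and co: "convex ?E" and ninf: "\<And>y. h y \<noteq> -\<infinity>"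
    using assms by (auto simp: proper_closed_convex_def)
  obtain y0 t0 where y0: "h y0 = ereal t0"
    using assms unfolding proper_closed_convex_def by (metis ereal_cases)
  have "(y0, t0 - 1) \<notin> ?E" using y0 by simp
  from separating_hyperplane_closed_point[OF co cl this]
  obtain p s \<beta> where sep: "(p, s) \<bullet> (y0, t0 - 1) < \<beta>" "\<And>z. z \<in> ?E \<Longrightarrow> \<beta> < (p, s) \<bullet> z"
    by (metis surj_pair)
  have "\<beta> < p \<bullet> y0 + s * t0" using sep(2)[of "(y0, t0)"] y0 by simp
  moreover have "p \<bullet> y0 + s * (t0 - 1) < \<beta>" using sep(1) by simp
  ultimately have s: "0 < s" by (simp add: algebra_simps)
  have "ereal ((- p /\<^sub>R s) \<bullet> y + \<beta> / s) \<le> h y" for y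
  proof (cases "h y")
    case (real t)
    then have "\<beta> < p \<bullet> y + s * t" using sep(2)[of "(y, t)"] by simp
    then show ?thesis using s real by (simp add: field_simps)
  qed (use ninf in auto)
  then show ?thesis using that by blast
qed

lemma quadratic_le_imp_bounded:
  fixes r :: real
  assumes "0 < \<mu>" "\<mu> / 2 * r\<^sup>2 \<le> B * r + C" "0 \<le> r" "0 \<le> B" "0 \<le> C"
  shows "r \<le> 1 + 2 * (B + C) / \<mu>"
proof (cases "r \<le> 1")
  case False
  then have "\<mu> / 2 * r\<^sup>2 \<le> (B + C) * r" using assms mult_left_mono[of 1 r C]
    by (simp add: distrib_right)
  then have "(\<mu> / 2 * r) * r \<le> (B + C) * r" by (simp add: power2_eq_square mult_ac)
  then have "\<mu> / 2 * r \<le> B + C" using False by (simp add: mult_le_cancel_right)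
  then show ?thesis using \<open>0 < \<mu>\<close> by (simp add: field_simps)
next
  case True
  have "0 \<le> 2 * (B + C) / \<mu>" using assms by simp
  then show ?thesis using True by simp
qed

text \<open>Minimising over the epigraph instead of over \<open>x\<close> makes the objective
  \<open>Q\<close> continuous, so closedness of the epigraph does the work of lower semicontinuity.
  Sublevel sets are bounded because strong convexity of \<open>\<phi>\<close> beats the affine
  minorant of \<open>h\<close>.\<close>

lemma composite_minimum_attained:
  fixes \<phi> :: "'a::euclidean_space \<Rightarrow> real"
  assumes \<phi>: "smooth_strongly_convex L \<mu> \<phi>" and h: "proper_closed_convex h"
  obtains x t where "h x = ereal t" "\<And>y s. h y \<le> ereal s \<Longrightarrow> \<phi> x + t \<le> \<phi> y + s"
proof -
  let ?E = "{(y, t::real). h y \<le> ereal t}"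
  have cl: "closed ?E" and ninf: "\<And>y. h y \<noteq> -\<infinity>"
    using h by (auto simp: proper_closed_convex_def)
  have mu: "0 < \<mu>" using \<phi> by (simp add: smooth_strongly_convex_def)
  obtain y0 t0 where y0: "h y0 = ereal t0"
    using h unfolding proper_closed_convex_def by (metis ereal_cases)
  obtain a c where ac: "\<And>y. ereal (a \<bullet> y + c) \<le> h y"
    using closed_convex_affine_minorant[OF h] by metis
  define Q where "Q z = \<phi> (fst z) + snd z" for z :: "'a \<times> real"
  define S where "S = ?E \<inter> {z. Q z \<le> Q (y0, t0)}"
  have contQ: "continuous_on UNIV Q" unfolding Q_def
    by (intro continuous_intros continuous_on_compose2[OF smooth_fun_continuous[OF ssc_smooth[OF \<phi>]]]) auto
  have "closed {z. Q z \<le> Q (y0, t0)}"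
    by (intro closed_Collect_le contQ continuous_intros)
  then have "closed S" unfolding S_def using cl by (rule closed_Int[OF _ , rotated])
  have "bounded S"
  proof -
    define g0 where "g0 = gradient \<phi> 0"
    define B where "B = norm g0 + norm a"
    define C where "C = \<bar>Q (y0, t0)\<bar> + \<bar>\<phi> 0\<bar> + \<bar>c\<bar>"
    define M where "M = 1 + 2 * (B + C) / \<mu>"
    have bd: "norm y \<le> M \<and> \<bar>t\<bar> \<le> norm a * M + \<bar>c\<bar> + C + norm g0 * M"
      if "(y, t) \<in> S" for y t
    proof -
      have le: "Q (y, t) \<le> Q (y0, t0)" and ht: "h y \<le> ereal t" using that by (auto simp: S_def)
      have t: "a \<bullet> y + c \<le> t" using order_trans[OF ac ht] by simp
      have p: "\<phi> 0 + g0 \<bullet> y + \<mu> / 2 * (norm y)\<^sup>2 \<le> \<phi> y"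
        using ssc_lower[OF \<phi>, of 0 y] by (simp add: g0_def)
      have ay: "- (norm a * norm y) \<le> a \<bullet> y" and gy: "- (norm g0 * norm y) \<le> g0 \<bullet> y"
        using Cauchy_Schwarz_ineq2[of a y] Cauchy_Schwarz_ineq2[of g0 y] by auto
      have "\<mu> / 2 * (norm y)\<^sup>2 \<le> B * norm y + C"
        using le t p ay gy unfolding Q_def B_def C_def distrib_right fst_conv snd_conv by linarith
      then have M: "norm y \<le> M" unfolding M_def
        using quadratic_le_imp_bounded[OF mu, of "norm y" B C] by (simp add: B_def C_def)
      have aM: "norm a * norm y \<le> norm a * M" and gM: "norm g0 * norm y \<le> norm g0 * M"
        using M by (auto intro: mult_left_mono)
      have "0 \<le> \<mu> / 2 * (norm y)\<^sup>2" using mu by simp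
      then have up: "t \<le> C + norm g0 * M" using le p gy gM unfolding Q_def C_def by simp
      have lo: "- (norm a * M + \<bar>c\<bar>) \<le> t" using t ay aM by linarith
      have "0 \<le> M" using M norm_ge_zero[of y] by linarith
      then have "0 \<le> norm a * M" "0 \<le> norm g0 * M" "0 \<le> C" by (auto simp: C_def)
      then have "\<bar>t\<bar> \<le> norm a * M + \<bar>c\<bar> + C + norm g0 * M" using up lo by linarith
      then show ?thesis using M by simp
    qed
    have "norm z \<le> M + (norm a * M + \<bar>c\<bar> + C + norm g0 * M)" if "z \<in> S" for z
    proof -
      obtain y t where z: "z = (y, t)" by (cases z)
      have "norm z \<le> norm y + \<bar>t\<bar>" unfolding z using norm_Pair_le[of y t] by simp
      then show ?thesis using bd[of y t] that z by simp
    qed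
    then show ?thesis unfolding bounded_iff by blast
  qed
  with \<open>closed S\<close> have "compact S" by (simp add: compact_eq_bounded_closed)
  moreover have "(y0, t0) \<in> S" using y0 by (simp add: S_def)
  ultimately obtain z where z: "z \<in> S" "\<And>z'. z' \<in> S \<Longrightarrow> Q z \<le> Q z'"
    using continuous_attains_inf[of S Q] contQ continuous_on_subset by blast
  obtain x t' where xt: "z = (x, t')" by (cases z)
  have hx: "h x \<le> ereal t'" using z(1) by (auto simp: S_def xt)
  then obtain t where t: "h x = ereal t" "t \<le> t'" using ninf[of x] by (cases "h x") auto
  have min: "\<phi> x + t \<le> \<phi> y + s" if "h y \<le> ereal s" for y s
  proof (cases "(y, s) \<in> S")
    case True
    then show ?thesis using z(2)[OF True] t(2) by (simp add: Q_def xt)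
  next
    case False
    then have "Q (y0, t0) < Q (y, s)" using that by (auto simp: S_def)
    moreover have "Q z \<le> Q (y0, t0)" using z(1) by (simp add: S_def)
    ultimately show ?thesis using t(2) by (simp add: Q_def xt)
  qed
  show ?thesis using that[OF t(1) min] .
qed

text \<open>Moving from the minimiser towards \<open>y\<close> by a fraction \<open>\<theta>\<close>
  changes the convex part at most linearly and the smooth part by its linear term up to order
  \<open>\<theta>\<^sup>2\<close>; dividing by \<open>\<theta>\<close> leaves an error
  \<open>\<theta> * N\<close> that can be made arbitrarily small.\<close>

lemma composite_optimality:
  fixes \<phi> :: "'a::euclidean_space \<Rightarrow> real"
  assumes \<phi>: "smooth_fun L \<phi>" and h: "proper_closed_convex h"
    and hx: "h x = ereal t" and min: "\<And>y s. h y \<le> ereal s \<Longrightarrow> \<phi> x + t \<le> \<phi> y + s"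
  shows "subgradient h x (- gradient \<phi> x)"
proof -
  have ninf: "\<And>y. h y \<noteq> -\<infinity>" and conv: "convex {(y, t::real). h y \<le> ereal t}"
    using h by (auto simp: proper_closed_convex_def)
  have "ereal (t + (- gradient \<phi> x) \<bullet> (y - x)) \<le> h y" for y
  proof (cases "h y")
    case (real s)
    define N where "N = L / 2 * (norm (y - x))\<^sup>2"
    have N: "0 \<le> N" using smooth_fun_nonneg[OF \<phi>] by (simp add: N_def)
    have step: "t - s - gradient \<phi> x \<bullet> (y - x) \<le> \<theta> * N" if \<theta>: "0 < \<theta>" "\<theta> \<le> 1" for \<theta>
    proof -
      have "(1 - \<theta>) *\<^sub>R (x, t) + \<theta> *\<^sub>R (y, s) \<in> {(y, t::real). h y \<le> ereal t}"
        using conv \<theta> hx real by (intro convexD) auto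
      then have "h ((1 - \<theta>) *\<^sub>R x + \<theta> *\<^sub>R y) \<le> ereal ((1 - \<theta>) * t + \<theta> * s)" by simp
      then have "\<phi> x + t \<le> \<phi> ((1 - \<theta>) *\<^sub>R x + \<theta> *\<^sub>R y) + ((1 - \<theta>) * t + \<theta> * s)" by (rule min)
      then have m: "\<theta> * (t - s) \<le> \<phi> ((1 - \<theta>) *\<^sub>R x + \<theta> *\<^sub>R y) - \<phi> x" by (simp add: algebra_simps)
      have "(1 - \<theta>) *\<^sub>R x + \<theta> *\<^sub>R y - x = \<theta> *\<^sub>R (y - x)" by (simp add: algebra_simps)
      with m have "\<theta> * (t - s) \<le> \<theta> * (gradient \<phi> x \<bullet> (y - x)) + L / 2 * (\<theta> * norm (y - x))\<^sup>2"
        using smooth_fun_upper[OF \<phi>, of "(1 - \<theta>) *\<^sub>R x + \<theta> *\<^sub>R y" x] \<theta> by simp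
      then have "\<theta> * (t - s - gradient \<phi> x \<bullet> (y - x)) \<le> \<theta> * (\<theta> * N)"
        by (simp add: N_def power2_eq_square algebra_simps)
      then show ?thesis using \<theta> by (simp add: mult_le_cancel_left)
    qed
    have "t - s - gradient \<phi> x \<bullet> (y - x) \<le> 0"
    proof (rule field_le_epsilon)
      fix e :: real assume "0 < e"
      define \<theta> where "\<theta> = min 1 (e / (N + 1))"
      have "\<theta> * N \<le> e / (N + 1) * (N + 1)" using N \<open>0 < e\<close>
        by (intro mult_mono) (auto simp: \<theta>_def)
      moreover have "0 < \<theta>" "\<theta> \<le> 1" using N \<open>0 < e\<close> by (auto simp: \<theta>_def)
      ultimately show "t - s - gradient \<phi> x \<bullet> (y - x) \<le> 0 + e"
        using step[of \<theta>] N by simp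
    qed
    then show ?thesis by (simp add: real)
  qed (use ninf in auto)
  then show ?thesis using hx by (auto simp: subgradient_def)
qed

lemma composite_minimizer_exists:
  fixes \<phi> :: "'a::euclidean_space \<Rightarrow> real"
  assumes "smooth_strongly_convex L \<mu> \<phi>" and "proper_closed_convex h"
  obtains x where "subgradient h x (- gradient \<phi> x)"
  using composite_minimum_attained[OF assms] composite_optimality[OF ssc_smooth[OF assms(1)] assms(2)]
  by metis

lemma composite_growth:
  fixes \<phi> :: "'a::euclidean_space \<Rightarrow> real"
  assumes "smooth_strongly_convex L \<mu> \<phi>" and "subgradient h x (- gradient \<phi> x)"
  shows "ereal (\<phi> x) + h x + ereal (\<mu> / 2 * (norm (y - x))\<^sup>2) \<le> ereal (\<phi> y) + h y"
proof -
  obtain t where t: "h x = ereal t" "\<And>z. ereal (t + (- gradient \<phi> x) \<bullet> (z - x)) \<le> h z"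
    using assms(2) by (auto elim: subgradientE)
  have "ereal (\<phi> x + t + \<mu> / 2 * (norm (y - x))\<^sup>2)
      \<le> ereal (\<phi> y) + ereal (t + (- gradient \<phi> x) \<bullet> (y - x))"
    using ssc_lower[OF assms(1), of x y] by simp
  also have "\<dots> \<le> ereal (\<phi> y) + h y" by (intro add_left_mono t(2))
  finally show ?thesis by (simp add: t(1))
qed

text \<open>\<open>arg_min\<close> is a choice, so its value is known only once the minimiser is
  unique; quadratic growth supplies the strict inequality.\<close>

lemma composite_arg_min:
  fixes \<phi> :: "'a::euclidean_space \<Rightarrow> real"
  assumes \<phi>: "smooth_strongly_convex L \<mu> \<phi>" and sub: "subgradient h x (- gradient \<phi> x)"
  shows "arg_min (\<lambda>y. ereal (\<phi> y) + h y) (\<lambda>_. True) = x"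
proof -
  have mu: "0 < \<mu>" using \<phi> by (simp add: smooth_strongly_convex_def)
  obtain t where t: "h x = ereal t" using sub by (auto elim: subgradientE)
  have lt: "ereal (\<phi> x) + h x < ereal (\<phi> y) + h y" if "y \<noteq> x" for y
  proof -
    have "0 < \<mu> / 2 * (norm (y - x))\<^sup>2" using that mu by simp
    then have "ereal (\<phi> x) + h x < ereal (\<phi> x) + h x + ereal (\<mu> / 2 * (norm (y - x))\<^sup>2)"
      by (simp add: t)
    then show ?thesis using composite_growth[OF assms, of y] by (rule less_le_trans)
  qed
  show ?thesis unfolding arg_min_def is_arg_min_def
    by (rule some_equality) (use lt in \<open>auto dest: less_asym\<close>)
qed

subsection \<open>Proximal maps and conjugates\<close>

lemma prox_eqI:
  fixes g :: "'a::euclidean_space \<Rightarrow> ereal"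
  assumes "subgradient g p (x - p)"
  shows "prox g x = p"
proof -
  have "(\<lambda>u. g u + ereal ((norm (x - u))\<^sup>2 / 2)) = (\<lambda>u. ereal (1 / 2 * (norm (u - x))\<^sup>2) + g u)"
    by (simp add: add.commute norm_minus_commute)
  then have "prox g x = arg_min (\<lambda>u. ereal (1 / 2 * (norm (u - x))\<^sup>2) + g u) (\<lambda>_. True)"
    by (simp add: prox_def)
  also have "\<dots> = p"
  proof (rule composite_arg_min[OF ssc_half_square(1)])
    show "subgradient g p (- gradient (\<lambda>u. 1 / 2 * (norm (u - x))\<^sup>2) p)"
      using assms by (simp only: ssc_half_square(2)[of 1]) simp
  qed simp
  finally show ?thesis .
qed

lemma prox_subgradient:
  fixes g :: "'a::euclidean_space \<Rightarrow> ereal"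
  assumes "proper_closed_convex g" "0 < c"
  shows "subgradient g (prox (\<lambda>u. ereal c * g u) x) ((1 / c) *\<^sub>R (x - prox (\<lambda>u. ereal c * g u) x))"
proof -
  have c: "0 < 1 / c" using assms(2) by simp
  obtain p where "subgradient g p (- gradient (\<lambda>u. (1 / c) / 2 * (norm (u - x))\<^sup>2) p)"
    using composite_minimizer_exists[OF ssc_half_square(1)[OF c] assms(1)] by blast
  then have p: "subgradient g p ((1 / c) *\<^sub>R (x - p))"
    by (simp only: ssc_half_square(2)[OF c]) (simp add: scaleR_diff_right)
  have "subgradient (\<lambda>u. ereal c * g u) p (x - p)"
    using subgradient_scale[OF p assms(2)] assms(2) by simp
  then have "prox (\<lambda>u. ereal c * g u) x = p" by (rule prox_eqI)
  with p show ?thesis by simp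
qed

lemma prox_nonexpansive:
  fixes g :: "'a::euclidean_space \<Rightarrow> ereal"
  assumes "proper_closed_convex g" "0 < c"
  shows "norm (prox (\<lambda>u. ereal c * g u) x - prox (\<lambda>u. ereal c * g u) y) \<le> norm (x - y)"
proof -
  define p q where "p = prox (\<lambda>u. ereal c * g u) x" and "q = prox (\<lambda>u. ereal c * g u) y"
  have "0 \<le> ((1 / c) *\<^sub>R (x - p) - (1 / c) *\<^sub>R (y - q)) \<bullet> (p - q)"
    using subgradient_monotone[OF prox_subgradient[OF assms] prox_subgradient[OF assms]]
    by (simp add: p_def q_def)
  then have "0 \<le> (1 / c) * (((x - y) - (p - q)) \<bullet> (p - q))"
    by (simp add: algebra_simps)
  then have "(norm (p - q))\<^sup>2 \<le> (x - y) \<bullet> (p - q)"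
    using assms(2) by (simp add: zero_le_divide_iff inner_diff_left power2_norm_eq_inner)
  also have "\<dots> \<le> norm (x - y) * norm (p - q)" by (rule norm_cauchy_schwarz)
  finally have "norm (p - q) \<le> norm (x - y)"
    by (cases "p = q") (simp_all add: power2_eq_square)
  then show ?thesis by (simp add: p_def q_def)
qed

lemma conjugate_ge:
  assumes "h u = ereal t"
  shows "ereal (w \<bullet> u - t) \<le> conjugate h w"
  unfolding conjugate_def using SUP_upper[of u UNIV "\<lambda>y. ereal (w \<bullet> y) - h y"] by (simp add: assms)

text \<open>Equality in Fenchel-Young: the subgradient inequality says that \<open>u\<close> attains
  the supremum.\<close>

lemma conjugate_eq:
  assumes "subgradient h u w" "h u = ereal t"
  shows "conjugate h w = ereal (w \<bullet> u - t)"
proof (rule antisym)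
  have "ereal (w \<bullet> y) - h y \<le> ereal (w \<bullet> u - t)" for y
  proof -
    have "ereal (t + w \<bullet> (y - u)) \<le> h y"
      using assms by (auto elim!: subgradientE)
    then have "ereal (w \<bullet> y) - h y \<le> ereal (w \<bullet> y) - ereal (t + w \<bullet> (y - u))"
      by (intro ereal_minus_mono) auto
    then show ?thesis by (simp add: inner_diff_right)
  qed
  then show "conjugate h w \<le> ereal (w \<bullet> u - t)" unfolding conjugate_def by (rule SUP_least)
qed (rule conjugate_ge[of h, OF assms(2)])

lemma subgradient_conjugate:
  assumes "subgradient h u w"
  shows "subgradient (conjugate h) w u"
proof -
  obtain t where t: "h u = ereal t" using assms by (auto elim: subgradientE)
  have "ereal (w \<bullet> u - t + u \<bullet> (z - w)) \<le> conjugate h z" for z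
    using conjugate_ge[of h u t z] t by (simp add: inner_diff_right inner_commute)
  then show ?thesis using conjugate_eq[OF assms t] by (auto simp: subgradient_def)
qed

text \<open>
  By Moreau's decomposition the multiplier update can be computed from a proximal step on \<open>h\<close>
  itself, so no regularity of the conjugate is needed.
\<close>

definition dual_prox :: "('a::euclidean_space \<Rightarrow> ereal) \<Rightarrow> real \<Rightarrow> 'a \<Rightarrow> 'a \<Rightarrow> 'a" where
  "dual_prox h l \<nu> r = prox (\<lambda>w. ereal (1 / l) * conjugate h w) (\<nu> + (1 / l) *\<^sub>R r)"

lemma dual_prox_subgradient:
  assumes "proper_closed_convex h" "0 < l"
  shows "subgradient h (r + l *\<^sub>R (\<nu> - dual_prox h l \<nu> r)) (dual_prox h l \<nu> r)"
proof -
  have l: "0 < 1 / l" using assms(2) by simp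
  \<comment> \<open>With \<open>u\<close> the proximal point of \<open>h\<close> at \<open>c\<close>
    with parameter \<open>l\<close>, the multiplier \<open>w = (c - u) / l\<close> is a subgradient
    of \<open>h\<close> at \<open>u\<close>. Hence \<open>u\<close> is one of the conjugate at
    \<open>w\<close>, and that is the optimality condition of the proximal step on the
    conjugate.\<close>
  define c where "c = l *\<^sub>R \<nu> + r"
  obtain u where "subgradient h u (- gradient (\<lambda>u. (1 / l) / 2 * (norm (u - c))\<^sup>2) u)"
    using composite_minimizer_exists[OF ssc_half_square(1)[OF l] assms(1)] by blast
  then have u: "subgradient h u (- (1 / l) *\<^sub>R (u - c))"
    by (simp only: ssc_half_square(2)[OF l]) simp
  define w where "w = - (1 / l) *\<^sub>R (u - c)"
  have w: "\<nu> + (1 / l) *\<^sub>R r - w = (1 / l) *\<^sub>R u" and u_eq: "u = r + l *\<^sub>R (\<nu> - w)"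
    using assms(2) by (simp_all add: w_def c_def algebra_simps)
  have "subgradient (\<lambda>w. ereal (1 / l) * conjugate h w) w (\<nu> + (1 / l) *\<^sub>R r - w)"
    unfolding w using subgradient_scale[OF subgradient_conjugate[OF u] l] by (simp add: w_def)
  then have "dual_prox h l \<nu> r = w" unfolding dual_prox_def by (rule prox_eqI)
  moreover have "subgradient h u w" using u by (simp add: w_def)
  ultimately show ?thesis by (simp add: u_eq[symmetric])
qed

lemma dual_prox_lipschitz:
  assumes "proper_closed_convex h" "0 < l"
  shows "norm (dual_prox h l \<nu> r - dual_prox h l \<nu> r') \<le> norm (r - r') / l"
proof -
  define w w' where "w = dual_prox h l \<nu> r" and "w' = dual_prox h l \<nu> r'"
  have "0 \<le> (w - w') \<bullet> ((r + l *\<^sub>R (\<nu> - w)) - (r' + l *\<^sub>R (\<nu> - w')))"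
    unfolding w_def w'_def by (intro subgradient_monotone[of h] dual_prox_subgradient assms)
  also have "\<dots> = (w - w') \<bullet> (r - r') - l * (norm (w - w'))\<^sup>2"
    by (simp add: power2_norm_eq_inner algebra_simps)
  finally have "l * (norm (w - w'))\<^sup>2 \<le> norm (w - w') * norm (r - r')"
    using norm_cauchy_schwarz[of "w - w'" "r - r'"] by linarith
  then have "l * norm (w - w') \<le> norm (r - r')"
    by (cases "w = w'") (simp_all add: power2_eq_square)
  then show ?thesis using assms(2) by (simp add: w_def w'_def field_simps)
qed

subsection \<open>Singular values\<close>

lemma inner_transpose:
  fixes A :: "real^'n^'m"
  shows "(A *v x) \<bullet> w = x \<bullet> (transpose A *v w)"
  by (metis dot_lmul_matrix inner_commute vector_transpose_matrix transpose_transpose)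

lemma norm_matrix_le: "norm (A *v x) \<le> op_norm A * norm x"
  unfolding op_norm_def by (rule onorm) simp

lemma op_norm_nonneg: "0 \<le> op_norm A"
  unfolding op_norm_def by (rule onorm_pos_le) simp

lemma norm_transpose_le: "norm (transpose A *v w) \<le> op_norm A * norm w"
proof (cases "transpose A *v w = 0")
  case False
  have "(norm (transpose A *v w))\<^sup>2 = (A *v (transpose A *v w)) \<bullet> w"
    by (simp add: inner_transpose power2_norm_eq_inner)
  also have "\<dots> \<le> norm (A *v (transpose A *v w)) * norm w" by (rule norm_cauchy_schwarz)
  also have "\<dots> \<le> op_norm A * norm (transpose A *v w) * norm w"
    by (intro mult_right_mono norm_matrix_le) auto
  finally show ?thesis using False by (simp add: power2_eq_square mult_ac)
qed (simp add: op_norm_nonneg)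

text \<open>
  A minimizer of \<open>\<parallel>A\<^sup>T v\<parallel>\<close> on the unit sphere is an eigenvector of \<open>A A\<^sup>T\<close>.
\<close>

lemma min_singular_bounds:
  fixes A :: "real^'n^'m"
  assumes "surj ((*v) A)"
  shows "0 < min_singular A" and "min_singular A * norm w \<le> norm (transpose A *v w)"
proof -
  define q where "q v = norm (transpose A *v v)" for v
  have qsq: "(q v)\<^sup>2 = (A *v (transpose A *v v)) \<bullet> v" for v
    by (simp add: q_def inner_transpose power2_norm_eq_inner)
  have "continuous_on (sphere 0 1) q" unfolding q_def
    by (intro continuous_intros linear_continuous_on)
  moreover have "sphere (0::real^'m) 1 \<noteq> {}" by simp
  ultimately obtain v0 where v0: "norm v0 = 1" and min: "\<And>v. norm v = 1 \<Longrightarrow> q v0 \<le> q v"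
    using continuous_attains_inf[OF compact_sphere, of 0 1 q] by auto
  define c where "c = q v0"
  have c0: "0 \<le> c" by (simp add: c_def q_def)
  have qge: "c * norm v \<le> q v" for v
  proof (cases "v = 0")
    case False
    have "c \<le> q (v /\<^sub>R norm v)" unfolding c_def by (rule min) (use False in simp)
    also have "\<dots> = q v / norm v"
      by (simp add: q_def matrix_vector_mult_scaleR divide_inverse_commute)
    finally show ?thesis using False by (simp add: field_simps)
  qed (simp add: q_def)
  have "c \<noteq> 0"
  proof
    assume "c = 0"
    then have "transpose A *v v0 = 0" by (simp add: c_def q_def)
    moreover obtain x where "v0 = A *v x" using assms by (metis surjD)
    ultimately have "v0 \<bullet> v0 = 0" by (simp add: inner_transpose)
    then show False using v0 by simp
  qed
  with c0 have cpos: "0 < c" by simp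
  \<comment> \<open>\<open>B\<close> is \<open>A A\<^sup>T - c\<^sup>2 I\<close>, positive
    semidefinite by the choice of \<open>c\<close>, and its quadratic form vanishes at
    \<open>v0\<close>. Showing \<open>B v0 = 0\<close> makes \<open>v0\<close> an
    eigenvector.\<close>
  define B where "B v = A *v (transpose A *v v) - c\<^sup>2 *\<^sub>R v" for v
  have Bq: "B v \<bullet> v = (q v)\<^sup>2 - c\<^sup>2 * (norm v)\<^sup>2" for v
    by (simp add: B_def qsq inner_diff_left power2_norm_eq_inner)
  have Bpos: "0 \<le> B v \<bullet> v" for v
    using power_mono[OF qge[of v], of 2] c0 by (simp add: Bq power_mult_distrib)
  define d where "d = B v0"
  have Blin: "B (v + t *\<^sub>R u) = B v + t *\<^sub>R B u" for v u t
    by (simp add: B_def matrix_vector_right_distrib matrix_vector_mult_scaleR algebra_simps)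
  have Bsym: "B v \<bullet> u = v \<bullet> B u" for u v
    unfolding B_def inner_diff_left inner_diff_right
    by (simp add: inner_transpose inner_commute[of v "A *v _"] inner_commute[of "u v* A"])
  have "0 \<le> t * (2 * (d \<bullet> d)) + t\<^sup>2 * (B d \<bullet> d)" for t
  proof -
    have z: "d \<bullet> v0 = 0" unfolding d_def by (simp add: Bq v0 c_def)
    have s: "B d \<bullet> v0 = d \<bullet> d" using Bsym[of d v0] by (simp add: d_def)
    have "B (v0 + t *\<^sub>R d) \<bullet> (v0 + t *\<^sub>R d) = (d + t *\<^sub>R B d) \<bullet> (v0 + t *\<^sub>R d)"
      by (simp only: Blin d_def)
    also have "\<dots> = t * (2 * (d \<bullet> d)) + t\<^sup>2 * (B d \<bullet> d)"
      by (simp add: inner_add_left inner_add_right z s power2_eq_square algebra_simps)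
    finally show ?thesis using Bpos[of "v0 + t *\<^sub>R d"] by simp
  qed
  note quad = this
  \<comment> \<open>A nonnegative quadratic in \<open>t\<close> without constant term has no linear
    term. The test point is \<open>- a / e\<close>; the \<open>+ 1\<close> in \<open>e\<close> keeps
    the denominator positive when \<open>B d \<bullet> d\<close> vanishes.\<close>
  have "(d \<bullet> d)\<^sup>2 * (B d \<bullet> d + 2) \<le> 0"
  proof -
    define a e where "a = d \<bullet> d" and "e = B d \<bullet> d + 1"
    have e: "0 < e" using Bpos[of d] by (simp add: e_def)
    have "0 \<le> (- a / e) * (2 * a) + (- a / e)\<^sup>2 * (e - 1)"
      using quad[of "- a / e"] by (simp add: a_def e_def)
    then have "0 \<le> e\<^sup>2 * ((- a / e) * (2 * a) + (- a / e)\<^sup>2 * (e - 1))" by simp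
    also have "\<dots> = - (a\<^sup>2 * (e + 1))" using e by (simp add: power2_eq_square field_simps)
    finally show ?thesis by (simp add: a_def e_def add.assoc)
  qed
  then have "d = 0" using Bpos[of d] by (simp add: mult_le_0_iff)
  then have "(A ** transpose A) *v v0 = c\<^sup>2 *\<^sub>R v0"
    unfolding d_def B_def matrix_vector_mul_assoc[symmetric] by (metis eq_iff_diff_eq_0)
  moreover have "v0 \<noteq> 0" using v0 by auto
  ultimately have "c \<in> singular_values A" unfolding singular_values_def using c0 by blast
  moreover have "c \<le> s" if s: "s \<in> singular_values A" for s
  proof -
    have "0 \<le> s \<and> (\<exists>v. v \<noteq> 0 \<and> A *v (transpose A *v v) = s\<^sup>2 *\<^sub>R v)"
      using s unfolding singular_values_def matrix_vector_mul_assoc mem_Collect_eq .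
    then obtain v where "0 \<le> s" and v: "v \<noteq> 0" "A *v (transpose A *v v) = s\<^sup>2 *\<^sub>R v"
      by (elim conjE exE)
    have "(c * norm v)\<^sup>2 \<le> (q v)\<^sup>2" using qge c0 by (intro power_mono) auto
    also have "\<dots> = (s * norm v)\<^sup>2" by (simp only: qsq v(2)) (simp add: power2_norm_eq_inner power_mult_distrib)
    finally have "c * norm v \<le> s * norm v" by (rule power2_le_imp_le) (use \<open>0 \<le> s\<close> in simp)
    then show ?thesis using v(1) by simp
  qed
  ultimately have "min_singular A = c" unfolding min_singular_def by (intro cInf_eq_minimum)
  then show "0 < min_singular A" "min_singular A * norm w \<le> norm (transpose A *v w)"
    using cpos qge by (simp_all add: q_def)
qed

lemma min_singular_le_op_norm:
  fixes A :: "real^'n^'m"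
  assumes "surj ((*v) A)"
  shows "min_singular A \<le> op_norm A"
proof -
  obtain w :: "real^'m" where "norm w = 1" using vector_choose_size[of 1] by auto
  then show ?thesis
    using order_trans[OF min_singular_bounds(2)[OF assms, of w] norm_transpose_le] by simp
qed

subsection \<open>Optimality conditions of the composite problem\<close>

text \<open>The saddle point conditions of the Lagrangian, with the dual condition stated through
  \<open>h\<close> at \<open>A *v x - b\<close> rather than through its conjugate at
  \<open>w\<close>.\<close>

definition kkt_pair ::
    "(real^'n \<Rightarrow> real) \<Rightarrow> (real^'m \<Rightarrow> ereal) \<Rightarrow> real^'n^'m \<Rightarrow> real^'m \<Rightarrow> real^'n \<Rightarrow> real^'m \<Rightarrow> bool" where
  "kkt_pair \<phi> h A b x w \<longleftrightarrow>
     gradient \<phi> x = - (transpose A *v w) \<and> subgradient h (A *v x - b) w"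

lemma proper_closed_convex_affine:
  fixes A :: "real^'n^'m"
  assumes A: "surj ((*v) A)" and h: "proper_closed_convex h"
  shows "proper_closed_convex (\<lambda>x. h (A *v x - b))"
proof -
  let ?E = "{(y, t::real). h y \<le> ereal t}" and ?F = "{(x, t::real). h (A *v x - b) \<le> ereal t}"
  have cl: "closed ?E" and co: "convex ?E" and ninf: "\<And>y. h y \<noteq> -\<infinity>"
    using h by (auto simp: proper_closed_convex_def)
  obtain y where y: "h y \<noteq> \<infinity>" using h by (auto simp: proper_closed_convex_def)
  obtain x where "y + b = A *v x" using A by (metis surjD)
  then have "h (A *v x - b) \<noteq> \<infinity>" using y by (metis add_diff_cancel_right')
  moreover have "closed ?F"
  proof -
    have "continuous_on UNIV (\<lambda>z::(real^'n) \<times> real. (A *v fst z - b, snd z))"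
      by (intro continuous_intros linear_continuous_on
          continuous_on_compose2[of UNIV "(*v) A" _ fst]) auto
    then have "closed ((\<lambda>z::(real^'n) \<times> real. (A *v fst z - b, snd z)) -` ?E)"
      by (rule closed_vimage[OF cl])
    also have "(\<lambda>z::(real^'n) \<times> real. (A *v fst z - b, snd z)) -` ?E = ?F" by auto
    finally show ?thesis .
  qed
  moreover have "convex ?F"
  proof (rule convexI)
    fix p q :: "(real^'n) \<times> real" and u v :: real
    assume p: "p \<in> ?F" and q: "q \<in> ?F" and uv: "0 \<le> u" "0 \<le> v" "u + v = 1"
    have "u *\<^sub>R (A *v fst p - b, snd p) + v *\<^sub>R (A *v fst q - b, snd q) \<in> ?E"
      using co p q uv by (intro convexD) auto
    moreover have "u *\<^sub>R (A *v fst p - b) + v *\<^sub>R (A *v fst q - b) = A *v (u *\<^sub>R fst p + v *\<^sub>R fst q) - b"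
    proof -
      have "u *\<^sub>R b + v *\<^sub>R b = b" using uv(3) by (metis scaleR_add_left scaleR_one)
      then show ?thesis
        by (simp add: matrix_vector_right_distrib matrix_vector_mult_scaleR algebra_simps)
    qed
    ultimately show "u *\<^sub>R p + v *\<^sub>R q \<in> ?F" by (auto simp: case_prod_beta)
  qed
  ultimately show ?thesis using ninf unfolding proper_closed_convex_def by blast
qed

lemma subgradient_affine:
  fixes A :: "real^'n^'m"
  assumes "subgradient h (A *v x - b) w"
  shows "subgradient (\<lambda>x. h (A *v x - b)) x (transpose A *v w)"
proof -
  obtain t where t: "h (A *v x - b) = ereal t"
      "\<And>y. ereal (t + w \<bullet> (y - (A *v x - b))) \<le> h y"
    using assms by (auto elim: subgradientE)
  have "(transpose A *v w) \<bullet> (y - x) = w \<bullet> ((A *v y - b) - (A *v x - b))" for y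
    using inner_transpose[of A "y - x" w] by (simp add: inner_commute matrix_vector_mult_diff_distrib)
  then have "ereal (t + (transpose A *v w) \<bullet> (y - x)) \<le> h (A *v y - b)" for y
    using t(2)[of "A *v y - b"] by simp
  then show ?thesis using t(1) unfolding subgradient_def by blast
qed

text \<open>
  A subgradient of \<open>h(A \<cdot> - b)\<close> annihilates the kernel of \<open>A\<close>, hence lies in the range of \<open>A\<^sup>T\<close>.
\<close>

lemma subgradient_affineD:
  fixes A :: "real^'n^'m"
  assumes A: "surj ((*v) A)" and sub: "subgradient (\<lambda>x. h (A *v x - b)) x v"
  obtains w where "v = transpose A *v w" "subgradient h (A *v x - b) w"
proof -
  obtain t where t: "h (A *v x - b) = ereal t"
      "\<And>z. ereal (t + v \<bullet> (z - x)) \<le> h (A *v z - b)"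
    using sub by (auto elim!: subgradientE)
  \<comment> \<open>\<open>G\<close> is \<open>A A\<^sup>T\<close>, injective by the lower bound on
    \<open>transpose A\<close> and hence onto. Choosing \<open>w\<close> with
    \<open>G w = A *v v\<close> puts \<open>d = v - A\<^sup>T w\<close> into the kernel of
    \<open>A\<close>, where the subgradient inequality gives \<open>v \<bullet> d \<le> 0\<close>;
    as \<open>A\<^sup>T w\<close> is orthogonal to \<open>d\<close>, this is already
    \<open>d \<bullet> d \<le> 0\<close>.\<close>
  define G where "G w = A *v (transpose A *v w)" for w
  have lin: "linear G" unfolding G_def
    by (intro linearI) (simp_all only: matrix_vector_right_distrib matrix_vector_mult_scaleR)
  have "w = 0" if "G w = 0" for w
  proof -
    have "(transpose A *v w) \<bullet> (transpose A *v w) = G w \<bullet> w"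
      unfolding G_def inner_transpose[of A "transpose A *v w" w] ..
    then have "norm (transpose A *v w) = 0" using that by simp
    then have "min_singular A * norm w \<le> 0" using min_singular_bounds(2)[OF A, of w] by linarith
    then show "w = 0" using min_singular_bounds(1)[OF A] by (simp add: mult_le_0_iff)
  qed
  then have "inj G" using lin by (simp add: linear_injective_0)
  then have "surj G" using lin linear_injective_imp_surjective by blast
  then obtain w where w: "G w = A *v v" by (metis surjD)
  define d where "d = v - transpose A *v w"
  have Ad: "A *v d = 0" using w by (simp only: d_def G_def matrix_vector_mult_diff_distrib) simp
  have "v \<bullet> d \<le> 0" using t(2)[of "x + d"] t(1) Ad by (simp add: matrix_vector_right_distrib)
  moreover have "(transpose A *v w) \<bullet> d = 0"
    using inner_transpose[of A d w] Ad by (simp add: inner_commute)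
  ultimately have "d \<bullet> d \<le> 0" unfolding d_def by (simp add: inner_diff_left inner_diff_right)
  then have "d = 0" by (metis inner_eq_zero_iff inner_ge_zero order_antisym)
  then have v: "v = transpose A *v w" by (simp add: d_def)
  have "ereal (t + w \<bullet> (y - (A *v x - b))) \<le> h y" for y
  proof -
    obtain z where "y + b = A *v z" using A by (metis surjD)
    then have z: "y = A *v z - b" by (metis add_diff_cancel_right')
    have "v \<bullet> (z - x) = w \<bullet> (y - (A *v x - b))"
      using inner_transpose[of A "z - x" w]
      by (simp add: v z inner_commute matrix_vector_mult_diff_distrib)
    then show ?thesis using t(2)[of z] by (simp add: z)
  qed
  then have "subgradient h (A *v x - b) w" using t(1) by (auto simp: subgradient_def)
  with v show ?thesis by (rule that)
qed

lemma kkt_pair_exists: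
  fixes A :: "real^'n^'m"
  assumes "smooth_strongly_convex L \<mu> \<phi>" and "proper_closed_convex h" and A: "surj ((*v) A)"
  obtains x w where "kkt_pair \<phi> h A b x w"
proof -
  obtain x where x: "subgradient (\<lambda>x. h (A *v x - b)) x (- gradient \<phi> x)"
    using composite_minimizer_exists[OF assms(1) proper_closed_convex_affine[OF A assms(2)]] by blast
  obtain w where "- gradient \<phi> x = transpose A *v w" "subgradient h (A *v x - b) w"
    using subgradient_affineD[OF A x] by blast
  then have "kkt_pair \<phi> h A b x w" unfolding kkt_pair_def by (metis minus_minus)
  then show ?thesis by (rule that)
qed

lemma kkt_pair_subgradient:
  fixes A :: "real^'n^'m"
  assumes "kkt_pair \<phi> h A b x w"
  shows "subgradient (\<lambda>x. h (A *v x - b)) x (- gradient \<phi> x)"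
  using assms subgradient_affine[of h A x b w] unfolding kkt_pair_def by simp

lemma kkt_pair_primal_sol:
  assumes "smooth_strongly_convex L \<mu> \<phi>" and "kkt_pair \<phi> h A b x w"
  shows "primal_sol \<phi> h A b = x"
  unfolding primal_sol_def objective_def
  using composite_arg_min[OF assms(1) kkt_pair_subgradient[OF assms(2)]] .

lemma kkt_pair_growth:
  assumes "smooth_strongly_convex L \<mu> \<phi>" and "kkt_pair \<phi> h A b x w"
  shows "objective \<phi> h A b x + ereal (\<mu> / 2 * (norm (y - x))\<^sup>2) \<le> objective \<phi> h A b y"
  unfolding objective_def
  using composite_growth[OF assms(1) kkt_pair_subgradient[OF assms(2)]] .

text \<open>A gradient step of length \<open>1 / (L + 1)\<close> would lower the tilted function
  unless its gradient vanished; \<open>L + 1\<close> keeps the length finite for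
  \<open>L = 0\<close>.\<close>

lemma gradient_at_tilted_minimum:
  fixes \<phi> :: "'a::euclidean_space \<Rightarrow> real"
  assumes \<phi>: "smooth_fun L \<phi>" and min: "\<And>y. \<phi> x + v \<bullet> x \<le> \<phi> y + v \<bullet> y"
  shows "gradient \<phi> x = - v"
proof -
  define G where "G = gradient \<phi> x + v"
  define s where "s = 1 / (L + 1)"
  have L: "0 \<le> L" using smooth_fun_nonneg[OF \<phi>] .
  have s: "0 < s" "L * s < 1" using L by (simp_all add: s_def)
  then have pos: "0 < s * (1 - L * s / 2)" by simp
  define n where "n = (norm G)\<^sup>2"
  have lin: "gradient \<phi> x \<bullet> (- s *\<^sub>R G) + v \<bullet> (- s *\<^sub>R G) = - s * n"
    by (simp only: inner_add_left[symmetric] G_def[symmetric] n_def) (simp add: power2_norm_eq_inner)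
  have "(norm (- s *\<^sub>R G))\<^sup>2 = s\<^sup>2 * n" by (simp add: power_mult_distrib n_def)
  moreover have "0 \<le> gradient \<phi> x \<bullet> (- s *\<^sub>R G) + L / 2 * (norm (- s *\<^sub>R G))\<^sup>2 + v \<bullet> (- s *\<^sub>R G)"
    using smooth_fun_upper[OF \<phi>, of "x - s *\<^sub>R G" x] min[of "x - s *\<^sub>R G"]
    by (simp add: inner_diff_right)
  ultimately have "0 \<le> - s * n + L / 2 * (s\<^sup>2 * n)" using lin by simp
  then have "(s * (1 - L * s / 2)) * n \<le> 0" by (simp add: power2_eq_square algebra_simps)
  then have "n \<le> 0" using pos by (meson not_le zero_less_mult_iff)
  then have "G = 0" by (simp add: n_def)
  then show ?thesis by (simp add: G_def eq_neg_iff_add_eq_0)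
qed

text \<open>There is no duality gap at a KKT pair. For uniqueness, a multiplier \<open>z\<close>
  attaining the same value has \<open>x\<close> as a minimiser of its Lagrangian, so
  \<open>A\<^sup>T z = A\<^sup>T w\<close>, and full row rank makes \<open>transpose A\<close>
  injective.\<close>

lemma kkt_pair_dual_sol:
  fixes A :: "real^'n^'m"
  assumes \<phi>: "smooth_strongly_convex L \<mu> \<phi>" and A: "surj ((*v) A)"
    and kkt: "kkt_pair \<phi> h A b x w"
  shows "dual_sol \<phi> h A b = w"
proof -
  define r where "r y = A *v y - b" for y
  have sub: "subgradient h (r x) w" and grad: "gradient \<phi> x = - (transpose A *v w)"
    using kkt by (simp_all add: kkt_pair_def r_def)
  obtain t where t: "h (r x) = ereal t" using sub by (auto elim: subgradientE)
  have r_diff: "(transpose A *v z) \<bullet> (y - y') = z \<bullet> r y - z \<bullet> r y'" for y y' z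
    using inner_transpose[of A "y - y'" z]
    by (simp add: r_def inner_commute matrix_vector_mult_diff_distrib inner_diff_right)
  define I where "I z = (INF y. ereal (\<phi> y + z \<bullet> r y))" for z
  have D: "dual_objective \<phi> h A b z = I z - conjugate h z" for z
    by (simp add: dual_objective_def I_def r_def)
  have I_le: "I z \<le> ereal (\<phi> y + z \<bullet> r y)" for y z
    unfolding I_def by (rule INF_lower) simp
  have "ereal (\<phi> x + w \<bullet> r x) \<le> I w" unfolding I_def
  proof (rule INF_greatest)
    fix y
    have "\<phi> x + gradient \<phi> x \<bullet> (y - x) \<le> \<phi> y"
      by (rule ssc_gradient_ineq[OF \<phi>])
    then show "ereal (\<phi> x + w \<bullet> r x) \<le> ereal (\<phi> y + w \<bullet> r y)"
      using r_diff[of w y x] by (simp add: grad)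
  qed
  then have Iw: "I w = ereal (\<phi> x + w \<bullet> r x)" using I_le by (intro antisym)
  have Dw: "dual_objective \<phi> h A b w = ereal (\<phi> x + t)"
    unfolding D Iw conjugate_eq[OF sub t] by simp
  have max: "z = w \<and> dual_objective \<phi> h A b z \<le> ereal (\<phi> x + t)
      \<or> dual_objective \<phi> h A b z < ereal (\<phi> x + t)" for z
  proof -
    have le: "dual_objective \<phi> h A b z \<le> ereal (\<phi> x + t)"
    proof -
      have "I z - conjugate h z \<le> ereal (\<phi> x + z \<bullet> r x) - ereal (z \<bullet> r x - t)"
        by (intro ereal_minus_mono I_le conjugate_ge t)
      then show ?thesis by (simp add: D)
    qed
    show ?thesis
    proof (cases "dual_objective \<phi> h A b z < ereal (\<phi> x + t)")
      case False
      with le have eq: "I z - conjugate h z = ereal (\<phi> x + t)" by (simp add: D)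
      obtain c where c: "conjugate h z = ereal c"
        using eq conjugate_ge[of h "r x" t z] t by (cases "conjugate h z"; cases "I z") auto
      have "z \<bullet> r x - t \<le> c" using conjugate_ge[of h "r x" t z] t c by simp
      moreover have Iz: "I z = ereal (\<phi> x + t + c)" using eq c by (cases "I z") auto
      ultimately have "\<phi> x + z \<bullet> r x \<le> \<phi> y + z \<bullet> r y" for y
        using I_le[of z y] by simp
      note I_min = this
      have "\<phi> x + (transpose A *v z) \<bullet> x \<le> \<phi> y + (transpose A *v z) \<bullet> y" for y
        using I_min[of y] r_diff[of z y x] unfolding inner_diff_right by linarith
      then have "gradient \<phi> x = - (transpose A *v z)"
        by (rule gradient_at_tilted_minimum[OF ssc_smooth[OF \<phi>]])
      then have "transpose A *v (z - w) = 0"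
        using grad by (simp only: matrix_vector_mult_diff_distrib) simp
      then have "min_singular A * norm (z - w) \<le> 0"
        using min_singular_bounds(2)[OF A, of "z - w"] by simp
      then have "z = w" using min_singular_bounds(1)[OF A] by (simp add: mult_le_0_iff)
      with le show ?thesis by simp
    qed simp
  qed
  show ?thesis unfolding dual_sol_def arg_max_def is_arg_max_def
  proof (rule some_equality)
    show "True \<and> (\<nexists>y. True \<and> dual_objective \<phi> h A b w < dual_objective \<phi> h A b y)"
      using max unfolding Dw by (metis less_asym not_less)
    fix z assume "True \<and> (\<nexists>y. True \<and> dual_objective \<phi> h A b z < dual_objective \<phi> h A b y)"
    then show "z = w" using max[of z] Dw by metis
  qed
qed

subsection \<open>The model function of the inner solver\<close>

text \<open>The supremum in the model is a Moreau envelope of \<open>h\<close>, up to a translation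
  and a constant. It is attained at \<open>dual_prox\<close>, which is therefore a subgradient of
  it; being \<open>1 / l\<close>-Lipschitz, this subgradient is a gradient.\<close>

lemma ppa_model_regularity:
  fixes A :: "real^'n^'m"
  assumes \<phi>: "smooth_strongly_convex L \<mu> \<phi>" and h: "proper_closed_convex h" and l: "0 < l"
  shows "smooth_strongly_convex (L + (op_norm A)\<^sup>2 / l) \<mu> (ppa_model \<phi> h A b l \<nu>)"
    and "gradient (ppa_model \<phi> h A b l \<nu>) x =
      gradient \<phi> x + transpose A *v dual_prox h l \<nu> (A *v x - b)"
proof -
  define S where "S r = (SUP w. ereal (w \<bullet> r) - conjugate h w - ereal (l / 2 * (norm (w - \<nu>))\<^sup>2))" for r
  define p where "p = dual_prox h l \<nu>"
  \<comment> \<open>The supremum is a real number, so \<open>real_of_ereal\<close> in the model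
    loses nothing.\<close>
  have S_val: "\<exists>s. S r = ereal s \<and> (\<forall>r'. ereal (s + p r \<bullet> (r' - r)) \<le> S r')" for r
  proof -
    define u where "u = r + l *\<^sub>R (\<nu> - p r)"
    have sub: "subgradient h u (p r)"
      unfolding u_def p_def by (rule dual_prox_subgradient[OF h l])
    obtain c where c: "conjugate h (p r) = ereal c"
      using subgradient_conjugate[OF sub] by (auto elim: subgradientE)
    have cz: "ereal (c + u \<bullet> (z - p r)) \<le> conjugate h z" for z
      using subgradient_conjugate[OF sub] c by (auto elim!: subgradientE)
    define s where "s = p r \<bullet> r - c - l / 2 * (norm (p r - \<nu>))\<^sup>2"
    have lower: "ereal (s + p r \<bullet> (r' - r)) \<le> S r'" for r'
    proof -
      have "ereal (s + p r \<bullet> (r' - r)) =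
          ereal (p r \<bullet> r') - conjugate h (p r) - ereal (l / 2 * (norm (p r - \<nu>))\<^sup>2)"
        by (simp add: s_def c inner_diff_right)
      also have "\<dots> \<le> S r'" unfolding S_def by (rule SUP_upper) simp
      finally show ?thesis .
    qed
    have "S r \<le> ereal s" unfolding S_def
    proof (rule SUP_least)
      fix z
      have "(norm (z - \<nu>))\<^sup>2 = (norm (p r - \<nu>))\<^sup>2 + 2 * ((p r - \<nu>) \<bullet> (z - p r)) + (norm (z - p r))\<^sup>2"
        by (rule norm_squared_shift)
      then have "l / 2 * (norm (z - \<nu>))\<^sup>2 = l / 2 * (norm (p r - \<nu>))\<^sup>2
          + l * ((p r - \<nu>) \<bullet> (z - p r)) + l / 2 * (norm (z - p r))\<^sup>2"
        by (simp only:) (simp add: distrib_left)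
      moreover have "u \<bullet> (z - p r) = z \<bullet> r - p r \<bullet> r - l * ((p r - \<nu>) \<bullet> (z - p r))"
        by (simp add: u_def inner_add_left inner_diff_left inner_diff_right inner_commute algebra_simps)
      moreover have "0 \<le> l / 2 * (norm (z - p r))\<^sup>2" using l by simp
      ultimately have "z \<bullet> r - (c + u \<bullet> (z - p r)) - l / 2 * (norm (z - \<nu>))\<^sup>2 \<le> s"
        unfolding s_def by linarith
      moreover have "ereal (z \<bullet> r) - conjugate h z - ereal (l / 2 * (norm (z - \<nu>))\<^sup>2)
          \<le> ereal (z \<bullet> r) - ereal (c + u \<bullet> (z - p r)) - ereal (l / 2 * (norm (z - \<nu>))\<^sup>2)"
        by (intro ereal_minus_mono cz) auto
      ultimately show "ereal (z \<bullet> r) - conjugate h z - ereal (l / 2 * (norm (z - \<nu>))\<^sup>2) \<le> ereal s"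
        by (metis (no_types, lifting) ereal_less_eq(3) ereal_minus(1) order_trans)
    qed
    moreover have "ereal s \<le> S r" using lower[of r] by simp
    ultimately show ?thesis using lower by (auto intro: antisym)
  qed
  define M where "M r = real_of_ereal (S r)" for r
  have SM: "S r = ereal (M r)" for r using S_val[of r] by (auto simp: M_def)
  have M_ge: "M r + p r \<bullet> (r' - r) \<le> M r'" for r r'
    using S_val[of r] by (auto simp: SM)
  define \<Psi> where "\<Psi> x = \<phi> x + M (A *v x - b)" for x
  have model: "ppa_model \<phi> h A b l \<nu> = \<Psi>"
    by (simp add: fun_eq_iff ppa_model_def \<Psi>_def M_def S_def)
  define a where "a = op_norm A"
  have a0: "0 \<le> a" by (simp add: a_def op_norm_nonneg)
  define g where "g x = gradient \<phi> x + transpose A *v p (A *v x - b)" for x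
  have A_diff: "(transpose A *v z) \<bullet> (y - x) = z \<bullet> ((A *v y - b) - (A *v x - b))" for x y z
    using inner_transpose[of A "y - x" z]
    by (simp add: inner_commute matrix_vector_mult_diff_distrib)
  have p_lip: "norm (p (A *v y - b) - p (A *v x - b)) \<le> a * norm (y - x) / l" for x y
  proof -
    have "norm (p (A *v y - b) - p (A *v x - b)) \<le> norm ((A *v y - b) - (A *v x - b)) / l"
      unfolding p_def by (rule dual_prox_lipschitz[OF h l])
    also have "\<dots> = norm (A *v (y - x)) / l" by (simp add: matrix_vector_mult_diff_distrib)
    also have "\<dots> \<le> a * norm (y - x) / l"
      using l norm_matrix_le[of A "y - x"] by (simp add: a_def divide_right_mono)
    finally show ?thesis .
  qed
  have M_lower: "M (A *v x - b) + (transpose A *v p (A *v x - b)) \<bullet> (y - x) \<le> M (A *v y - b)" for x y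
    unfolding A_diff by (rule M_ge)
  \<comment> \<open>The subgradient inequality with the two points exchanged. The coefficient is
    twice the sharp one, which is enough for differentiability; the Lipschitz constant is computed
    from \<open>g\<close> itself.\<close>
  have M_upper: "M (A *v y - b) \<le> M (A *v x - b) + (transpose A *v p (A *v x - b)) \<bullet> (y - x)
      + a\<^sup>2 / l * (norm (y - x))\<^sup>2" for x y
  proof -
    have "M (A *v y - b) - M (A *v x - b) - (transpose A *v p (A *v x - b)) \<bullet> (y - x)
        \<le> (p (A *v y - b) - p (A *v x - b)) \<bullet> ((A *v y - b) - (A *v x - b))"
      using M_ge[of "A *v y - b" "A *v x - b"] unfolding A_diff
      by (simp add: inner_diff_left inner_diff_right)
    also have "\<dots> \<le> norm (p (A *v y - b) - p (A *v x - b)) * norm (A *v (y - x))"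
      using norm_cauchy_schwarz by (simp add: matrix_vector_mult_diff_distrib)
    also have "\<dots> \<le> (a * norm (y - x) / l) * (a * norm (y - x))"
      using p_lip[of y x] norm_matrix_le[of A "y - x"] a0 l
      by (intro mult_mono) (auto simp: a_def)
    also have "\<dots> = a\<^sup>2 / l * (norm (y - x))\<^sup>2" by (simp add: power2_eq_square)
    finally show ?thesis by simp
  qed
  have D: "GDERIV \<Psi> x :> g x" for x
  proof (rule GDERIV_quadratic_remainder[where C = "L / 2 + a\<^sup>2 / l"])
    fix y
    have nn: "0 \<le> L / 2 * (norm (y - x))\<^sup>2" "0 \<le> a\<^sup>2 / l * (norm (y - x))\<^sup>2"
      using smooth_fun_nonneg[OF ssc_smooth[OF \<phi>]] l by auto
    show "\<bar>\<Psi> y - \<Psi> x - g x \<bullet> (y - x)\<bar> \<le> (L / 2 + a\<^sup>2 / l) * (norm (y - x))\<^sup>2"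
      using smooth_fun_upper[OF ssc_smooth[OF \<phi>], of y x] smooth_fun_lower[OF ssc_smooth[OF \<phi>], of x y]
        M_lower[of x y] M_upper[of y x] nn
      unfolding \<Psi>_def g_def inner_add_left distrib_right abs_le_iff by linarith
  qed
  have gr: "gradient \<Psi> x = g x" for x using D by (rule gradient_eqI)
  have "(L + a\<^sup>2 / l)-lipschitz_on UNIV g"
  proof (rule lipschitz_onI)
    show "0 \<le> L + a\<^sup>2 / l" using smooth_fun_nonneg[OF ssc_smooth[OF \<phi>]] l by simp
    fix x y
    have "g x - g y = (gradient \<phi> x - gradient \<phi> y)
        + transpose A *v (p (A *v x - b) - p (A *v y - b))"
      unfolding g_def matrix_vector_mult_diff_distrib by simp
    then have "norm (g x - g y) \<le> norm (gradient \<phi> x - gradient \<phi> y)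
        + norm (transpose A *v (p (A *v x - b) - p (A *v y - b)))"
      by (metis norm_triangle_ineq)
    also have "\<dots> \<le> L * norm (x - y) + a * (a * norm (x - y) / l)"
    proof (rule add_mono)
      show "norm (gradient \<phi> x - gradient \<phi> y) \<le> L * norm (x - y)"
        by (rule smooth_fun_lipschitz[OF ssc_smooth[OF \<phi>]])
      have "norm (transpose A *v (p (A *v x - b) - p (A *v y - b)))
          \<le> a * norm (p (A *v x - b) - p (A *v y - b))"
        unfolding a_def by (rule norm_transpose_le)
      also have "\<dots> \<le> a * (a * norm (x - y) / l)" by (intro mult_left_mono p_lip a0)
      finally show "norm (transpose A *v (p (A *v x - b) - p (A *v y - b))) \<le> a * (a * norm (x - y) / l)" .
    qed
    finally show "dist (g x) (g y) \<le> (L + a\<^sup>2 / l) * dist x y"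
      by (simp add: dist_norm power2_eq_square distrib_right)
  qed
  with D have sm: "smooth_fun (L + a\<^sup>2 / l) \<Psi>" by (rule smooth_funI)
  have "\<Psi> x + gradient \<Psi> x \<bullet> (y - x) + \<mu> / 2 * (norm (y - x))\<^sup>2 \<le> \<Psi> y" for x y
    using ssc_lower[OF \<phi>, of x y] M_lower[of x y]
    unfolding gr \<Psi>_def g_def inner_add_left by linarith
  with sm \<phi> have "smooth_strongly_convex (L + a\<^sup>2 / l) \<mu> \<Psi>"
    unfolding smooth_strongly_convex_def by blast
  then show "smooth_strongly_convex (L + (op_norm A)\<^sup>2 / l) \<mu> (ppa_model \<phi> h A b l \<nu>)"
    by (simp add: model a_def)
  show "gradient (ppa_model \<phi> h A b l \<nu>) x =
      gradient \<phi> x + transpose A *v dual_prox h l \<nu> (A *v x - b)"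
    unfolding model gr g_def p_def ..
qed

subsection \<open>Accelerated gradient descent\<close>

text \<open>The auxiliary point of Nesterov's estimate sequence is recovered from two consecutive
  iterates as \<open>y' + (1 / q) *\<^sub>R (y - y')\<close>, since AGD keeps only these. Here
  \<open>q\<close> is \<open>sqrt (\<mu> / L)\<close>, and the momentum
  \<open>(1 - q) / (1 + q)\<close> is the \<open>\<theta>\<close> of the algorithm.\<close>

lemma agd_lyapunov_step:
  fixes \<Psi> :: "'a::euclidean_space \<Rightarrow> real" and y y' xs :: 'a
  assumes \<Psi>: "smooth_strongly_convex L \<mu> \<Psi>" and L: "0 < L"
    and q: "0 < q" "q \<le> 1" and mu: "\<mu> = q\<^sup>2 * L"
  defines "z \<equiv> y + ((1 - q) / (1 + q)) *\<^sub>R (y - y')"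
  defines "y1 \<equiv> z - (1 / L) *\<^sub>R gradient \<Psi> z"
  shows "\<Psi> y1 - \<Psi> xs + \<mu> / 2 * (norm (y + (1 / q) *\<^sub>R (y1 - y) - xs))\<^sup>2
    \<le> (1 - q) * (\<Psi> y - \<Psi> xs + \<mu> / 2 * (norm (y' + (1 / q) *\<^sub>R (y - y') - xs))\<^sup>2)"
proof -
  define g where "g = gradient \<Psi> z"
  define a where "a = y' + (1 / q) *\<^sub>R (y - y') - xs"
  define c where "c = z - xs"
  define u where "u = (1 - q) *\<^sub>R a + q *\<^sub>R c"
  have mu_pos: "0 < \<mu>" using q L by (simp add: mu)
  have "(1 + q) *\<^sub>R z = (1 + q) *\<^sub>R y + (1 - q) *\<^sub>R (y - y')"
    using q by (simp add: z_def scaleR_add_right)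
  also have "\<dots> = y + q *\<^sub>R (a + xs)"
    using q by (simp add: a_def algebra_simps)
  finally have y_eq: "y = z + q *\<^sub>R (c - a)" by (simp add: c_def algebra_simps)
  have "y + (1 / q) *\<^sub>R (y1 - y) - xs = c + q *\<^sub>R (c - a) + (1 / q) *\<^sub>R (- (q *\<^sub>R (c - a)) - (1 / L) *\<^sub>R g)"
    unfolding y1_def g_def[symmetric] by (subst (1 2) y_eq) (simp add: c_def)
  also have "\<dots> = u - (1 / (q * L)) *\<^sub>R g"
    using q by (simp add: u_def algebra_simps)
  finally have v_eq: "y + (1 / q) *\<^sub>R (y1 - y) - xs = u - (1 / (q * L)) *\<^sub>R g" .
  define na nc nac G where "na = (norm a)\<^sup>2" and "nc = (norm c)\<^sup>2" and "nac = (norm (a - c))\<^sup>2"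
    and "G = (norm g)\<^sup>2"
  have nu: "(norm u)\<^sup>2 = (1 - q) * na + q * nc - q * (1 - q) * nac"
    unfolding u_def na_def nc_def nac_def power2_norm_eq_inner
    by (simp add: inner_commute[of c a] algebra_simps power2_eq_square)
  have nv: "(norm (u - (1 / (q * L)) *\<^sub>R g))\<^sup>2 = (norm u)\<^sup>2 - 2 / (q * L) * (g \<bullet> u) + G / (q * L)\<^sup>2"
  proof -
    have "(norm (u - s *\<^sub>R g))\<^sup>2 = (norm u)\<^sup>2 - 2 * s * (g \<bullet> u) + s\<^sup>2 * G" for s
      unfolding G_def power2_norm_eq_inner
      by (simp add: inner_diff_left inner_diff_right inner_commute[of u g] power2_eq_square algebra_simps)
    from this[of "1 / (q * L)"] show ?thesis by (simp add: power_divide)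
  qed
  have gu: "g \<bullet> u = (1 - q) * (g \<bullet> a) + q * (g \<bullet> c)" by (simp add: u_def inner_add_right)
  \<comment> \<open>Three inequalities at \<open>z\<close> are combined: descent of the gradient
    step with weight 1, strong convexity towards \<open>xs\<close> with weight \<open>q\<close>,
    convexity towards \<open>y\<close> with weight \<open>1 - q\<close>. Because
    \<open>\<mu> = q\<^sup>2 * L\<close>, the squared gradient cancels exactly, and the
    \<open>nac\<close> term has the favourable sign.\<close>
  have I1: "\<Psi> y1 \<le> \<Psi> z - G / (2 * L)"
  proof -
    have "\<Psi> y1 \<le> \<Psi> z + g \<bullet> (- ((1 / L) *\<^sub>R g)) + L / 2 * (norm (- ((1 / L) *\<^sub>R g)))\<^sup>2"
      using smooth_fun_upper[OF ssc_smooth[OF \<Psi>], of y1 z] by (simp add: y1_def g_def)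
    also have "\<dots> = \<Psi> z - G / (2 * L)"
      using L by (simp add: G_def power2_norm_eq_inner[symmetric] power_mult_distrib power2_eq_square
          field_simps flip: power2_norm_eq_inner)
    finally show ?thesis .
  qed
  have I2: "\<Psi> z - g \<bullet> c + \<mu> / 2 * nc \<le> \<Psi> xs"
    using ssc_lower[OF \<Psi>, of z xs]
    by (simp add: c_def nc_def g_def inner_diff_right norm_minus_commute)
  have I3: "\<Psi> z + q * (g \<bullet> c - g \<bullet> a) \<le> \<Psi> y"
    using ssc_gradient_ineq[OF \<Psi>, of z y] y_eq by (simp add: g_def inner_diff_right)
  have J2: "q * (\<Psi> z - g \<bullet> c + \<mu> / 2 * nc) \<le> q * \<Psi> xs"
    using I2 q by (intro mult_left_mono) auto
  have J3: "(1 - q) * (\<Psi> z + q * (g \<bullet> c - g \<bullet> a)) \<le> (1 - q) * \<Psi> y"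
    using I3 q by (intro mult_left_mono) auto
  have J4: "0 \<le> \<mu> / 2 * (q * (1 - q) * nac)" using q mu_pos by (simp add: nac_def)
  have c1: "\<mu> / 2 * (2 / (q * L) * (g \<bullet> u)) = q * (g \<bullet> u)" and c2: "\<mu> / 2 * (G / (q * L)\<^sup>2) = G / (2 * L)"
    using q L by (simp_all add: mu power2_eq_square)
  have "\<Psi> y1 - \<Psi> xs + \<mu> / 2 * (norm (u - (1 / (q * L)) *\<^sub>R g))\<^sup>2
      = \<Psi> y1 - \<Psi> xs + \<mu> / 2 * (norm u)\<^sup>2 - q * (g \<bullet> u) + G / (2 * L)"
    unfolding nv right_diff_distrib distrib_left c1 c2 by simp
  also have "\<dots> \<le> \<Psi> z - \<Psi> xs + \<mu> / 2 * (norm u)\<^sup>2 - q * (g \<bullet> u)"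
    using I1 by simp
  also have "\<dots> \<le> \<Psi> z - \<Psi> xs + \<mu> / 2 * ((1 - q) * na + q * nc) - q * (g \<bullet> u)"
    using J4 unfolding nu by (simp add: right_diff_distrib)
  also have "\<dots> \<le> (1 - q) * (\<Psi> y - \<Psi> xs + \<mu> / 2 * na)"
  proof -
    define e where "e = \<mu> / 2"
    show ?thesis using J2 J3 unfolding gu e_def[symmetric] by (simp add: algebra_simps)
  qed
  finally show ?thesis unfolding v_eq na_def a_def .
qed

text \<open>The stopping test is on the gradient, the potential on values: strong convexity converts
  the gap into a distance and the Lipschitz bound the distance into a gradient. The powers of
  \<open>L / \<mu>\<close> lost on the way end up inside a logarithm.\<close>

lemma agd_gradient_bound:
  fixes \<Psi> :: "'a::euclidean_space \<Rightarrow> real"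
  assumes \<Psi>: "smooth_strongly_convex L \<mu> \<Psi>" and \<mu>L: "\<mu> \<le> L" and opt: "gradient \<Psi> xs = 0"
  shows "(norm (gradient \<Psi> (fst (agd_state \<Psi> L \<mu> y0 k))))\<^sup>2
    \<le> 2 * L ^ 3 / \<mu> * (1 - sqrt (\<mu> / L)) ^ k * (norm (y0 - xs))\<^sup>2"
proof -
  have mu: "0 < \<mu>" using ssc_pos[OF \<Psi>] .
  have L: "0 < L" using mu \<mu>L by simp
  define q where "q = sqrt (\<mu> / L)"
  have q: "0 < q" "q \<le> 1" and mu_q: "\<mu> = q\<^sup>2 * L"
    using mu L \<mu>L by (simp_all add: q_def)
  have sq: "sqrt (L / \<mu>) = 1 / q" by (simp add: q_def real_sqrt_divide)
  have \<theta>: "(sqrt (L / \<mu>) - 1) / (sqrt (L / \<mu>) + 1) = (1 - q) / (1 + q)"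
  proof -
    have "1 / q - 1 = (1 - q) / q" "1 / q + 1 = (1 + q) / q"
      using q by (simp_all add: field_simps)
    then show ?thesis using q unfolding sq by simp
  qed
  define y y' where "y k = fst (agd_state \<Psi> L \<mu> y0 k)" and "y' k = snd (agd_state \<Psi> L \<mu> y0 k)" for k
  define V where "V k = \<Psi> (y k) - \<Psi> xs + \<mu> / 2 * (norm (y' k + (1 / q) *\<^sub>R (y k - y' k) - xs))\<^sup>2" for k
  define Y2 where "Y2 = (norm (y0 - xs))\<^sup>2"
  have V_Suc: "V (Suc k) \<le> (1 - q) * V k" for k
    using agd_lyapunov_step[OF \<Psi> L q mu_q, of "y k" "y' k" xs]
    unfolding V_def by (simp add: y_def y'_def Let_def \<theta>)
  have V_bound: "V k \<le> (1 - q) ^ k * V 0" for k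
  proof (induction k)
    case (Suc k)
    have "V (Suc k) \<le> (1 - q) * V k" by (rule V_Suc)
    also have "\<dots> \<le> (1 - q) * ((1 - q) ^ k * V 0)" using Suc q by (intro mult_left_mono) auto
    finally show ?case by (simp add: mult.assoc)
  qed simp
  have "V 0 \<le> L / 2 * Y2 + \<mu> / 2 * Y2"
    using smooth_fun_upper[OF ssc_smooth[OF \<Psi>], of y0 xs]
    by (simp add: V_def y_def y'_def Y2_def opt)
  moreover have "\<mu> / 2 * Y2 \<le> L / 2 * Y2" using \<mu>L by (intro mult_right_mono) (auto simp: Y2_def)
  ultimately have V0: "V 0 \<le> L * Y2" by simp
  have "\<mu> / 2 * (norm (y k - xs))\<^sup>2 \<le> \<Psi> (y k) - \<Psi> xs"
    using ssc_lower[OF \<Psi>, of xs "y k"] by (simp add: opt)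
  also have "\<dots> \<le> V k" using mu by (simp add: V_def)
  also have "\<dots> \<le> (1 - q) ^ k * V 0" by (rule V_bound)
  also have "\<dots> \<le> (1 - q) ^ k * (L * Y2)" using V0 q by (intro mult_left_mono) auto
  finally have dist: "(norm (y k - xs))\<^sup>2 \<le> 2 * L / \<mu> * (1 - q) ^ k * Y2"
    using mu by (simp add: field_simps)
  have "norm (gradient \<Psi> (y k)) \<le> L * norm (y k - xs)"
    using smooth_fun_lipschitz[OF ssc_smooth[OF \<Psi>], of "y k" xs] by (simp add: opt)
  then have "(norm (gradient \<Psi> (y k)))\<^sup>2 \<le> L\<^sup>2 * (norm (y k - xs))\<^sup>2"
    using power_mono[of "norm (gradient \<Psi> (y k))" "L * norm (y k - xs)" 2] by (simp add: power_mult_distrib)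
  also have "\<dots> \<le> L\<^sup>2 * (2 * L / \<mu> * (1 - q) ^ k * Y2)" using dist by (intro mult_left_mono) auto
  also have "\<dots> = 2 * L ^ 3 / \<mu> * (1 - q) ^ k * Y2" by (simp add: power2_eq_square power3_eq_cube)
  finally show ?thesis by (simp add: y_def q_def Y2_def)
qed

text \<open>\<open>Q\<close> compares the initial distance with the tolerance, and \<open>Z\<close>
  is the factor by which the bound on the squared gradient has to shrink;
  \<open>1 - q \<le> exp (- q)\<close> turns this into about \<open>ln Z / q\<close> steps.\<close>

lemma agd_terminates:
  fixes \<Psi> :: "'a::euclidean_space \<Rightarrow> real"
  assumes \<Psi>: "smooth_strongly_convex L \<mu> \<Psi>" and \<mu>L: "\<mu> \<le> L" and opt: "gradient \<Psi> xs = 0"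
    and \<delta>: "0 < \<delta>" and start: "norm (y0 - xs) \<le> Q * \<delta>" and Z: "1 \<le> Z" "2 * (L / \<mu>) ^ 3 * Q\<^sup>2 \<le> Z"
  obtains t y where "agd_returns \<Psi> L \<mu> y0 \<delta> t y" "real t \<le> 1 + sqrt (L / \<mu>) * ln Z"
proof -
  have mu: "0 < \<mu>" using ssc_pos[OF \<Psi>] .
  have L: "0 < L" using mu \<mu>L by simp
  define q where "q = sqrt (\<mu> / L)"
  have q: "0 < q" "q \<le> 1" using mu L \<mu>L by (simp_all add: q_def)
  have sq: "sqrt (L / \<mu>) = 1 / q" by (simp add: q_def real_sqrt_divide)
  define P where "P t \<longleftrightarrow> norm (gradient \<Psi> (fst (agd_state \<Psi> L \<mu> y0 t))) \<le> \<mu> * \<delta>" for t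
  define t0 where "t0 = nat \<lceil>ln Z / q\<rceil>"
  have lnZ: "0 \<le> ln Z / q" using Z q by simp
  have t0: "ln Z / q \<le> real t0" "real t0 \<le> 1 + ln Z / q"
    using lnZ unfolding t0_def by linarith+
  have "(1 - q) ^ t0 \<le> exp (- q) ^ t0"
    using q exp_ge_add_one_self[of "- q"] by (intro power_mono) auto
  also have "\<dots> = exp (- (q * real t0))" by (simp add: exp_of_nat_mult[symmetric] mult.commute)
  also have "\<dots> \<le> exp (- ln Z)" using t0(1) q by (simp add: field_simps)
  also have "\<dots> = 1 / Z" using Z by (simp add: exp_minus inverse_eq_divide)
  finally have pw: "(1 - q) ^ t0 \<le> 1 / Z" .
  have "(norm (gradient \<Psi> (fst (agd_state \<Psi> L \<mu> y0 t0))))\<^sup>2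
      \<le> 2 * L ^ 3 / \<mu> * (1 - q) ^ t0 * (norm (y0 - xs))\<^sup>2"
    unfolding q_def by (rule agd_gradient_bound[OF \<Psi> \<mu>L opt])
  also have "\<dots> \<le> 2 * L ^ 3 / \<mu> * (1 / Z) * (Q * \<delta>)\<^sup>2"
    using pw start mu L Z q by (intro mult_mono power_mono) auto
  also have "\<dots> = (2 * (L / \<mu>) ^ 3 * Q\<^sup>2) * (\<mu>\<^sup>2 * \<delta>\<^sup>2) / Z"
    using mu by (simp add: power2_eq_square power3_eq_cube)
  also have "\<dots> \<le> Z * (\<mu>\<^sup>2 * \<delta>\<^sup>2) / Z"
    using Z by (intro divide_right_mono mult_right_mono) auto
  also have "\<dots> = (\<mu> * \<delta>)\<^sup>2" using Z by (simp add: power_mult_distrib)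
  finally have "P t0" unfolding P_def by (rule power2_le_imp_le) (use mu \<delta> in simp)
  define t where "t = (LEAST t. P t)"
  have "P t" unfolding t_def using \<open>P t0\<close> by (rule LeastI)
  moreover have "t \<le> t0" unfolding t_def using \<open>P t0\<close> by (rule Least_le)
  moreover have "\<not> P s" if "s < t" for s using that unfolding t_def by (rule not_less_Least)
  ultimately have "agd_returns \<Psi> L \<mu> y0 \<delta> t (fst (agd_state \<Psi> L \<mu> y0 t))"
    unfolding agd_returns_def P_def by force
  moreover have "real t \<le> 1 + sqrt (L / \<mu>) * ln Z"
    using \<open>t \<le> t0\<close> t0(2) unfolding sq by simp
  ultimately show ?thesis by (rule that)
qed

lemma agd_returns_accuracy:
  fixes \<Psi> :: "'a::euclidean_space \<Rightarrow> real"
  assumes "smooth_strongly_convex L \<mu> \<Psi>" and "gradient \<Psi> xs = 0" and "agd_returns \<Psi> L' \<mu> y0 \<delta> t y"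
  shows "norm (y - xs) \<le> \<delta>"
proof -
  have "norm (gradient \<Psi> y) \<le> \<mu> * \<delta>" using assms(3) unfolding agd_returns_def by blast
  then have "\<mu> * norm (y - xs) \<le> \<mu> * \<delta>"
    using ssc_norm_gradient_ge[OF assms(1), of y xs] by (simp add: assms(2))
  then show ?thesis using ssc_pos[OF assms(1)] by simp
qed

lemma ssc_minimizer_exists:
  fixes \<Psi> :: "'a::euclidean_space \<Rightarrow> real"
  assumes "smooth_strongly_convex L \<mu> \<Psi>"
  obtains x where "gradient \<Psi> x = 0"
proof -
  have "{(y::'a, t::real). (0::ereal) \<le> ereal t} = UNIV \<times> {0..}" by auto
  then have "proper_closed_convex (\<lambda>_::'a. 0)"
    by (simp add: proper_closed_convex_def closed_Times convex_Times)
  then obtain x where "subgradient (\<lambda>_. 0) x (- gradient \<Psi> x)"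
    using composite_minimizer_exists[OF assms] by blast
  then have "(- gradient \<Psi> x) \<bullet> (y - x) \<le> 0" for y
    by (auto elim!: subgradientE simp: zero_ereal_def)
  from this[of "x - gradient \<Psi> x"] have "gradient \<Psi> x \<bullet> gradient \<Psi> x \<le> 0" by simp
  then have "gradient \<Psi> x = 0" by (metis inner_eq_zero_iff inner_ge_zero order_antisym)
  then show ?thesis by (rule that)
qed

subsection \<open>The inner solver\<close>

text \<open>
  The dual is strongly monotone because \<open>\<parallel>A\<^sup>T w\<parallel> \<ge> \<mu>\<^sub>A \<parallel>w\<parallel>\<close>.
\<close>

lemma ppa_contraction:
  fixes A :: "real^'n^'m"
  assumes \<phi>: "smooth_strongly_convex L \<mu> \<phi>" and L: "0 < L" and h: "proper_closed_convex h"
    and A: "surj ((*v) A)" and l: "0 < l" and kkt: "kkt_pair \<phi> h A b xs ws"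
    and opt: "gradient (ppa_model \<phi> h A b l \<nu>) x = 0"
  defines "w \<equiv> dual_prox h l \<nu> (A *v x - b)"
  shows "(l + \<mu> * (min_singular A / L)\<^sup>2) * norm (w - ws) \<le> l * norm (\<nu> - ws)"
    and "\<mu> * norm (x - xs) \<le> op_norm A * norm (w - ws)"
proof -
  have mu: "0 < \<mu>" using ssc_pos[OF \<phi>] .
  have gx: "gradient \<phi> x = - (transpose A *v w)"
    using opt unfolding ppa_model_regularity(2)[OF \<phi> h l] w_def by (simp add: eq_neg_iff_add_eq_0)
  have gxs: "gradient \<phi> xs = - (transpose A *v ws)" and subs: "subgradient h (A *v xs - b) ws"
    using kkt by (simp_all add: kkt_pair_def)
  have gdiff: "gradient \<phi> x - gradient \<phi> xs = - (transpose A *v (w - ws))"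
    unfolding gx gxs matrix_vector_mult_diff_distrib by simp
  show "\<mu> * norm (x - xs) \<le> op_norm A * norm (w - ws)"
    using ssc_norm_gradient_ge[OF \<phi>, of x xs] norm_transpose_le[of A "w - ws"]
    unfolding gdiff norm_minus_cancel by linarith
  \<comment> \<open>The smoothness of \<open>\<phi>\<close> bounds \<open>norm (x - xs)\<close> from
    below by the multipliers, and strong monotonicity then gives the dual modulus
    \<open>\<mu> * (min_singular A / L)\<^sup>2\<close>. Cocoercivity would give
    \<open>(min_singular A)\<^sup>2 / L\<close>; for \<open>L = 3 * \<mu>\<close> the difference is
    a factor 3.\<close>
  have "min_singular A * norm (w - ws) \<le> L * norm (x - xs)"
    using smooth_fun_lipschitz[OF ssc_smooth[OF \<phi>], of x xs] min_singular_bounds(2)[OF A, of "w - ws"]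
    unfolding gdiff norm_minus_cancel by linarith
  then have "min_singular A / L * norm (w - ws) \<le> norm (x - xs)" using L by (simp add: field_simps)
  then have "(min_singular A / L * norm (w - ws))\<^sup>2 \<le> (norm (x - xs))\<^sup>2"
    using min_singular_bounds(1)[OF A] L by (intro power_mono) auto
  then have "\<mu> * ((min_singular A / L)\<^sup>2 * (norm (w - ws))\<^sup>2) \<le> \<mu> * (norm (x - xs))\<^sup>2"
    unfolding power_mult_distrib using mu by (intro mult_left_mono) auto
  also have "\<dots> \<le> (gradient \<phi> x - gradient \<phi> xs) \<bullet> (x - xs)" by (rule ssc_monotone[OF \<phi>])
  also have "\<dots> = - ((w - ws) \<bullet> (A *v (x - xs)))"
    unfolding gdiff using inner_transpose[of A "x - xs" "w - ws"] by (simp add: inner_commute)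
  also have "\<dots> \<le> l * ((w - ws) \<bullet> (\<nu> - ws)) - l * (norm (w - ws))\<^sup>2"
  proof -
    have "0 \<le> (w - ws) \<bullet> ((A *v x - b + l *\<^sub>R (\<nu> - w)) - (A *v xs - b))"
      using subgradient_monotone[OF dual_prox_subgradient[OF h l, of "A *v x - b" \<nu>] subs]
      by (simp only: w_def[symmetric])
    also have "(A *v x - b + l *\<^sub>R (\<nu> - w)) - (A *v xs - b)
        = A *v (x - xs) + (l *\<^sub>R (\<nu> - ws) - l *\<^sub>R (w - ws))"
      by (simp add: matrix_vector_mult_diff_distrib algebra_simps)
    finally show ?thesis
      by (simp add: inner_add_right inner_diff_right[of _ "l *\<^sub>R _"] power2_norm_eq_inner)
  qed
  also have "\<dots> \<le> l * (norm (w - ws) * norm (\<nu> - ws)) - l * (norm (w - ws))\<^sup>2"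
    using l norm_cauchy_schwarz[of "w - ws" "\<nu> - ws"] by simp
  finally have "((l + \<mu> * (min_singular A / L)\<^sup>2) * norm (w - ws)) * norm (w - ws)
      \<le> (l * norm (\<nu> - ws)) * norm (w - ws)"
    by (simp add: power2_eq_square algebra_simps)
  then show "(l + \<mu> * (min_singular A / L)\<^sup>2) * norm (w - ws) \<le> l * norm (\<nu> - ws)"
    using l by (cases "w = ws") simp_all
qed

text \<open>This is \<open>(1 - \<rho>)\<^bsup>1/2\<^esup>\<close>, since \<open>\<rho> = 1/12\<close> for \<open>\<ell> = \<mu>\<^sub>\<Phi>\<close>.\<close>

definition inner_rate :: real where "inner_rate = sqrt (11 / 12)"

lemma inner_rate_bounds:
  shows "15 / 16 \<le> inner_rate" "inner_rate \<le> exp (- 1 / 24)" "inner_rate \<le> 1" "0 < inner_rate"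
proof -
  show "15 / 16 \<le> inner_rate"
    unfolding inner_rate_def by (rule real_le_rsqrt) (simp add: power2_eq_square)
  then show "0 < inner_rate" by linarith
  have "inner_rate \<le> sqrt (exp (- 1 / 12))"
    unfolding inner_rate_def using exp_ge_add_one_self[of "- 1 / 12"] by (intro real_sqrt_le_mono) simp
  also have "\<dots> = exp (- 1 / 24)"
    by (rule real_sqrt_unique) (simp_all add: exp_double[symmetric])
  finally show "inner_rate \<le> exp (- 1 / 24)" .
  also have "\<dots> \<le> 1" by simp
  finally show "inner_rate \<le> 1" .
qed

lemma inner_rate_powr: "(11 / 12) powr (real j / 2) = inner_rate ^ j"
proof -
  have "(11 / 12 :: real) powr (real j / 2) = ((11 / 12) powr (1 / 2)) powr real j"
    by (simp add: powr_powr)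
  also have "\<dots> = inner_rate ^ j"
    by (simp add: powr_half_sqrt inner_rate_def powr_realpow)
  finally show ?thesis .
qed

text \<open>The exact stationary point \<open>xh\<close> of the model is the intermediary: its
  multiplier contracts, and replacing \<open>xh\<close> by the AGD output moves the point by at most
  \<open>\<delta>\<close> and the multiplier by at most
  \<open>op_norm A / l * \<delta>\<close>.\<close>

lemma inner_solver_step:
  fixes A :: "real^'n^'m"
  assumes Lf: "0 < Lf" and \<phi>: "smooth_strongly_convex (3 * Lf) Lf \<phi>"
    and h: "proper_closed_convex h" and A: "surj ((*v) A)" and kkt: "kkt_pair \<phi> h A b xs ws"
  defines "l \<equiv> mu_dual (3 * Lf) A"
  assumes \<nu>: "norm (\<nu> - ws) \<le> E" and x: "norm (x - xs) + op_norm A / Lf * E \<le> Q * \<delta>" and \<delta>: "0 < \<delta>"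
    and Z: "1 \<le> Z" "432 * cond_number A ^ 6 * Q\<^sup>2 \<le> Z"
  obtains t y where "agd_returns (ppa_model \<phi> h A b l \<nu>) (3 * Lf + (op_norm A)\<^sup>2 / l) Lf x \<delta> t y"
    "real t \<le> 1 + 3 * cond_number A * ln Z"
    "norm (y - xs) \<le> \<delta> + op_norm A / Lf * (3 / 4 * E)"
    "norm (dual_prox h l \<nu> (A *v y - b) - ws) \<le> 3 / 4 * E + op_norm A / l * \<delta>"
proof -
  define a m where "a = op_norm A" and "m = min_singular A"
  have m: "0 < m" and am: "m \<le> a"
    using min_singular_bounds(1)[OF A] min_singular_le_op_norm[OF A] by (simp_all add: m_def a_def)
  have l_eq: "l = m\<^sup>2 / (3 * Lf)" by (simp add: l_def mu_dual_def m_def)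
  have l: "0 < l" using m Lf by (simp add: l_eq)
  have E: "0 \<le> E" using \<nu> norm_ge_zero[of "\<nu> - ws"] by linarith
  define \<kappa> where "\<kappa> = cond_number A"
  have \<kappa>: "\<kappa> = a / m" "1 \<le> \<kappa>" using m am by (simp_all add: \<kappa>_def cond_number_def a_def m_def)
  define \<Psi> where "\<Psi> = ppa_model \<phi> h A b l \<nu>"
  define L where "L = 3 * Lf + a\<^sup>2 / l"
  have \<Psi>: "smooth_strongly_convex L Lf \<Psi>"
    unfolding \<Psi>_def L_def a_def by (rule ppa_model_regularity(1)[OF \<phi> h l])
  \<comment> \<open>For \<open>l = m\<^sup>2 / (3 * Lf)\<close> the penalty contributes
    \<open>a\<^sup>2 / l = 3 * Lf * \<kappa>\<^sup>2\<close>. The cube of the bound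
    \<open>6 * \<kappa>\<^sup>2\<close> and the 2 of the AGD estimate give the 432 in the condition
    on \<open>Z\<close>.\<close>
  have ratio: "L / Lf = 3 + 3 * \<kappa>\<^sup>2"
    using Lf m by (simp add: L_def l_eq \<kappa> power2_eq_square field_simps)
  have "0 \<le> a\<^sup>2 / l" using l by simp
  then have LL: "Lf \<le> L" using Lf unfolding L_def by linarith
  have \<kappa>2: "1 \<le> \<kappa>\<^sup>2" using \<kappa>(2) by simp
  obtain xh where xh: "gradient \<Psi> xh = 0" using ssc_minimizer_exists[OF \<Psi>] by blast
  define wh where "wh = dual_prox h l \<nu> (A *v xh - b)"
  have L3: "0 < 3 * Lf" using Lf by simp
  have c1: "(l + Lf * (m / (3 * Lf))\<^sup>2) * norm (wh - ws) \<le> l * norm (\<nu> - ws)"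
    and c2: "Lf * norm (xh - xs) \<le> a * norm (wh - ws)"
    using ppa_contraction[OF \<phi> L3 h A l kkt xh[unfolded \<Psi>_def]]
    by (simp_all add: wh_def a_def m_def)
  \<comment> \<open>The dual modulus is \<open>l / 3\<close>, which is where the factor 3/4 comes
    from.\<close>
  have "l + Lf * (m / (3 * Lf))\<^sup>2 = l * (4 / 3)"
    using Lf by (simp add: l_eq power2_eq_square field_simps)
  then have "l * (4 / 3 * norm (wh - ws)) \<le> l * norm (\<nu> - ws)" using c1 by (simp only: mult.assoc)
  then have wh: "norm (wh - ws) \<le> 3 / 4 * E" using l \<nu> by simp
  have a0: "0 \<le> a" using m am by simp
  have "norm (xh - xs) \<le> a / Lf * norm (wh - ws)" using c2 Lf by (simp add: field_simps)
  also have "\<dots> \<le> a / Lf * (3 / 4 * E)" using wh a0 Lf by (intro mult_left_mono) auto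
  finally have xh_xs: "norm (xh - xs) \<le> a / Lf * (3 / 4 * E)" .
  also have "\<dots> \<le> a / Lf * E" using a0 Lf E by (intro mult_left_mono) auto
  finally have "norm (x - xh) \<le> Q * \<delta>"
    using x norm_triangle_ineq4[of "x - xs" "xh - xs"] by (simp add: a_def)
  moreover have "2 * (L / Lf) ^ 3 * Q\<^sup>2 \<le> Z"
  proof -
    have "L / Lf \<le> 6 * \<kappa>\<^sup>2" unfolding ratio using \<kappa>2 by simp
    then have "(L / Lf) ^ 3 \<le> (6 * \<kappa>\<^sup>2) ^ 3" using LL Lf by (intro power_mono) auto
    also have "\<dots> = 216 * \<kappa> ^ 6" by (simp add: power_mult_distrib flip: power_mult)
    finally have "2 * (L / Lf) ^ 3 * Q\<^sup>2 \<le> 2 * (216 * \<kappa> ^ 6) * Q\<^sup>2"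
      by (intro mult_right_mono mult_left_mono) auto
    also have "\<dots> = 432 * cond_number A ^ 6 * Q\<^sup>2" by (simp add: \<kappa>_def)
    also note Z(2)
    finally show ?thesis .
  qed
  ultimately obtain t y where ret: "agd_returns \<Psi> L Lf x \<delta> t y"
    and t: "real t \<le> 1 + sqrt (L / Lf) * ln Z"
    using agd_terminates[OF \<Psi> LL xh \<delta> _ Z(1)] by blast
  have "sqrt (L / Lf) \<le> 3 * \<kappa>"
  proof (rule real_le_lsqrt)
    show "L / Lf \<le> (3 * \<kappa>)\<^sup>2" unfolding ratio power_mult_distrib using \<kappa>2 by simp
  qed (use \<kappa>(2) in simp)
  then have "sqrt (L / Lf) * ln Z \<le> 3 * \<kappa> * ln Z" using Z(1) by (intro mult_right_mono) auto
  then have t': "real t \<le> 1 + 3 * \<kappa> * ln Z" using t by simp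
  have y: "norm (y - xh) \<le> \<delta>" by (rule agd_returns_accuracy[OF \<Psi> xh ret])
  have "norm (dual_prox h l \<nu> (A *v y - b) - wh) \<le> norm ((A *v y - b) - (A *v xh - b)) / l"
    unfolding wh_def by (rule dual_prox_lipschitz[OF h l])
  also have "\<dots> = norm (A *v (y - xh)) / l" by (simp add: matrix_vector_mult_diff_distrib)
  also have "\<dots> \<le> a * \<delta> / l"
    using norm_matrix_le[of A "y - xh"] mult_left_mono[OF y a0] l
    unfolding a_def by (intro divide_right_mono) linarith+
  finally have "norm (dual_prox h l \<nu> (A *v y - b) - ws) \<le> 3 / 4 * E + a / l * \<delta>"
    using wh norm_triangle_ineq[of "dual_prox h l \<nu> (A *v y - b) - wh" "wh - ws"] by simp
  moreover have "norm (y - xs) \<le> \<delta> + a / Lf * (3 / 4 * E)"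
    using y xh_xs norm_triangle_ineq[of "y - xh" "xh - xs"] by simp
  ultimately show ?thesis
    using that[OF ret[unfolded \<Psi>_def L_def a_def] t'[unfolded \<kappa>_def]] by (simp add: a_def)
qed

text \<open>Both errors follow the tolerances because \<open>r \<ge> 15 / 16\<close> exceeds the
  contraction factor with room: \<open>3/4 * 16/15 = 4/5\<close>, so a fifth of \<open>K\<close> is
  left for the AGD error, and \<open>K\<close> contains \<open>op_norm A / l * D\<close> five times
  for that. The starting distance over the tolerance is then bounded by one \<open>Q\<close> for all
  iterations.\<close>

lemma inner_solver_bound:
  fixes A :: "real^'n^'m"
  assumes Lf: "0 < Lf" and \<phi>: "smooth_strongly_convex (3 * Lf) Lf \<phi>"
    and h: "proper_closed_convex h" and A: "surj ((*v) A)" and kkt: "kkt_pair \<phi> h A b xs ws"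
  defines "l \<equiv> mu_dual (3 * Lf) A"
  assumes D: "0 < D" and \<delta>: "0 < \<delta>"
    and X: "norm (c - xs) \<le> X" and Y: "norm (\<nu>0 - ws) \<le> Y"
  defines "K \<equiv> Y + 5 * (op_norm A / l) * D"
  defines "K2 \<equiv> D + op_norm A / Lf * K"
  assumes Z: "1 \<le> Z" "432 * cond_number A ^ 6 * ((2 * X + 3 * K2) / D)\<^sup>2 \<le> Z"
    and Z': "1 \<le> Z'" "K2 / \<delta> \<le> Z'"
  obtains N x where "ppa_returns \<phi> h A b (3 * Lf) Lf l D c \<nu>0 \<delta> N x"
    "real N \<le> (2 + 24 * ln Z') * (3 + 6 * cond_number A * ln Z)"
proof -
  define a r where "a = op_norm A" and "r = inner_rate"
  have a0: "0 \<le> a" by (simp add: a_def op_norm_nonneg)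
  have r: "15 / 16 \<le> r" "r \<le> 1" "0 < r" using inner_rate_bounds by (simp_all add: r_def)
  have l: "0 < l" using min_singular_bounds(1)[OF A] Lf by (simp add: l_def mu_dual_def)
  have X0: "0 \<le> X" using X norm_ge_zero[of "c - xs"] by linarith
  have Y0: "0 \<le> Y" using Y norm_ge_zero[of "\<nu>0 - ws"] by linarith
  have alD: "0 \<le> a / l * D" using a0 l D by simp
  have K_Y: "Y \<le> K" and K_D: "a / l * D \<le> K / 5" and K0: "0 \<le> K"
  proof -
    have "K = Y + 5 * (a / l * D)" unfolding K_def a_def by (simp only: mult.assoc)
    then show "Y \<le> K" "a / l * D \<le> K / 5" "0 \<le> K" using alD Y0 by linarith+
  qed
  have aK: "0 \<le> a / Lf * K" using a0 Lf K0 by simp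
  have K2: "0 < K2" "a / Lf * K \<le> K2" using aK D by (simp_all add: K2_def a_def)
  define Q where "Q = (2 * X + 3 * K2) / D"
  \<comment> \<open>States are triples of iterate, multiplier and step count. The starting point
    obeys only \<open>X\<close>, which may be unrelated to \<open>K2\<close>; the bound
    \<open>K2 * r ^ n\<close> holds from the first iteration on.\<close>
  define P where "P n s \<longleftrightarrow> norm (fst (snd s) - ws) \<le> K * r ^ n \<and>
      norm (fst s - xs) \<le> (if n = 0 then X else K2 * r ^ n) \<and>
      (n = 0 \<longrightarrow> fst s = c \<and> fst (snd s) = \<nu>0)" for n and s :: "(real^'n) \<times> (real^'m) \<times> nat"
  define R where "R n s s' \<longleftrightarrow>
      agd_returns (ppa_model \<phi> h A b l (fst (snd s))) (3 * Lf + (op_norm A)\<^sup>2 / l) Lf (fst s)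
        (r ^ Suc n * D) (snd (snd s')) (fst s') \<and>
      fst (snd s') = dual_prox h l (fst (snd s)) (A *v fst s' - b) \<and>
      real (snd (snd s')) \<le> 1 + 3 * cond_number A * ln Z"
    for n and s s' :: "(real^'n) \<times> (real^'m) \<times> nat"
  have "\<exists>f. \<forall>n. P n (f n) \<and> R n (f n) (f (Suc n))"
  proof (rule dependent_nat_choice)
    show "\<exists>s. P 0 s" using X Y K_Y by (intro exI[of _ "(c, \<nu>0, 0)"]) (simp add: P_def)
    fix s n assume P: "P n s"
    define E where "E = K * r ^ n"
    have E0: "0 \<le> E" using K0 r by (simp add: E_def)
    have rn: "0 < r ^ n" using r by simp
    define d where "d = r ^ Suc n * D"
    have d: "0 < d" using r D by (simp add: d_def)
    have up: "u * r ^ n \<le> 16 / 15 * u * r ^ Suc n" if "0 \<le> u" for u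
    proof -
      have "u * r ^ n * 1 \<le> u * r ^ n * (16 / 15 * r)" using that rn r by (intro mult_left_mono) auto
      then show ?thesis by (simp add: mult_ac)
    qed
    have \<nu>: "norm (fst (snd s) - ws) \<le> E" using P by (simp add: P_def E_def)
    have start: "norm (fst s - xs) + op_norm A / Lf * E \<le> Q * d"
    proof -
      have "norm (fst s - xs) \<le> (2 * X + 16 / 15 * K2) * r ^ Suc n"
      proof (cases "n = 0")
        case True
        have "X \<le> 16 / 15 * X * r" using up[OF X0] True by simp
        also have "\<dots> \<le> (2 * X + 16 / 15 * K2) * r" using X0 K2 r by (intro mult_right_mono) auto
        finally have "X \<le> (2 * X + 16 / 15 * K2) * r" .
        moreover have "norm (fst s - xs) \<le> X" using P True X by (simp add: P_def)
        ultimately show ?thesis using True by simp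
      next
        case False
        then have "norm (fst s - xs) \<le> K2 * r ^ n" using P by (simp add: P_def)
        also have "\<dots> \<le> 16 / 15 * K2 * r ^ Suc n" using up K2 by simp
        also have "\<dots> \<le> (2 * X + 16 / 15 * K2) * r ^ Suc n" using X0 r by (intro mult_right_mono) auto
        finally show ?thesis .
      qed
      moreover have "op_norm A / Lf * E \<le> 16 / 15 * (a / Lf * K) * r ^ Suc n"
        using up[OF aK] by (simp add: E_def a_def)
      moreover have "16 / 15 * (a / Lf * K) * r ^ Suc n \<le> 16 / 15 * K2 * r ^ Suc n"
        using K2 r by (intro mult_right_mono mult_left_mono) auto
      ultimately have "norm (fst s - xs) + op_norm A / Lf * E \<le> (2 * X + 32 / 15 * K2) * r ^ Suc n"
        unfolding distrib_right by linarith
      also have "\<dots> \<le> (2 * X + 3 * K2) * r ^ Suc n" using K2 r by (intro mult_right_mono) auto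
      also have "\<dots> = Q * d" using D by (simp add: Q_def d_def)
      finally show ?thesis .
    qed
    obtain t y where ret: "agd_returns (ppa_model \<phi> h A b l (fst (snd s))) (3 * Lf + (op_norm A)\<^sup>2 / l) Lf (fst s) d t y"
      and t: "real t \<le> 1 + 3 * cond_number A * ln Z"
      and y: "norm (y - xs) \<le> d + op_norm A / Lf * (3 / 4 * E)"
      and w: "norm (dual_prox h l (fst (snd s)) (A *v y - b) - ws) \<le> 3 / 4 * E + op_norm A / l * d"
      using inner_solver_step[OF Lf \<phi> h A kkt \<nu> start d Z(1) Z(2)[folded Q_def]] unfolding l_def by blast
    have E_up: "3 / 4 * E \<le> 4 / 5 * K * r ^ Suc n" using up[OF K0] unfolding E_def by simp
    have "op_norm A / l * d = a / l * D * r ^ Suc n" by (simp add: d_def a_def)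
    also have "\<dots> \<le> K / 5 * r ^ Suc n" using K_D r by (intro mult_right_mono) auto
    finally have "norm (dual_prox h l (fst (snd s)) (A *v y - b) - ws) \<le> K * r ^ Suc n"
      using w E_up by linarith
    moreover have "norm (y - xs) \<le> K2 * r ^ Suc n"
    proof -
      have "4 / 5 * K * r ^ Suc n \<le> K * r ^ Suc n" using K0 r by (intro mult_right_mono) auto
      then have "a / Lf * (3 / 4 * E) \<le> a / Lf * (K * r ^ Suc n)"
        using E_up a0 Lf by (intro mult_left_mono) auto
      moreover have "K2 * r ^ Suc n = d + a / Lf * (K * r ^ Suc n)"
        by (simp only: K2_def d_def a_def distrib_right mult.commute[of D] mult.assoc)
      ultimately show ?thesis using y by (simp add: a_def)
    qed
    ultimately have "P (Suc n) (y, dual_prox h l (fst (snd s)) (A *v y - b), t)"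
      by (simp add: P_def)
    moreover have "R n s (y, dual_prox h l (fst (snd s)) (A *v y - b), t)"
      using ret t by (simp add: R_def d_def)
    ultimately show "\<exists>s'. P (Suc n) s' \<and> R n s s'" by blast
  qed
  then obtain F where F: "\<And>n. P n (F n)" "\<And>n. R n (F n) (F (Suc n))" by blast
  define u v t where "u n = fst (F n)" and "v n = fst (snd (F n))" and "t n = snd (snd (F n))" for n
  have rate: "1 - mu_dual (3 * Lf) A / (12 * l) = 11 / 12" using l by (simp add: l_def)
  have iter: "ppa_iterates \<phi> h A b (3 * Lf) Lf l D c \<nu>0 J u v t" for J
    unfolding ppa_iterates_def
  proof (intro conjI ballI)
    show "u 0 = c" "v 0 = \<nu>0" using F(1)[of 0] by (simp_all add: P_def u_def v_def)
    fix j assume "j \<in> {1..J}"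
    then obtain n where j: "j = Suc n" by (cases j) auto
    show "agd_returns (ppa_model \<phi> h A b l (v (j - 1))) (3 * Lf + (op_norm A)\<^sup>2 / l) Lf (u (j - 1))
        ((1 - mu_dual (3 * Lf) A / (12 * l)) powr (real j / 2) * D) (t j) (u j)"
      using F(2)[of n] unfolding rate inner_rate_powr by (simp add: R_def u_def v_def t_def j r_def)
    show "v j = prox (\<lambda>w. ereal (1 / l) * conjugate h w) (v (j - 1) + (1 / l) *\<^sub>R (A *v u j - b))"
      using F(2)[of n] by (simp add: R_def u_def v_def j dual_prox_def)
  qed
  have u_bound: "norm (u n - xs) \<le> K2 * r ^ n" if "1 \<le> n" for n
    using F(1)[of n] that by (simp add: P_def u_def)
  have t_bound: "real (t n) \<le> 1 + 3 * cond_number A * ln Z" if n: "1 \<le> n" for n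
  proof -
    obtain k where "n = Suc k" using n by (cases n) auto
    then show ?thesis using F(2)[of k] by (simp add: R_def t_def)
  qed
  have prim: "primal_sol \<phi> h A b = xs" by (rule kkt_pair_primal_sol[OF \<phi> kkt])
  define B where "B j \<longleftrightarrow> 1 \<le> j \<and> norm (u j - xs) \<le> \<delta>" for j
  \<comment> \<open>\<open>r \<le> exp (- 1 / 24)\<close>, so \<open>24 * ln Z'\<close> iterations
    shrink the error by the factor \<open>Z'\<close>. The \<open>+ 1\<close> guarantees one
    iteration, since the starting point itself is never returned.\<close>
  define j0 where "j0 = nat \<lceil>24 * ln Z'\<rceil> + 1"
  have lnZ': "0 \<le> ln Z'" using Z' by simp
  have j0: "24 * ln Z' \<le> real j0" "real j0 \<le> 2 + 24 * ln Z'"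
    using lnZ' unfolding j0_def by linarith+
  have "r ^ j0 \<le> exp (- 1 / 24) ^ j0"
    using r inner_rate_bounds(2) by (intro power_mono) (auto simp: r_def)
  also have "\<dots> = exp (- (real j0 / 24))" by (simp add: exp_of_nat_mult[symmetric])
  also have "\<dots> \<le> exp (- ln Z')" using j0(1) by simp
  also have "\<dots> = 1 / Z'" using Z' by (simp add: exp_minus inverse_eq_divide)
  finally have "K2 * r ^ j0 \<le> K2 * (1 / Z')" using K2 by (intro mult_left_mono) auto
  also have "\<dots> \<le> \<delta>" using Z' \<delta> by (simp add: field_simps)
  finally have "B j0" using u_bound[of j0] by (simp add: B_def j0_def)
  define J where "J = (LEAST j. B j)"
  have J: "B J" "J \<le> j0" unfolding J_def using \<open>B j0\<close> by (auto intro: LeastI Least_le)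
  have first: "\<delta> < norm (u j - xs)" if "j \<in> {1..<J}" for j
    using not_less_Least[of j B] that by (auto simp: J_def B_def)
  define N where "N = (\<Sum>j=1..J. agd_cost (t j))"
  have "ppa_returns \<phi> h A b (3 * Lf) Lf l D c \<nu>0 \<delta> N (u J)"
    unfolding ppa_returns_def prim
    by (rule exI[of _ J], rule exI[of _ u], rule exI[of _ v], rule exI[of _ t])
      (use iter J(1) first in \<open>auto simp: B_def N_def\<close>)
  moreover have "real N \<le> (2 + 24 * ln Z') * (3 + 6 * cond_number A * ln Z)"
  proof -
    have "real N = (\<Sum>j=1..J. 2 * real (t j) + 1)" by (simp add: N_def agd_cost_def add.commute)
    also have "\<dots> \<le> (\<Sum>j=1..J. 3 + 6 * cond_number A * ln Z)"
      using t_bound by (intro sum_mono) fastforce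
    also have "\<dots> = real J * (3 + 6 * cond_number A * ln Z)" by simp
    also have "\<dots> \<le> (2 + 24 * ln Z') * (3 + 6 * cond_number A * ln Z)"
    proof (rule mult_right_mono)
      show "real J \<le> 2 + 24 * ln Z'" using J(2) j0(2) by linarith
      have "0 \<le> cond_number A"
        using min_singular_bounds(1)[OF A] by (simp add: cond_number_def op_norm_nonneg)
      then show "0 \<le> 3 + 6 * cond_number A * ln Z" using Z(1) by simp
    qed
    finally show ?thesis .
  qed
  ultimately show ?thesis by (rule that)
qed

text \<open>Iterations of the inner solver times gradient evaluations per AGD run, which are
  \<open>2 * t + 1\<close> for \<open>t \<le> 1 + 3 * \<kappa> * ln Z\<close>. It stays a function
  of the initial distances \<open>X\<close> and \<open>Y\<close>, which are known only along the
  outer loop.\<close>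

definition inner_cost :: "real \<Rightarrow> real^'n^'m \<Rightarrow> real \<Rightarrow> real \<Rightarrow> real \<Rightarrow> real \<Rightarrow> real" where
  "inner_cost Lf A D \<delta> X Y =
     (let K = Y + 5 * (op_norm A / mu_dual (3 * Lf) A) * D; K2 = D + op_norm A / Lf * K
      in (2 + 24 * ln (max 1 (K2 / \<delta>))) *
         (3 + 6 * cond_number A * ln (max 1 (432 * cond_number A ^ 6 * ((2 * X + 3 * K2) / D)\<^sup>2))))"

lemma inner_solver_cost:
  fixes A :: "real^'n^'m"
  assumes "0 < Lf" and "smooth_strongly_convex (3 * Lf) Lf \<phi>"
    and "proper_closed_convex h" and "surj ((*v) A)" and "kkt_pair \<phi> h A b xs ws"
    and "0 < D" and "0 < \<delta>"
  obtains N x where "ppa_returns \<phi> h A b (3 * Lf) Lf (mu_dual (3 * Lf) A) D c \<nu> \<delta> N x"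
    "real N \<le> inner_cost Lf A D \<delta> (norm (c - xs)) (norm (\<nu> - ws))"
  using inner_solver_bound[OF assms order_refl order_refl max.cobounded1 max.cobounded2
      max.cobounded1 max.cobounded2]
  unfolding inner_cost_def Let_def by blast

section \<open>Bounding the parameters by powers of one number\<close>

lemma le_power_mult:
  fixes S u v :: real
  assumes "u \<le> S ^ i" "v \<le> S ^ j" "0 \<le> u" "0 \<le> v"
  shows "u * v \<le> S ^ (i + j)"
  unfolding power_add using assms by (intro mult_mono) auto

text \<open>One spare factor \<open>S \<ge> 2\<close> pays for the addition.\<close>

lemma le_power_add:
  fixes S u v :: real
  assumes "u \<le> S ^ i" "v \<le> S ^ j" "i < n" "j < n" "2 \<le> S"
  shows "u + v \<le> S ^ n"
proof -
  obtain k where k: "n = Suc k" using assms(3) by (cases n) auto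
  have "u \<le> S ^ k" "v \<le> S ^ k"
    using assms k by (auto intro: order_trans power_increasing)
  then have "u + v \<le> 2 * S ^ k" by simp
  also have "\<dots> \<le> S * S ^ k" using assms(5) by (intro mult_right_mono) auto
  finally show ?thesis by (simp add: k)
qed

lemma le_power_const:
  fixes S c :: real
  assumes "c \<le> 2 ^ i" "2 \<le> S"
  shows "c \<le> S ^ i"
  using assms power_mono[of 2 S i] by simp

text \<open>
  Every logarithm is bounded by \<open>ln S\<close> up to a constant because its argument is at most a fixed power
  of the number \<open>S\<close> that dominates all parameters. The exponents for \<open>1 / \<delta>\<close>, \<open>X\<close> and \<open>Y\<close> are those
  that hold along the outer loop.
\<close>

lemma inner_cost_le:
  fixes A :: "real^'n^'m"
  assumes A: "surj ((*v) A)" and S: "exp 1 \<le> S" and Lf: "0 < Lf" "Lf \<le> S" "1 / Lf \<le> S"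
    and a: "op_norm A \<le> S" and m: "1 / min_singular A \<le> S"
    and D: "0 < D" "D \<le> S" "1 / D \<le> S" and \<delta>: "0 < \<delta>" "1 / \<delta> \<le> S ^ 12"
    and X: "0 \<le> X" "X \<le> S ^ 2" and Y: "0 \<le> Y" "Y \<le> S ^ 17"
  shows "inner_cost Lf A D \<delta> X Y \<le> 350000 * cond_number A * (ln S)\<^sup>2"
proof -
  have S2: "2 \<le> S" using S exp_ge_add_one_self[of 1] by linarith
  have mpos: "0 < min_singular A" using min_singular_bounds(1)[OF A] .
  have S1: "1 \<le> ln S" using S S2 by (subst ln_ge_iff) auto
  note a0 = op_norm_nonneg[of A]
  define \<kappa> where "\<kappa> = cond_number A"
  have \<kappa>1: "1 \<le> \<kappa>"
    using min_singular_le_op_norm[OF A] mpos by (simp add: \<kappa>_def cond_number_def)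
  have p1: "u \<le> S ^ 1" if "u \<le> S" for u using that by simp
  have num_S: "2 \<le> S ^ 1" "3 \<le> S ^ 2" "5 \<le> S ^ 3" "432 \<le> S ^ 9"
    using S2 by (rule le_power_const[rotated], simp)+
  note le_S = num_S p1[OF a] p1[OF m] p1[OF Lf(2)] p1[OF Lf(3)] p1[OF D(2)] p1[OF D(3)]
  have \<kappa>S: "\<kappa> \<le> S ^ 2"
    using le_power_mult[OF p1[OF a] p1[OF m]] a0 mpos by (simp add: \<kappa>_def cond_number_def numeral_2_eq_2)
  have al: "op_norm A / mu_dual (3 * Lf) A = 3 * (op_norm A * (1 / min_singular A) * ((1 / min_singular A) * Lf))"
    using mpos Lf by (simp add: mu_dual_def power2_eq_square)
  have alS: "op_norm A / mu_dual (3 * Lf) A \<le> S ^ (2 + ((1 + 1) + (1 + 1)))" unfolding al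
    using a0 mpos Lf S2
    by (intro le_power_mult le_S) auto
  have al0: "0 \<le> op_norm A / mu_dual (3 * Lf) A" unfolding al using a0 mpos Lf by simp
  define K where "K = Y + 5 * (op_norm A / mu_dual (3 * Lf) A) * D"
  have K0: "0 \<le> K" unfolding K_def using Y al0 D by (intro add_nonneg_nonneg mult_nonneg_nonneg) auto
  have KS: "K \<le> S ^ 18" unfolding K_def
  proof (rule le_power_add)
    show "5 * (op_norm A / mu_dual (3 * Lf) A) * D \<le> S ^ (3 + (2 + ((1 + 1) + (1 + 1))) + 1)"
      using al0 D by (intro le_power_mult alS le_S) auto
  qed (use Y S2 in auto)
  define K2 where "K2 = D + op_norm A / Lf * K"
  have K20: "0 \<le> K2" using D a0 Lf K0 by (simp add: K2_def)
  have K2S: "K2 \<le> S ^ 21" unfolding K2_def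
  proof (rule le_power_add)
    have "op_norm A * (1 / Lf) * K \<le> S ^ (1 + 1 + 18)"
      using a0 Lf K0 by (intro le_power_mult le_S KS) auto
    then show "op_norm A / Lf * K \<le> S ^ (1 + 1 + 18)" by simp
    show "D \<le> S ^ 1" by (rule p1) (fact D(2))
  qed (use S2 in auto)
  define Q where "Q = (2 * X + 3 * K2) / D"
  have Q0: "0 \<le> Q" using X K20 D by (simp add: Q_def)
  have QS: "Q \<le> S ^ 25"
  proof -
    have "2 * X + 3 * K2 \<le> S ^ 24"
    proof (rule le_power_add)
      show "2 * X \<le> S ^ (1 + 2)" using X by (intro le_power_mult le_S) auto
      show "3 * K2 \<le> S ^ (2 + 21)" using K20 K2S by (intro le_power_mult le_S) auto
    qed (use S2 in auto)
    then have "(2 * X + 3 * K2) * (1 / D) \<le> S ^ (24 + 1)"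
      using X K20 D by (intro le_power_mult le_S) auto
    then show ?thesis by (simp add: Q_def)
  qed
  have S_ge: "1 \<le> S ^ n" for n using S2 by simp
  have "432 * \<kappa> ^ 6 * Q\<^sup>2 \<le> S ^ (9 + 12 + 50)"
  proof (intro le_power_mult le_S)
    show "\<kappa> ^ 6 \<le> S ^ 12" using power_mono[OF \<kappa>S, of 6] \<kappa>1 by (simp flip: power_mult)
    show "Q\<^sup>2 \<le> S ^ 50" using power_mono[OF QS Q0, of 2] by (simp flip: power_mult)
  qed (use \<kappa>1 in auto)
  then have Z: "max 1 (432 * \<kappa> ^ 6 * Q\<^sup>2) \<le> S ^ 71" using S_ge by simp
  have "K2 * (1 / \<delta>) \<le> S ^ (21 + 12)" using K20 K2S \<delta> by (intro le_power_mult) auto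
  then have Z': "max 1 (K2 / \<delta>) \<le> S ^ 33" using S_ge by simp
  have lnZ: "ln (max 1 (432 * \<kappa> ^ 6 * Q\<^sup>2)) \<le> 71 * ln S"
    using ln_mono[OF Z] S2 by (simp add: ln_realpow)
  have lnZ': "ln (max 1 (K2 / \<delta>)) \<le> 33 * ln S"
    using ln_mono[OF Z'] S2 by (simp add: ln_realpow)
  \<comment> \<open>The exponents 71 and 33 become the factors \<open>3 + 6 * 71 = 429\<close> and
    \<open>2 + 24 * 33 = 794\<close>; the additive 3 and 2 are absorbed because
    \<open>ln S \<ge> 1\<close> and \<open>\<kappa> \<ge> 1\<close>.\<close>
  have "1 * 1 \<le> \<kappa> * ln S" using \<kappa>1 S1 by (intro mult_mono) auto
  moreover have "\<kappa> * ln (max 1 (432 * \<kappa> ^ 6 * Q\<^sup>2)) \<le> \<kappa> * (71 * ln S)"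
    using lnZ \<kappa>1 by (intro mult_left_mono) auto
  ultimately have f2: "3 + 6 * \<kappa> * ln (max 1 (432 * \<kappa> ^ 6 * Q\<^sup>2)) \<le> 429 * (\<kappa> * ln S)" by linarith
  have f1: "2 + 24 * ln (max 1 (K2 / \<delta>)) \<le> 794 * ln S" using lnZ' S1 by linarith
  have nn: "0 \<le> ln (max 1 (432 * \<kappa> ^ 6 * Q\<^sup>2))" by simp
  have "inner_cost Lf A D \<delta> X Y = (2 + 24 * ln (max 1 (K2 / \<delta>))) * (3 + 6 * \<kappa> * ln (max 1 (432 * \<kappa> ^ 6 * Q\<^sup>2)))"
    by (simp add: inner_cost_def Let_def K_def K2_def Q_def \<kappa>_def)
  also have "\<dots> \<le> (794 * ln S) * (429 * (\<kappa> * ln S))"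
    using f1 f2 nn \<kappa>1 S1 by (intro mult_mono) auto
  also have "\<dots> = 340626 * (\<kappa> * (ln S)\<^sup>2)" by (simp add: power2_eq_square)
  also have "\<dots> \<le> 350000 * (\<kappa> * (ln S)\<^sup>2)" using \<kappa>1 by (intro mult_right_mono) auto
  finally show ?thesis by (simp add: \<kappa>_def)
qed

subsection \<open>The outer loop\<close>

lemma prox_smooth_part_regularity:
  assumes "smooth_fun Lf f" and "0 < Lf"
  shows "smooth_strongly_convex (3 * Lf) Lf (prox_smooth_part Lf f c)"
    and "gradient (prox_smooth_part Lf f c) x = gradient f x + (2 * Lf) *\<^sub>R (x - c)"
proof -
  have eq: "prox_smooth_part Lf f c = (\<lambda>x. f x + Lf * (norm (x - c))\<^sup>2)"
    by (simp add: fun_eq_iff prox_smooth_part_def)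
  show "smooth_strongly_convex (3 * Lf) Lf (prox_smooth_part Lf f c)"
    and "gradient (prox_smooth_part Lf f c) x = gradient f x + (2 * Lf) *\<^sub>R (x - c)"
    unfolding eq using ssc_shifted_square[OF assms] by blast+
qed

text \<open>
  The exact solution \<open>y\<close> of a subproblem is the proximal point of \<open>c - \<nabla>f(y) / (2 L\<^sub>f)\<close>.
\<close>

lemma subopt_nc_le:
  fixes A :: "real^'n^'m"
  assumes Lf: "0 < Lf" and f: "smooth_fun Lf f" and h: "proper_closed_convex h" and A: "surj ((*v) A)"
    and kkt: "kkt_pair (prox_smooth_part Lf f c) h A b y w"
  shows "subopt_nc Lf f h A b x \<le> Lf * (5 / 2 * norm (x - y) + norm (y - c))"
proof -
  define g where "g u = h (A *v u - b)" for u
  define G where "G u = ereal (1 / (2 * Lf)) * g u" for u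
  have g: "proper_closed_convex g" unfolding g_def by (rule proper_closed_convex_affine[OF A h])
  have s: "0 < 1 / (2 * Lf)" using Lf by simp
  have "subgradient g y (- gradient (prox_smooth_part Lf f c) y)"
    unfolding g_def by (rule kkt_pair_subgradient[OF kkt])
  then have "subgradient G y ((1 / (2 * Lf)) *\<^sub>R (- gradient (prox_smooth_part Lf f c) y))"
    unfolding G_def using s by (rule subgradient_scale)
  also have "(1 / (2 * Lf)) *\<^sub>R (- gradient (prox_smooth_part Lf f c) y)
      = (c - (1 / (2 * Lf)) *\<^sub>R gradient f y) - y"
    using Lf by (simp add: prox_smooth_part_regularity(2)[OF f Lf] algebra_simps)
  finally have y: "prox G (c - (1 / (2 * Lf)) *\<^sub>R gradient f y) = y" by (rule prox_eqI)
  define p where "p = prox G (x - (1 / (2 * Lf)) *\<^sub>R gradient f x)"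
  have "norm (p - y) \<le> norm ((x - (1 / (2 * Lf)) *\<^sub>R gradient f x) - (c - (1 / (2 * Lf)) *\<^sub>R gradient f y))"
    using prox_nonexpansive[OF g s] y unfolding p_def G_def by metis
  also have "(x - (1 / (2 * Lf)) *\<^sub>R gradient f x) - (c - (1 / (2 * Lf)) *\<^sub>R gradient f y)
      = ((x - y) + (y - c)) - (1 / (2 * Lf)) *\<^sub>R (gradient f x - gradient f y)"
    by (simp add: algebra_simps)
  also have "norm \<dots> \<le> norm ((x - y) + (y - c)) + norm ((1 / (2 * Lf)) *\<^sub>R (gradient f x - gradient f y))"
    by (rule norm_triangle_ineq4)
  also have "\<dots> \<le> (norm (x - y) + norm (y - c)) + 1 / 2 * norm (x - y)"
  proof (rule add_mono[OF norm_triangle_ineq])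
    show "norm ((1 / (2 * Lf)) *\<^sub>R (gradient f x - gradient f y)) \<le> 1 / 2 * norm (x - y)"
      unfolding norm_scaleR using smooth_fun_lipschitz[OF f, of x y] Lf by (simp add: field_simps)
  qed
  \<comment> \<open>5/2 is 1 for the way from \<open>x\<close> to \<open>y\<close>, 1 for the shift
    of the argument of the proximal map, and 1/2 for the change of \<open>gradient f\<close> scaled
    by \<open>1 / (2 * Lf)\<close>.\<close>
  finally have "norm (x - p) \<le> 5 / 2 * norm (x - y) + norm (y - c)"
    using norm_triangle_ineq4[of "x - y" "p - y"] by simp
  then show ?thesis
    using Lf unfolding subopt_nc_def p_def G_def g_def by (intro mult_left_mono) auto
qed

section \<open>Descent of the outer loop\<close>

lemma sum_inverse_squares_le: "(\<Sum>k=1..n. 1 / (real k)\<^sup>2) \<le> 2"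
proof -
  have "(\<Sum>k=1..Suc n. 1 / (real k)\<^sup>2) \<le> 2 - 1 / real (Suc n)" for n
  proof (induction n)
    case (Suc n)
    define u where "u = real (Suc n)"
    have u: "0 < u" "real (Suc (Suc n)) = u + 1" by (simp_all add: u_def)
    have "1 / (u + 1)\<^sup>2 \<le> 1 / (u * (u + 1))"
      using u by (intro divide_left_mono) (auto simp: power2_eq_square)
    also have "\<dots> = 1 / u - 1 / (u + 1)" using u by (simp add: field_simps)
    finally have "1 / (real (Suc (Suc n)))\<^sup>2 \<le> 1 / real (Suc n) - 1 / real (Suc (Suc n))"
      by (simp only: u u_def[symmetric])
    then show ?case using Suc by simp
  qed simp
  from this[of "n - 1"] show ?thesis
    by (cases n) (auto intro: order_trans)
qed

text \<open>Telescoping leaves the gap \<open>\<Delta>\<close> plus \<open>\<Delta> / 2\<close> from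
  the tolerances. The sum starts at the second subproblem: the first has no exact solution before it
  to compare with, and the objective at the starting point may be infinite.\<close>

lemma proximal_descent:
  fixes F a \<delta> :: "nat \<Rightarrow> real"
  assumes Lf: "0 < Lf" and \<Delta>: "0 < \<Delta>"
    and \<delta>: "\<And>k. \<delta> k = sqrt (\<Delta> / Lf) / (2 * real k)"
    and step: "\<And>k. 1 \<le> k \<Longrightarrow> F (Suc k) + Lf * (a (Suc k))\<^sup>2 \<le> F k + Lf * (\<delta> k)\<^sup>2"
    and gap: "\<And>k. 1 \<le> k \<Longrightarrow> F 1 \<le> F k + \<Delta>"
  shows "(\<Sum>k=1..n. (a (Suc k))\<^sup>2) \<le> 25 / 16 * (\<Delta> / Lf)"
proof -
  have tel: "F (Suc n) + Lf * (\<Sum>k=1..n. (a (Suc k))\<^sup>2) \<le> F 1 + Lf * (\<Sum>k=1..n. (\<delta> k)\<^sup>2)"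
  proof (induction n)
    case (Suc n)
    have "F (Suc (Suc n)) + Lf * (a (Suc (Suc n)))\<^sup>2 \<le> F (Suc n) + Lf * (\<delta> (Suc n))\<^sup>2"
      by (rule step) simp
    then show ?case using Suc by (simp add: distrib_left)
  qed simp
  have "(\<Sum>k=1..n. (\<delta> k)\<^sup>2) = \<Delta> / Lf / 4 * (\<Sum>k=1..n. 1 / (real k)\<^sup>2)"
    using \<Delta> Lf by (simp add: \<delta> power_divide power_mult_distrib sum_distrib_left mult_ac)
  also have "\<dots> \<le> \<Delta> / Lf / 4 * 2"
    using \<Delta> Lf by (intro mult_left_mono sum_inverse_squares_le) auto
  finally have "Lf * (\<Sum>k=1..n. (\<delta> k)\<^sup>2) \<le> Lf * (\<Delta> / Lf / 2)" using Lf by (intro mult_left_mono) auto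
  also have "\<dots> = \<Delta> / 2" using Lf by simp
  finally have "Lf * (\<Sum>k=1..n. (a (Suc k))\<^sup>2) \<le> 3 / 2 * \<Delta>"
    using tel gap[of "Suc n"] by simp
  then have "(\<Sum>k=1..n. (a (Suc k))\<^sup>2) \<le> 3 / 2 * (\<Delta> / Lf)" using Lf by (simp add: field_simps)
  \<comment> \<open>3/2 is rounded up to 25/16, whose square root 5/4 is rational.\<close>
  also have "\<dots> \<le> 25 / 16 * (\<Delta> / Lf)" using Lf \<Delta> by (intro mult_right_mono) auto
  finally show ?thesis .
qed

text \<open>Both claims of the theorem come down to this one, since it asks for the gap at the first
  exact solution only.\<close>

lemma finds_within_of_gap:
  fixes f :: "real^'n \<Rightarrow> real" and h :: "real^'m \<Rightarrow> ereal"
    and A :: "real^'n^'m" and b :: "real^'m" and Lf :: real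
  assumes Lf: "0 < Lf" and f: "smooth_fun Lf f" and h: "proper_closed_convex h"
    and A: "surj ((*v) A)" and D: "0 < D" and \<epsilon>: "0 < \<epsilon>"
    and R: "norm (x0 - primal_sol (prox_smooth_part Lf f x0) h A b) \<le> R"
    and R': "\<And>k. 1 \<le> k \<Longrightarrow> norm (lam0 k - dual_sol (prox_smooth_part Lf f x0) h A b) \<le> R"
    and \<Delta>: "0 < \<Delta>"
    and gap: "objective f h A b (primal_sol (prox_smooth_part Lf f x0) h A b)
      - (INF x. objective f h A b x) \<le> ereal \<Delta>"
  shows "finds_within f h A b Lf (mu_dual (3 * Lf) A) D x0 lam0 R \<Delta> \<epsilon>"
proof -
  define \<phi> where "\<phi> c = prox_smooth_part Lf f c" for c
  define l where "l = mu_dual (3 * Lf) A"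
  have \<phi>: "smooth_strongly_convex (3 * Lf) Lf (\<phi> c)"
    and grad: "gradient (\<phi> c) x = gradient f x + (2 * Lf) *\<^sub>R (x - c)" for c x
    unfolding \<phi>_def using prox_smooth_part_regularity[OF f Lf] by blast+
  have "\<exists>z. kkt_pair (\<phi> c) h A b (fst z) (snd z)" for c
    using kkt_pair_exists[OF \<phi>[of c] h A] by (metis fst_conv snd_conv)
  then obtain z where z: "\<And>c. kkt_pair (\<phi> c) h A b (fst (z c)) (snd (z c))" by metis
  define XS WS where "XS c = fst (z c)" and "WS c = snd (z c)" for c
  have kkt: "kkt_pair (\<phi> c) h A b (XS c) (WS c)" for c unfolding XS_def WS_def by (rule z)
  have prim: "primal_sol (\<phi> c) h A b = XS c" for c by (rule kkt_pair_primal_sol[OF \<phi> kkt])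
  have dual: "dual_sol (\<phi> c) h A b = WS c" for c by (rule kkt_pair_dual_sol[OF \<phi> A kkt])
  define \<sigma> where "\<sigma> = sqrt (\<Delta> / Lf)"
  have \<sigma>: "0 < \<sigma>" "\<sigma>\<^sup>2 = \<Delta> / Lf" using \<Delta> Lf by (simp_all add: \<sigma>_def)
  define \<delta> where "\<delta> k = sqrt (\<Delta> / Lf) / (2 * real k)" for k
  have \<delta>_pos: "0 < \<delta> k" if "1 \<le> k" for k using that \<Delta> Lf by (simp add: \<delta>_def)
  define G where "G n s s' \<longleftrightarrow>
      ppa_returns (\<phi> (fst s)) h A b (3 * Lf) Lf l D (fst s) (lam0 (Suc n)) (\<delta> (Suc n)) (snd s') (fst s') \<and>
      real (snd s') \<le> inner_cost Lf A D (\<delta> (Suc n)) (norm (fst s - XS (fst s)))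
        (norm (lam0 (Suc n) - WS (fst s)))" for n and s s' :: "(real^'n) \<times> nat"
  \<comment> \<open>The centre of each subproblem is the inexact output of the previous one, so the
    run is built by dependent choice; the clause for \<open>n = 0\<close> fixes the start.\<close>
  have "\<exists>F. \<forall>n. (n = 0 \<longrightarrow> fst (F n) = x0) \<and> G n (F n) (F (Suc n))"
  proof (rule dependent_nat_choice)
    show "\<exists>s::(real^'n) \<times> nat. (0::nat) = 0 \<longrightarrow> fst s = x0" by (intro exI[of _ "(x0, 0)"]) simp
    fix s :: "(real^'n) \<times> nat" and n
    obtain N x where "ppa_returns (\<phi> (fst s)) h A b (3 * Lf) Lf l D (fst s) (lam0 (Suc n)) (\<delta> (Suc n)) N x"
      "real N \<le> inner_cost Lf A D (\<delta> (Suc n)) (norm (fst s - XS (fst s))) (norm (lam0 (Suc n) - WS (fst s)))"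
      using inner_solver_cost[OF Lf \<phi> h A kkt[of "fst s"] D \<delta>_pos, where c = "fst s" and \<nu> = "lam0 (Suc n)"]
      unfolding l_def by (metis le_add1 plus_1_eq_Suc)
    then have "G n s (x, N)" by (simp add: G_def)
    then show "\<exists>s'. (Suc n = 0 \<longrightarrow> fst s' = x0) \<and> G n s s'" by blast
  qed
  then obtain F where F: "fst (F 0) = x0" "\<And>n. G n (F n) (F (Suc n))" by blast
  define xs Ns where "xs n = fst (F n)" and "Ns n = snd (F n)" for n
  define c w a where "c k = XS (xs (k - 1))" and "w k = WS (xs (k - 1))"
    and "a k = norm (c k - xs (k - 1))" for k
  have xs0: "xs 0 = x0" by (simp add: xs_def F)
  have ret: "ppa_returns (\<phi> (xs (k - 1))) h A b (3 * Lf) Lf l D (xs (k - 1)) (lam0 k) (\<delta> k) (Ns k) (xs k)"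
    and cost: "real (Ns k) \<le> inner_cost Lf A D (\<delta> k) (a k) (norm (lam0 k - w k))"
    if k: "1 \<le> k" for k
  proof -
    obtain n where "k = Suc n" using k by (cases k) auto
    then show "ppa_returns (\<phi> (xs (k - 1))) h A b (3 * Lf) Lf l D (xs (k - 1)) (lam0 k) (\<delta> k) (Ns k) (xs k)"
      and "real (Ns k) \<le> inner_cost Lf A D (\<delta> k) (a k) (norm (lam0 k - w k))"
      using F(2)[of n] by (simp_all add: G_def xs_def Ns_def a_def c_def w_def norm_minus_commute)
  qed
  have acc: "norm (xs k - c k) \<le> \<delta> k" if "1 \<le> k" for k
    using ret[OF that] by (auto simp: ppa_returns_def prim c_def)
  have kkt_c: "kkt_pair (\<phi> (xs (k - 1))) h A b (c k) (w k)" for k unfolding c_def w_def by (rule kkt)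
  have "\<exists>t. h (A *v c k - b) = ereal t" for k
    using kkt_c[of k] by (auto simp: kkt_pair_def elim: subgradientE)
  then obtain t where t: "\<And>k. h (A *v c k - b) = ereal (t k)" by metis
  define Fv where "Fv k = f (c k) + t k" for k
  have Fv: "objective f h A b (c k) = ereal (Fv k)" for k by (simp add: objective_def t Fv_def)
  have step: "Fv (Suc k) + Lf * (a (Suc k))\<^sup>2 \<le> Fv k + Lf * (\<delta> k)\<^sup>2" if "1 \<le> k" for k
  proof -
    \<comment> \<open>The previous exact solution \<open>c k\<close> is the competitor: it has a
      finite value, and its penalty is controlled by the tolerance with which \<open>xs k\<close>
      approximates it.\<close>
    have "objective (\<phi> (xs k)) h A b (c (Suc k)) + ereal (Lf / 2 * (norm (c k - c (Suc k)))\<^sup>2)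
        \<le> objective (\<phi> (xs k)) h A b (c k)"
      using kkt_pair_growth[OF \<phi> kkt_c[of "Suc k"]] by simp
    then have "\<phi> (xs k) (c (Suc k)) + t (Suc k) + Lf / 2 * (norm (c k - c (Suc k)))\<^sup>2
        \<le> \<phi> (xs k) (c k) + t k"
      by (simp add: objective_def t)
    moreover have "0 \<le> Lf / 2 * (norm (c k - c (Suc k)))\<^sup>2" using Lf by simp
    moreover have "Lf * (norm (c k - xs k))\<^sup>2 \<le> Lf * (\<delta> k)\<^sup>2"
      using acc[OF that] Lf by (intro mult_left_mono power_mono) (auto simp: norm_minus_commute)
    ultimately show ?thesis by (simp add: \<phi>_def prox_smooth_part_def Fv_def a_def)
  qed
  have c1: "c 1 = primal_sol (prox_smooth_part Lf f x0) h A b"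
    using prim[of x0] by (simp add: c_def xs0 \<phi>_def)
  have w1: "w 1 = dual_sol (prox_smooth_part Lf f x0) h A b"
    using dual[of x0] by (simp add: w_def xs0 \<phi>_def)
  have gap': "Fv 1 \<le> Fv k + \<Delta>" for k
  proof -
    have "(INF x. objective f h A b x) \<le> ereal (Fv k)" unfolding Fv[symmetric] by (rule INF_lower) simp
    then show ?thesis using gap unfolding c1[symmetric] Fv
      by (cases "INF x. objective f h A b x") auto
  qed
  have sum_a: "(\<Sum>k=1..n. (a (Suc k))\<^sup>2) \<le> 25 / 16 * \<sigma>\<^sup>2" for n
    unfolding \<sigma>(2) by (rule proximal_descent[OF Lf \<Delta> \<delta>_def step gap'])
  have a_le: "a (Suc k) \<le> 5 / 4 * \<sigma>" if "1 \<le> k" for k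
  proof -
    have "(a (Suc k))\<^sup>2 \<le> (\<Sum>k=1..k. (a (Suc k))\<^sup>2)"
      using that by (intro member_le_sum[of k "{1..k}" "\<lambda>k. (a (Suc k))\<^sup>2"]) auto
    also have "\<dots> \<le> 25 / 16 * \<sigma>\<^sup>2" by (rule sum_a)
    also have "\<dots> = (5 / 4 * \<sigma>)\<^sup>2" by (simp add: power2_eq_square)
    finally show ?thesis by (rule power2_le_imp_le) (use \<sigma>(1) in simp)
  qed
  define x where "x = Lf * \<Delta> / \<epsilon>\<^sup>2"
  have x0: "0 < x" using Lf \<Delta> \<epsilon> by (simp add: x_def)
  \<comment> \<open>With \<open>s = \<sigma> / sqrt M\<close> the tolerance and the displacement
    contribute \<open>5/4 * s\<close> each to the suboptimality, and
    \<open>Lf * (5/2 * s) \<le> \<epsilon>\<close> amounts to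
    \<open>25/4 * x \<le> M\<close>.\<close>
  define M where "M = nat \<lceil>25 / 4 * x\<rceil> + 1"
  have M: "25 / 4 * x \<le> real M" "real M \<le> 25 / 4 * x + 2" "1 \<le> M"
    using x0 unfolding M_def by linarith+
  define T where "T = 2 * M"
  obtain k0 where k0: "M \<le> k0" "k0 < T" "(a (Suc k0))\<^sup>2 \<le> 25 / 16 * \<sigma>\<^sup>2 / real M"
  proof -
    \<comment> \<open>The window holds \<open>M\<close> indices, so one term is at most the average;
      starting it at \<open>M\<close> makes the tolerance of order \<open>\<sigma> / M\<close>
      there.\<close>
    have "\<exists>k\<in>{M..<T}. (a (Suc k))\<^sup>2 \<le> 25 / 16 * \<sigma>\<^sup>2 / real M"
    proof (rule ccontr)
      assume "\<not> (\<exists>k\<in>{M..<T}. (a (Suc k))\<^sup>2 \<le> 25 / 16 * \<sigma>\<^sup>2 / real M)"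
      then have "(\<Sum>k\<in>{M..<T}. 25 / 16 * \<sigma>\<^sup>2 / real M) < (\<Sum>k\<in>{M..<T}. (a (Suc k))\<^sup>2)"
        using M(3) by (intro sum_strict_mono) (auto simp: T_def not_le)
      also have "\<dots> \<le> (\<Sum>k=1..T. (a (Suc k))\<^sup>2)" using M(3) by (intro sum_mono2) auto
      also have "\<dots> \<le> 25 / 16 * \<sigma>\<^sup>2" by (rule sum_a)
      finally show False using M(3) by (simp add: T_def)
    qed
    then show ?thesis using that by auto
  qed
  define k1 where "k1 = Suc k0"
  have k1: "k1 \<in> {1..T}" "M \<le> k1" "1 \<le> k1" using k0 M(3) by (auto simp: k1_def)
  have good: "subopt_nc Lf f h A b (xs k1) \<le> \<epsilon>"
  proof -
    define s where "s = \<sigma> / sqrt (real M)"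
    have sM: "1 \<le> sqrt (real M)" using M(3) by simp
    have "sqrt (real M) * sqrt (real M) = real M" by simp
    then have "sqrt (real M) \<le> real M" using sM by (metis mult_le_cancel_left1 not_le order_trans zero_le_one)
    have "\<delta> k1 \<le> \<sigma> / (2 * real M)"
      unfolding \<delta>_def \<sigma>_def[symmetric] using \<sigma>(1) k1 M(3) by (intro divide_left_mono) auto
    also have "\<dots> \<le> \<sigma> / (2 * sqrt (real M))"
      using \<sigma>(1) sM \<open>sqrt (real M) \<le> real M\<close> M(3) by (intro divide_left_mono) auto
    finally have "norm (xs k1 - c k1) \<le> s / 2" using acc[OF k1(3)] by (simp add: s_def)
    moreover have "a k1 \<le> 5 / 4 * s"
    proof (rule power2_le_imp_le)
      show "(a k1)\<^sup>2 \<le> (5 / 4 * s)\<^sup>2"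
        using k0(3) by (simp add: k1_def s_def power_mult_distrib power_divide)
      show "0 \<le> 5 / 4 * s" using \<sigma>(1) by (simp add: s_def)
    qed
    ultimately have "5 / 2 * norm (xs k1 - c k1) + a k1 \<le> 5 / 2 * s" by linarith
    then have "Lf * (5 / 2 * norm (xs k1 - c k1) + a k1) \<le> Lf * (5 / 2 * s)"
      using Lf by (intro mult_left_mono) auto
    with subopt_nc_le[OF Lf f h A kkt_c[of k1, unfolded \<phi>_def], of "xs k1"]
    have "subopt_nc Lf f h A b (xs k1) \<le> Lf * (5 / 2 * s)" unfolding a_def by (rule order_trans)
    also have "\<dots> \<le> \<epsilon>"
    proof (rule power2_le_imp_le)
      have "(Lf * (5 / 2 * s))\<^sup>2 = 25 / 4 * (Lf * \<Delta>) / real M"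
        unfolding s_def power_mult_distrib power_divide \<sigma>(2)
        using Lf by (simp add: power2_eq_square)
      also have "\<dots> = 25 / 4 * x * \<epsilon>\<^sup>2 / real M" using \<epsilon> by (simp add: x_def)
      also have "\<dots> \<le> real M * \<epsilon>\<^sup>2 / real M" using M(1) by (intro divide_right_mono mult_right_mono) auto
      also have "\<dots> = \<epsilon>\<^sup>2" using M(3) by simp
      finally show "(Lf * (5 / 2 * s))\<^sup>2 \<le> \<epsilon>\<^sup>2" .
    qed (use \<epsilon> in simp)
    finally show ?thesis .
  qed
  \<comment> \<open>The argument of the logarithm in \<open>soft_O\<close>. All summands are
    nonnegative, so every parameter is at most \<open>S\<close>.\<close>
  define S where "S = exp 1 + sum_list
    [Lf, 1 / Lf, op_norm A, 1 / min_singular A, \<Delta>, 1 / \<Delta>, 1 / \<epsilon>, D, 1 / D, R]"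
  have mpos: "0 < min_singular A" using min_singular_bounds(1)[OF A] .
  have R0: "0 \<le> R" using R norm_ge_zero order_trans by blast
  have le_S: "exp 1 \<le> S" "Lf \<le> S" "1 / Lf \<le> S" "op_norm A \<le> S" "1 / min_singular A \<le> S" "\<Delta> \<le> S"
    "1 / \<Delta> \<le> S" "1 / \<epsilon> \<le> S" "D \<le> S" "1 / D \<le> S" "R \<le> S"
  proof -
    have "0 \<le> 1 / Lf" "0 \<le> op_norm A" "0 \<le> 1 / min_singular A" "0 \<le> 1 / \<Delta>" "0 \<le> 1 / \<epsilon>" "0 \<le> 1 / D"
      "0 \<le> exp (1::real)"
      using Lf op_norm_nonneg[of A] mpos \<Delta> \<epsilon> D by simp_all
    moreover have "S = exp 1 + (Lf + (1 / Lf + (op_norm A + (1 / min_singular A + (\<Delta> + (1 / \<Delta> +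
        (1 / \<epsilon> + (D + (1 / D + R)))))))))" by (simp add: S_def)
    ultimately show "exp 1 \<le> S" "Lf \<le> S" "1 / Lf \<le> S" "op_norm A \<le> S" "1 / min_singular A \<le> S" "\<Delta> \<le> S"
        "1 / \<Delta> \<le> S" "1 / \<epsilon> \<le> S" "D \<le> S" "1 / D \<le> S" "R \<le> S"
      using Lf \<Delta> D R0 by linarith+
  qed
  have S2: "2 \<le> S" using le_S(1) exp_ge_add_one_self[of "1::real"] by linarith
  have p1: "u \<le> S ^ 1" if "u \<le> S" for u using that by simp
  have two: "2 \<le> S ^ 1" using S2 by simp
  have \<sigma>S: "\<sigma> \<le> S" unfolding \<sigma>_def
  proof (rule real_le_lsqrt)
    show "\<Delta> / Lf \<le> S\<^sup>2"
      using le_power_mult[OF p1[OF le_S(6)] p1[OF le_S(3)]] \<Delta> Lf by (simp add: numeral_2_eq_2)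
  qed (use S2 in simp)
  have \<sigma>S': "1 / \<sigma> \<le> S"
  proof -
    have "1 / \<sigma> = sqrt (Lf * (1 / \<Delta>))" by (simp add: \<sigma>_def real_sqrt_divide)
    also have "\<dots> \<le> S"
    proof (rule real_le_lsqrt)
      show "Lf * (1 / \<Delta>) \<le> S\<^sup>2"
        using le_power_mult[OF p1[OF le_S(2)] p1[OF le_S(7)]] \<Delta> Lf by (simp add: numeral_2_eq_2)
    qed (use S2 in simp)
    finally show ?thesis .
  qed
  have xS: "x \<le> S ^ 4"
  proof -
    have "Lf * \<Delta> * (1 / \<epsilon> * (1 / \<epsilon>)) \<le> S ^ (1 + 1 + (1 + 1))"
      using Lf \<Delta> \<epsilon> by (intro le_power_mult p1 le_S) auto
    then show ?thesis by (simp add: x_def power2_eq_square numeral_eq_Suc)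
  qed
  \<comment> \<open>From \<open>T = 2 * M \<le> 25/2 * x + 4\<close>.\<close>
  have T_le: "real T \<le> 17 * max 1 x"
    using M(2) unfolding T_def by (simp add: max_def)
  have TS: "real T \<le> S ^ 10"
  proof -
    have "17 * max 1 x \<le> S ^ (5 + 5)"
    proof (rule le_power_mult)
      show "17 \<le> S ^ 5" by (rule le_power_const[OF _ S2]) simp
      have "1 \<le> S ^ 5" using S2 by simp
      moreover have "x \<le> S ^ 5" by (rule order_trans[OF xS power_increasing]) (use S2 in auto)
      ultimately show "max 1 x \<le> S ^ 5" by simp
    qed auto
    then show ?thesis using T_le by simp
  qed
  have kS: "real k \<le> S ^ 10" if "k \<in> {1..T}" for k using that TS by (smt (verit) atLeastAtMost_iff of_nat_mono)
  \<comment> \<open>The descent says nothing about the first displacement; there the assumed bound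
    \<open>R\<close> takes over.\<close>
  have aS: "a k \<le> S ^ 2" if k: "1 \<le> k" for k
  proof (cases "k = 1")
    case True
    have "a 1 = norm (x0 - c 1)" by (simp add: a_def xs0 norm_minus_commute)
    then have "a 1 \<le> S" using R le_S(11) unfolding c1 by linarith
    also have "S * 1 \<le> S * S" using S2 by (intro mult_left_mono) auto
    finally show ?thesis using True by (simp add: power2_eq_square)
  next
    case False
    then obtain j where j: "k = Suc j" "1 \<le> j" using k by (cases k) auto
    have "a k \<le> 2 * \<sigma>" using a_le[OF j(2)] \<sigma>(1) j(1) by simp
    also have "\<dots> \<le> S ^ (1 + 1)" using \<sigma>(1) by (intro le_power_mult p1 \<sigma>S two) auto
    finally show ?thesis by (simp add: numeral_2_eq_2)
  qed
  have a0: "0 \<le> a k" for k by (simp add: a_def)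
  \<comment> \<open>Each round moves the exact solution by at most \<open>S ^ 3\<close>, so the
    drift is linear in the number of rounds, which is enough inside a logarithm.\<close>
  have c_dist: "norm (c (Suc k) - c 1) \<le> real k * S ^ 3" for k
  proof (induction k)
    case (Suc k)
    have "norm (c (Suc (Suc k)) - c (Suc k)) \<le> a (Suc (Suc k)) + \<delta> (Suc k)"
      using norm_triangle_ineq[of "c (Suc (Suc k)) - xs (Suc k)" "xs (Suc k) - c (Suc k)"] acc[of "Suc k"]
      by (simp add: a_def)
    also have "\<delta> (Suc k) \<le> S ^ 1"
    proof -
      have "\<delta> (Suc k) \<le> \<sigma> / 1" unfolding \<delta>_def \<sigma>_def[symmetric] using \<sigma>(1) by (intro divide_left_mono) auto
      then show ?thesis using \<sigma>S by simp
    qed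
    also have "a (Suc (Suc k)) + S ^ 1 \<le> S ^ 3" by (rule le_power_add[OF aS order_refl]) (use S2 in auto)
    finally have "norm (c (Suc (Suc k)) - c (Suc k)) \<le> S ^ 3" by simp
    then have "norm (c (Suc (Suc k)) - c 1) \<le> S ^ 3 + real k * S ^ 3"
      using Suc norm_triangle_ineq[of "c (Suc (Suc k)) - c (Suc k)" "c (Suc k) - c 1"] by simp
    then show ?case by (simp add: distrib_right)
  qed simp
  \<comment> \<open>\<open>lam0 k\<close> is known to be near \<open>w 1\<close>, while the cost of
    round \<open>k\<close> depends on its distance to \<open>w k\<close>. Stationarity expresses
    \<open>A\<^sup>T (w 1 - w k)\<close> by differences of \<open>gradient f\<close> and
    displacements, and dividing by \<open>min_singular A\<close> bounds the multipliers.\<close>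
  have wS: "norm (lam0 k - w k) \<le> S ^ 17" if k: "k \<in> {1..T}" for k
  proof -
    have k_1: "1 \<le> k" using k by simp
    have "norm (c k - c 1) \<le> S ^ 13"
    proof -
      have "norm (c k - c 1) \<le> real (k - 1) * S ^ 3" using c_dist[of "k - 1"] k by simp
      also have "\<dots> \<le> S ^ (10 + 3)"
        using kS[OF k] S2 by (intro le_power_mult) auto
      finally show ?thesis by simp
    qed
    then have "Lf * norm (c k - c 1) \<le> S ^ (1 + 13)" using Lf by (intro le_power_mult p1 le_S) auto
    moreover have "2 * Lf * (a k + a 1) \<le> S ^ (1 + 1 + 3)"
      using Lf a0 S2 le_power_add[OF aS[OF k_1] aS[of 1], of 3]
      by (intro le_power_mult p1 le_S two) (auto intro: add_nonneg_nonneg)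
    ultimately have sum15: "Lf * norm (c k - c 1) + 2 * Lf * (a k + a 1) \<le> S ^ 15"
      by (rule le_power_add) (use S2 in auto)
    have gk: "gradient (\<phi> (xs (k - 1))) (c k) = - (transpose A *v w k)"
      and g1: "gradient (\<phi> (xs (1 - 1))) (c 1) = - (transpose A *v w 1)"
      using kkt_c[of k] kkt_c[of 1] by (simp_all add: kkt_pair_def)
    have "transpose A *v (w 1 - w k) = (gradient f (c k) - gradient f (c 1))
        + ((2 * Lf) *\<^sub>R (c k - xs (k - 1)) - (2 * Lf) *\<^sub>R (c 1 - xs (1 - 1)))"
    proof -
      have "transpose A *v w k = - gradient (\<phi> (xs (k - 1))) (c k)"
        and "transpose A *v w 1 = - gradient (\<phi> (xs (1 - 1))) (c 1)"
        unfolding gk g1 by simp_all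
      then show ?thesis unfolding matrix_vector_mult_diff_distrib grad by simp
    qed
    then have "norm (transpose A *v (w 1 - w k)) \<le> norm (gradient f (c k) - gradient f (c 1))
        + norm ((2 * Lf) *\<^sub>R (c k - xs (k - 1)) - (2 * Lf) *\<^sub>R (c 1 - xs (1 - 1)))"
      by (metis norm_triangle_ineq)
    also have "\<dots> \<le> Lf * norm (c k - c 1) + (2 * Lf * a k + 2 * Lf * a 1)"
    proof (rule add_mono[OF smooth_fun_lipschitz[OF f]])
      show "norm ((2 * Lf) *\<^sub>R (c k - xs (k - 1)) - (2 * Lf) *\<^sub>R (c 1 - xs (1 - 1)))
          \<le> 2 * Lf * a k + 2 * Lf * a 1"
        using norm_triangle_ineq4[of "(2 * Lf) *\<^sub>R (c k - xs (k - 1))" "(2 * Lf) *\<^sub>R (c 1 - xs (1 - 1))"] Lf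
        unfolding a_def norm_scaleR by simp
    qed
    also have "\<dots> \<le> S ^ 15" using sum15 by (simp add: distrib_left)
    finally have "min_singular A * norm (w 1 - w k) \<le> S ^ 15"
      using min_singular_bounds(2)[OF A, of "w 1 - w k"] by linarith
    then have "norm (w 1 - w k) \<le> S ^ 15 * (1 / min_singular A)" using mpos by (simp add: field_simps)
    also have "\<dots> \<le> S ^ (15 + 1)" using S2 mpos by (intro le_power_mult p1 le_S) auto
    finally have "norm (w 1 - w k) \<le> S ^ 16" by simp
    moreover have "norm (lam0 k - w 1) \<le> S ^ 1" using R'[OF k_1] le_S(11) unfolding w1 by simp
    ultimately have "norm (lam0 k - w 1) + norm (w 1 - w k) \<le> S ^ 17"
      using S2 by (intro le_power_add[of _ _ 1 _ 16]) auto
    then show ?thesis using norm_triangle_ineq[of "lam0 k - w 1" "w 1 - w k"] by simp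
  qed
  define \<kappa> where "\<kappa> = cond_number A"
  have \<kappa>0: "0 \<le> \<kappa>" using mpos by (simp add: \<kappa>_def cond_number_def op_norm_nonneg)
  have N_k: "real (Ns k) \<le> 350000 * \<kappa> * (ln S)\<^sup>2" if k: "k \<in> {1..T}" for k
  proof -
    have k_1: "1 \<le> k" using k by simp
    have "1 / \<delta> k = 2 * real k * (1 / \<sigma>)" by (simp add: \<delta>_def \<sigma>_def)
    also have "\<dots> \<le> S ^ (1 + 10 + 1)"
      using kS[OF k] \<sigma>(1) by (intro le_power_mult p1 \<sigma>S' two) auto
    finally have "1 / \<delta> k \<le> S ^ 12" by simp
    then have "inner_cost Lf A D (\<delta> k) (a k) (norm (lam0 k - w k)) \<le> 350000 * \<kappa> * (ln S)\<^sup>2"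
      unfolding \<kappa>_def using Lf D \<delta>_pos[OF k_1] aS[OF k_1] wS[OF k] a0
      by (intro inner_cost_le A le_S) auto
    then show ?thesis using cost[OF k_1] by linarith
  qed
  define N where "N = (\<Sum>k=1..T. Ns k)"
  have "real N = (\<Sum>k=1..T. real (Ns k))" by (simp add: N_def)
  also have "\<dots> \<le> (\<Sum>k=1..T. 350000 * \<kappa> * (ln S)\<^sup>2)" by (intro sum_mono N_k)
  also have "\<dots> = real T * (350000 * \<kappa> * (ln S)\<^sup>2)" by simp
  also have "\<dots> \<le> 17 * max 1 x * (350000 * \<kappa> * (ln S)\<^sup>2)"
    using T_le \<kappa>0 by (intro mult_right_mono) auto
  also have "\<dots> = 5950000 * (\<kappa> * max 1 x * (ln S)\<^sup>2)" by simp
  also have "\<dots> \<le> 10 ^ 12 * (\<kappa> * max 1 x * (ln S)\<^sup>2)"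
    using \<kappa>0 by (intro mult_right_mono) auto
  \<comment> \<open>The 1 stems from rounding up the number of rounds; times \<open>\<kappa>\<close>
    it becomes the cost of a single subproblem in the maximum.\<close>
  also have "\<kappa> * max 1 x = max \<kappa> (\<kappa> * Lf * \<Delta> / \<epsilon>\<^sup>2)"
    using \<kappa>0 by (simp add: max_mult_distrib_left x_def)
  finally have "real N \<le> 10 ^ 12 * max \<kappa> (\<kappa> * Lf * \<Delta> / \<epsilon>\<^sup>2) * (ln S)\<^sup>2" by (simp only: mult.assoc)
  then have "soft_O N (max (cond_number A) (cond_number A * Lf * \<Delta> / \<epsilon>\<^sup>2))
      [Lf, 1 / Lf, op_norm A, 1 / min_singular A, \<Delta>, 1 / \<Delta>, 1 / \<epsilon>, D, 1 / D, R]"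
    by (simp only: soft_O_def S_def \<kappa>_def)
  moreover have "ippm_returns f h A b Lf l D x0 lam0 (\<lambda>k. sqrt (\<Delta> / Lf) / (2 * real k)) T N xs"
    unfolding ippm_returns_def using xs0 ret
    by (intro conjI exI[of _ Ns]) (auto simp: N_def \<delta>_def \<phi>_def)
  ultimately show ?thesis
    unfolding finds_within_def l_def using good k1(1) by blast
qed

theorem corollary2:
  fixes f :: "real^'n \<Rightarrow> real" and h :: "real^'m \<Rightarrow> ereal"
    and A :: "real^'n^'m" and b :: "real^'m" and Lf :: real
  assumes "0 < Lf" and "smooth_fun Lf f"
    and "proper_closed_convex h"
    and "rank A = CARD('m)"
  shows "\<exists>l \<ge> mu_dual (3 * Lf) A.
    \<forall>x0 lam0 D R \<epsilon>.
      0 < D \<longrightarrow> 0 < \<epsilon> \<longrightarrow>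
      norm (x0 - primal_sol (prox_smooth_part Lf f x0) h A b) \<le> R \<longrightarrow>
      (\<forall>k\<ge>1. norm (lam0 k - dual_sol (prox_smooth_part Lf f x0) h A b) \<le> R) \<longrightarrow>
      (\<forall>\<Delta>'>0.
         objective f h A b (primal_sol (prox_smooth_part Lf f x0) h A b)
           - (INF x. objective f h A b x) \<le> ereal \<Delta>' \<longrightarrow>
         finds_within f h A b Lf l D x0 lam0 R \<Delta>' \<epsilon>) \<and>
      (\<forall>\<Delta>>0.
         objective f h A b x0 < \<infinity> \<longrightarrow>
         objective f h A b x0 - (INF x. objective f h A b x) \<le> ereal \<Delta> \<longrightarrow>
         finds_within f h A b Lf l D x0 lam0 R \<Delta> \<epsilon>)"
proof -
  have A: "surj ((*v) A)" using assms(4) full_rank_surjective by blast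
  \<comment> \<open>\<open>x0\<close> competes in the first subproblem with zero penalty, so the gap
    at \<open>x0\<close> dominates the gap at the exact solution and the second claim reduces to the
    first.\<close>
  have first_step: "objective f h A b (primal_sol (prox_smooth_part Lf f x0) h A b) \<le> objective f h A b x0"
    for x0
  proof -
    define \<phi> where "\<phi> = prox_smooth_part Lf f x0"
    have \<phi>: "smooth_strongly_convex (3 * Lf) Lf \<phi>"
      unfolding \<phi>_def by (rule prox_smooth_part_regularity(1)[OF assms(2,1)])
    obtain x w where kkt: "kkt_pair \<phi> h A b x w"
      using kkt_pair_exists[OF \<phi> assms(3) A] by blast
    obtain t where t: "h (A *v x - b) = ereal t"
      using kkt by (auto simp: kkt_pair_def elim: subgradientE)
    have "objective f h A b x \<le> objective \<phi> h A b x + ereal (Lf / 2 * (norm (x0 - x))\<^sup>2)"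
      using assms(1) by (simp add: objective_def t \<phi>_def prox_smooth_part_def)
    also have "\<dots> \<le> objective \<phi> h A b x0" by (rule kkt_pair_growth[OF \<phi> kkt])
    also have "\<dots> = objective f h A b x0" by (simp add: objective_def \<phi>_def prox_smooth_part_def)
    finally show ?thesis using kkt_pair_primal_sol[OF \<phi> kkt] by (simp add: \<phi>_def)
  qed
  show ?thesis
  proof (intro exI[of _ "mu_dual (3 * Lf) A"] conjI allI impI)
    fix x0 :: "real^'n" and lam0 :: "nat \<Rightarrow> real^'m" and D R \<epsilon> \<Delta>' :: real
    assume "0 < D" "0 < \<epsilon>" "norm (x0 - primal_sol (prox_smooth_part Lf f x0) h A b) \<le> R"
      "\<forall>k\<ge>1. norm (lam0 k - dual_sol (prox_smooth_part Lf f x0) h A b) \<le> R"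
      "0 < \<Delta>'"
      "objective f h A b (primal_sol (prox_smooth_part Lf f x0) h A b)
        - (INF x. objective f h A b x) \<le> ereal \<Delta>'"
    then show "finds_within f h A b Lf (mu_dual (3 * Lf) A) D x0 lam0 R \<Delta>' \<epsilon>"
      by (intro finds_within_of_gap assms A) auto
  next
    fix x0 :: "real^'n" and lam0 :: "nat \<Rightarrow> real^'m" and D R \<epsilon> \<Delta> :: real
    assume *: "0 < D" "0 < \<epsilon>" "norm (x0 - primal_sol (prox_smooth_part Lf f x0) h A b) \<le> R"
      "\<forall>k\<ge>1. norm (lam0 k - dual_sol (prox_smooth_part Lf f x0) h A b) \<le> R"
      "0 < \<Delta>" and gap: "objective f h A b x0 - (INF x. objective f h A b x) \<le> ereal \<Delta>"
    have "objective f h A b (primal_sol (prox_smooth_part Lf f x0) h A b)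
        - (INF x. objective f h A b x) \<le> ereal \<Delta>"
      using ereal_minus_mono[OF first_step order_refl] gap by (rule order_trans)
    with * show "finds_within f h A b Lf (mu_dual (3 * Lf) A) D x0 lam0 R \<Delta> \<epsilon>"
      by (intro finds_within_of_gap assms A) auto
  qed simp
qed

end
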